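(* Suppose $f\in L^2([0,1))$ is such that $\#\operatorname{argmin}H_\gamma^\infty(\cdot,f)=1$ for all but a countable number of $\gamma>0$ and $\#\operatorname{argmin}H_\gamma^\infty(\cdot,f)\le2$ for all $\gamma\ge0$. Then $\tau$ is uniquely determined by the requirement that $\tau\in D([0,\infty),L^2([0,1)))$ and $\tau(\zeta)\in\operatorname{argmin}H^\infty_{1/\zeta}(\cdot,f)$ for all $\zeta\ge0$. Moreover, for any empirical scale spaces $\hat\tau_n\in D([0,\infty),L^2([0,1)))$ with $\hat\tau_n(\zeta)\in\iota^n(\operatorname{argmin}H_{1/\zeta}(\cdot,Y_n))$ for all $\zeta\ge0$, $n\in\mathbb{N}$, $$\hat\tau_n\xrightarrow[n\to\infty]{}\tau\qquad\mathbb{P}\text{-a.s.}$$ holds both in $D([0,\infty),D([0,1)))$ and in $D([0,\infty),L^2([0,1)))$, each equipped with the Skorokhod $J_1$ topology.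
   Context: Regression model: for $n\in\mathbb{N}$ and $1\le i\le n$, $Y_{i,n}=\bar f_{i,n}+\xi_{i,n}$, where $\bar f_{i,n}=n\int_{(i-1)/n}^{i/n}f(u)\,du$ and $(\xi_{i,n})_{1\le i\le n,\,n\in\mathbb{N}}$ is a triangular array of zero-mean real random variables on a probability space with measure $\mathbb{P}$. Write $Y_n=(Y_{1,n},\dots,Y_{n,n})$. Standing assumption on the noise (Condition (A)): for each $n$ the variables $(\xi_{i,n})_{1\le i\le n}$ are independent, and there is a (deterministic) sequence $(\beta_n)_{n\in\mathbb{N}}$ with $\beta_n/n\to0$ such that $\mathbb{P}$-a.s., for all but finitely many $n$, $\max_{1\le i\le j\le n}\frac{(\xi_{i,n}+\cdots+\xi_{j,n})^2}{j-i+1}\le\beta_n$. For $u\in\mathbb{R}^n$ let $J(u)=\{i:1\le i\le n-1,\ u_i\ne u_{i+1}\}$ and $H_\gamma(u,Y_n)=\gamma\,\#J(u)+\frac1n\sum_{i=1}^n(u_i-Y_{i,n})^2$. $\operatorname{argmin}F$ denotes the whole set of minimizers of $F$. The map $\iota^n:\mathbb{R}^n\to L^2([0,1))$ is $\iota^n(u)=\sum_{i=1}^n u_i\mathbf{1}_{[(i-1)/n,i/n)}$. $S([0,1))=\operatorname{span}\{\mathbf 1_{[s,t)}:0\le s<t\le1\}$ is the space of step functions; for $g\in S([0,1))$, $\mathcal J(g)=\{t\in(0,1):g(t-)\ne g(t+)\}$. $\|\cdot\|$ is the norm of $L^2([0,1))$. For $\gamma>0$ and $g,f\in L^2([0,1))$,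 $H_\gamma^\infty(g,f)=\gamma\,\#\mathcal J(g)+\|f-g\|^2$ if $g\in S([0,1))$, and $=\infty$ otherwise; $H_0^\infty(g,f)=\|f-g\|^2$ for all $g\in L^2([0,1))$. Conventions: $1/0=\infty$, and for $\gamma=\infty$ one uses $\infty\cdot0=0$, so that $\operatorname{argmin}H^\infty_\infty(\cdot,f)$ consists only of the constant function with value $\int_0^1f(u)\,du$, and $\operatorname{argmin}H_\infty(\cdot,Y_n)$ consists only of the constant vector with entries $\frac1n\sum_iY_{i,n}$. $D([0,1))$ is the space of real functions on $[0,1]$ that are right continuous with left limits and left continuous at $1$; step functions are regarded as elements of it via their right continuous representatives (extended to $1$ by left continuity). It carries the metric $\rho_S(f,g)=\inf\{\max(L(\lambda),\sup_{0\le t\le1}|f(\lambda(t))-g(t)|):\lambda\in\Lambda_1\}$, where $\Lambda_1$ is the set of strictly increasing continuous maps of $[0,1]$ onto $[0,1]$ and $L(\lambda)=\sup_{s\ne t}\left|\log\frac{\lambda(t)-\lambda(s)}{t-s}\right|$. For a metric space $(\Theta,\rho)$, $D([0,\infty),\Theta)$ is the space of functions $[0,\infty)\to\Theta$ that are right continuous with left limits. Its Skorokhod $J_1$ topology is induced by the metric $\inf_{\lambda\in\Lambda_\infty}\max\left(L(\lambda),\int_0^\infty e^{-u}\sup_{t\ge0}\min\{1,\rho(f(\lambda(t)\wedge u),g(t\wedge u))\}\,du\right)$, where $\Lambda_\infty$ is the set of strictly increasing continuous maps $\lambda$ of $[0,\infty)$ onto $[0,\infty)$ and $L(\lambda)=\sup_{s\ne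 t\ge0}\left|\log\frac{\lambda(t)-\lambda(s)}{t-s}\right|$. *)

theory Defs
  imports "HOL-Probability.Probability" "HOL-Real_Asymp.Real_Asymp"
begin

abbreviation leb01 :: "real measure" where
  "leb01 \<equiv> lebesgue_on {0..<1}"

definition square_integrable01 :: "(real \<Rightarrow> real) \<Rightarrow> bool" where
  "square_integrable01 f \<longleftrightarrow> f \<in> borel_measurable leb01 \<and> integrable leb01 (\<lambda>x. (f x)\<^sup>2)"

lemma square_integrable01_mult:
  assumes "square_integrable01 f" "square_integrable01 g"
  shows "integrable leb01 (\<lambda>x. f x * g x)"
proof (rule Bochner_Integration.integrable_bound)
  show "integrable leb01 (\<lambda>x. (f x)\<^sup>2 + (g x)\<^sup>2)"
    using assms by (auto simp: square_integrable01_def)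
  show "(\<lambda>x. f x * g x) \<in> borel_measurable leb01"
    using assms by (auto simp: square_integrable01_def)
  have "\<bar>a * b\<bar> \<le> \<bar>a\<^sup>2 + b\<^sup>2\<bar>" for a b :: real
  proof -
    have "2 * (\<bar>a\<bar> * \<bar>b\<bar>) \<le> a\<^sup>2 + b\<^sup>2"
      using sum_squares_bound[of "\<bar>a\<bar>" "\<bar>b\<bar>"] by simp
    moreover have "0 \<le> \<bar>a\<bar> * \<bar>b\<bar>" by simp
    ultimately show ?thesis unfolding abs_mult by linarith
  qed
  then show "AE x in leb01. norm (f x * g x) \<le> norm ((f x)\<^sup>2 + (g x)\<^sup>2)" by simp
qed

lemma square_integrable01_add:
  assumes "square_integrable01 f" "square_integrable01 g"
  shows "square_integrable01 (\<lambda>x. f x + g x)"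
proof -
  have "(\<lambda>x. (f x + g x)\<^sup>2) = (\<lambda>x. (f x)\<^sup>2 + (g x)\<^sup>2 + 2 * (f x * g x))"
    by (simp add: fun_eq_iff power2_sum algebra_simps)
  then show ?thesis
    using assms square_integrable01_mult[OF assms] by (auto simp: square_integrable01_def)
qed

lemma square_integrable01_scale:
  "square_integrable01 f \<Longrightarrow> square_integrable01 (\<lambda>x. c * f x)"
  by (auto simp: square_integrable01_def power_mult_distrib)

lemma square_integrable01_uminus:
  "square_integrable01 f \<Longrightarrow> square_integrable01 (\<lambda>x. - f x)"
  by (auto simp: square_integrable01_def)

lemma square_integrable01_diff:
  "square_integrable01 f \<Longrightarrow> square_integrable01 g \<Longrightarrow> square_integrable01 (\<lambda>x. f x - g x)"
  using square_integrable01_add[of f "\<lambda>x. - g x"] square_integrable01_uminus[of g] by simp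

lemma square_integrable01_0: "square_integrable01 (\<lambda>x. 0)"
  by (simp add: square_integrable01_def)

lemma leb01_measure: "emeasure leb01 (space leb01) = 1"
  by (simp add: emeasure_restrict_space)

lemma finite_measure_leb01: "finite_measure leb01"
  by (rule finite_measureI) (simp only: leb01_measure, simp)

lemma square_integrable01_indicator: "square_integrable01 (indicator {s..<t})"
proof -
  interpret finite_measure leb01 by (rule finite_measure_leb01)
  have m: "(indicator {s..<t} :: real \<Rightarrow> real) \<in> borel_measurable leb01"
    by (intro measurable_restrict_space1 borel_measurable_indicator) auto
  have "integrable leb01 (indicator {s..<t} :: real \<Rightarrow> real)"
    by (rule integrable_const_bound[where B = 1]) (auto simp: m indicator_def)
  moreover have "(\<lambda>x. (indicator {s..<t} x :: real)\<^sup>2) = indicator {s..<t}"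
    by (auto simp: indicator_def)
  ultimately show ?thesis using m by (simp add: square_integrable01_def)
qed

text \<open>The space \<open>L\<^sup>2([0,1))\<close> of almost-everywhere classes.\<close>

quotient_type L2 = "real \<Rightarrow> real" / partial:
  "\<lambda>f g. square_integrable01 f \<and> square_integrable01 g \<and> (AE x in leb01. f x = g x)"
proof (rule part_equivpI)
  show "\<exists>f. square_integrable01 f \<and> square_integrable01 f \<and> (AE x in leb01. f x = f x)"
    using square_integrable01_0 by auto
  show "symp (\<lambda>f g. square_integrable01 f \<and> square_integrable01 g \<and> (AE x in leb01. f x = g x))"
    by (auto intro!: sympI)
  show "transp (\<lambda>f g. square_integrable01 f \<and> square_integrable01 g \<and> (AE x in leb01. f x = g x))"
    by (auto intro!: transpI)
qed

instantiation L2 :: real_inner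
begin

lift_definition zero_L2 :: L2 is "\<lambda>x. 0" by (simp add: square_integrable01_0)
lift_definition plus_L2 :: "L2 \<Rightarrow> L2 \<Rightarrow> L2" is "\<lambda>f g x. f x + g x"
  by (auto intro: square_integrable01_add)
lift_definition minus_L2 :: "L2 \<Rightarrow> L2 \<Rightarrow> L2" is "\<lambda>f g x. f x - g x"
  by (auto intro: square_integrable01_diff)
lift_definition uminus_L2 :: "L2 \<Rightarrow> L2" is "\<lambda>f x. - f x"
  by (auto intro: square_integrable01_uminus)
lift_definition scaleR_L2 :: "real \<Rightarrow> L2 \<Rightarrow> L2" is "\<lambda>c f x. c * f x"
  by (auto intro: square_integrable01_scale)
lift_definition inner_L2 :: "L2 \<Rightarrow> L2 \<Rightarrow> real" is "\<lambda>f g. LINT x|leb01. f x * g x"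
proof -
  fix f f' g g' :: "real \<Rightarrow> real"
  assume f: "square_integrable01 f \<and> square_integrable01 f' \<and> (AE x in leb01. f x = f' x)"
    and g: "square_integrable01 g \<and> square_integrable01 g' \<and> (AE x in leb01. g x = g' x)"
  then have "AE x in leb01. f x = f' x" "AE x in leb01. g x = g' x" by auto
  then have "AE x in leb01. f x * g x = f' x * g' x" by eventually_elim simp
  moreover have "(\<lambda>x. f x * g x) \<in> borel_measurable leb01" "(\<lambda>x. f' x * g' x) \<in> borel_measurable leb01"
    using f g by (auto intro!: borel_measurable_times simp: square_integrable01_def)
  ultimately show "(LINT x|leb01. f x * g x) = (LINT x|leb01. f' x * g' x)"
    by (intro integral_cong_AE)
qed

definition norm_L2 :: "L2 \<Rightarrow> real" where "norm_L2 f = sqrt (inner f f)"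
definition dist_L2 :: "L2 \<Rightarrow> L2 \<Rightarrow> real" where "dist_L2 f g = norm (f - g)"
definition sgn_L2 :: "L2 \<Rightarrow> L2" where "sgn_L2 f = inverse (norm f) *\<^sub>R f"
definition uniformity_L2 :: "(L2 \<times> L2) filter"
  where "uniformity_L2 = (INF e\<in>{0<..}. principal {(x, y). dist x y < e})"
definition open_L2 :: "L2 set \<Rightarrow> bool"
  where "open_L2 U = (\<forall>x\<in>U. eventually (\<lambda>(x', y). x' = x \<longrightarrow> y \<in> U) uniformity)"

instance
proof
  fix a b c :: L2 and r s :: real
  show "a + b + c = a + (b + c)"
    by transfer (auto simp: algebra_simps intro: square_integrable01_add)
  show "a + b = b + a"
    by transfer (auto simp: algebra_simps intro: square_integrable01_add)
  show "0 + a = a" by transfer auto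
  show "- a + a = 0" by transfer (auto simp: square_integrable01_0)
  show "a - b = a + - b"
    by transfer (auto intro: square_integrable01_diff)
  show "r *\<^sub>R (a + b) = r *\<^sub>R a + r *\<^sub>R b"
    by transfer (auto simp: algebra_simps intro!: square_integrable01_add square_integrable01_scale)
  show "(r + s) *\<^sub>R a = r *\<^sub>R a + s *\<^sub>R a"
    by transfer (auto simp: algebra_simps intro!: square_integrable01_add square_integrable01_scale)
  show "r *\<^sub>R s *\<^sub>R a = (r * s) *\<^sub>R a"
    by transfer (auto simp: algebra_simps intro!: square_integrable01_scale)
  show "1 *\<^sub>R a = a" by transfer auto
  show "inner a b = inner b a" by transfer (simp add: mult.commute)
  show "inner (a + b) c = inner a c + inner b c"
    by transfer (auto simp: distrib_right intro!: Bochner_Integration.integral_add square_integrable01_mult)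
  show "inner (r *\<^sub>R a) b = r * inner a b"
    by transfer (simp add: mult.assoc)
  show "0 \<le> inner a a" by transfer simp
  show "(inner a a = 0) = (a = 0)"
  proof transfer
    fix f :: "real \<Rightarrow> real"
    assume f: "square_integrable01 f \<and> square_integrable01 f \<and> (AE x in leb01. f x = f x)"
    then have "integrable leb01 (\<lambda>x. f x * f x)" by (auto intro: square_integrable01_mult)
    from integral_nonneg_eq_0_iff_AE[OF this] have "((LINT x|leb01. f x * f x) = 0) = (AE x in leb01. f x * f x = 0)"
      by simp
    then show "((LINT x|leb01. f x * f x) = 0) =
       (square_integrable01 f \<and> square_integrable01 (\<lambda>x. 0) \<and> (AE x in leb01. f x = 0))"
      using f by (simp add: square_integrable01_0)
  qed
qed (simp_all only: norm_L2_def dist_L2_def sgn_L2_def uniformity_L2_def open_L2_def)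

end

lift_definition L2_indicator :: "real \<Rightarrow> real \<Rightarrow> L2" is "\<lambda>s t. indicator {s..<t}"
  by (simp add: square_integrable01_indicator)

lift_definition L2_integral :: "L2 \<Rightarrow> real \<Rightarrow> real \<Rightarrow> real" is
  "\<lambda>f a b. LINT x:{a..<b}|leb01. f x"
proof (intro ext)
  fix f g :: "real \<Rightarrow> real" and a b :: real
  assume h: "square_integrable01 f \<and> square_integrable01 g \<and> (AE x in leb01. f x = g x)"
  have m: "(\<lambda>x. indicator {a..<b} x *\<^sub>R u x) \<in> borel_measurable leb01" if "square_integrable01 u" for u :: "real \<Rightarrow> real"
    using that square_integrable01_indicator[of a b] by (auto simp: square_integrable01_def)
  from h have "AE x in leb01. f x = g x" by simp
  then have "AE x in leb01. indicator {a..<b} x *\<^sub>R f x = indicator {a..<b} x *\<^sub>R g x"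
    by eventually_elim simp
  then show "(LINT x:{a..<b}|leb01. f x) = (LINT x:{a..<b}|leb01. g x)"
    unfolding set_lebesgue_integral_def using m h by (intro integral_cong_AE) auto
qed

text \<open>
  Time changes of an interval \<open>I\<close> (below \<open>{0..1}\<close> and \<open>{0..}\<close>). Only the values on \<open>I\<close> matter, so
  they are not normalised outside \<open>I\<close>. The distortion may be infinite, hence \<open>ennreal\<close>.
\<close>

definition time_changes :: "real set \<Rightarrow> (real \<Rightarrow> real) set" where
  "time_changes I = {l. strict_mono_on I l \<and> continuous_on I l \<and> l ` I = I}"

definition log_distortion :: "real set \<Rightarrow> (real \<Rightarrow> real) \<Rightarrow> ennreal" where
  "log_distortion I l =
     (SUP (s, t)\<in>{(s, t). s \<in> I \<and> t \<in> I \<and> s \<noteq> t}. ennreal \<bar>ln ((l t - l s) / (t - s))\<bar>)"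

lemma time_changes_mem: "l \<in> time_changes I \<Longrightarrow> t \<in> I \<Longrightarrow> l t \<in> I"
  by (auto simp: time_changes_def)

lemma time_changes_less:
  "l \<in> time_changes I \<Longrightarrow> s \<in> I \<Longrightarrow> t \<in> I \<Longrightarrow> s < t \<Longrightarrow> l s < l t"
  by (simp add: time_changes_def strict_mono_on_def)

lemma time_changes_inj: "l \<in> time_changes I \<Longrightarrow> inj_on l I"
  by (auto simp: time_changes_def strict_mono_on_imp_inj_on)

lemma time_changes_slope_pos:
  assumes "l \<in> time_changes I" "s \<in> I" "t \<in> I" "s \<noteq> t"
  shows "(l t - l s) / (t - s) > 0"
proof (cases "s < t")
  case True
  then have "l s < l t" using assms by (auto simp: time_changes_def strict_mono_on_def)
  then show ?thesis using True by simp
next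
  case False
  then have "t < s" using assms by simp
  then have "l t < l s" using assms by (auto simp: time_changes_def strict_mono_on_def)
  then show ?thesis using \<open>t < s\<close> by (simp add: zero_less_divide_iff)
qed

lemma log_distortion_upper:
  "s \<in> I \<Longrightarrow> t \<in> I \<Longrightarrow> s \<noteq> t \<Longrightarrow> ennreal \<bar>ln ((l t - l s) / (t - s))\<bar> \<le> log_distortion I l"
  unfolding log_distortion_def by (rule SUP_upper2[where i = "(s, t)"]) auto

lemma log_distortion_least:
  assumes "\<And>s t. s \<in> I \<Longrightarrow> t \<in> I \<Longrightarrow> s \<noteq> t \<Longrightarrow> ennreal \<bar>ln ((l t - l s) / (t - s))\<bar> \<le> c"
  shows "log_distortion I l \<le> c"
  unfolding log_distortion_def by (rule SUP_least) (use assms in auto)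

lemma time_changes_id: "(\<lambda>t. t) \<in> time_changes I"
  by (auto simp: time_changes_def strict_mono_on_def)

lemma log_distortion_id: "log_distortion I (\<lambda>t. t) = 0"
proof -
  have "log_distortion I (\<lambda>t. t) \<le> 0" by (rule log_distortion_least) auto
  then show ?thesis by simp
qed

lemma time_changes_comp:
  assumes "l \<in> time_changes I" "m \<in> time_changes I"
  shows "l \<circ> m \<in> time_changes I"
proof -
  have "(l \<circ> m) ` I = I" using assms unfolding time_changes_def by (simp only: image_comp[symmetric] mem_Collect_eq)
  moreover have "continuous_on I (l \<circ> m)"
    using assms by (intro continuous_on_compose) (auto simp: time_changes_def)
  moreover have "strict_mono_on I (l \<circ> m)"
    using assms time_changes_mem[OF assms(2)] by (simp add: time_changes_def strict_mono_on_def)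
  ultimately show ?thesis by (simp add: time_changes_def)
qed

lemma log_distortion_comp:
  assumes "l \<in> time_changes I" "m \<in> time_changes I"
  shows "log_distortion I (l \<circ> m) \<le> log_distortion I l + log_distortion I m"
proof (rule log_distortion_least)
  fix s t assume st: "s \<in> I" "t \<in> I" "s \<noteq> t"
  have mst: "m s \<in> I" "m t \<in> I" using assms st by (auto intro: time_changes_mem)
  have ne: "m s \<noteq> m t" using time_changes_inj[OF assms(2)] st by (auto dest: inj_onD)
  let ?a = "(l (m t) - l (m s)) / (m t - m s)" and ?b = "(m t - m s) / (t - s)"
  have pos: "?a > 0" "?b > 0" using time_changes_slope_pos assms st mst ne by blast+
  have "((l \<circ> m) t - (l \<circ> m) s) / (t - s) = ?a * ?b" using ne by simp
  then have "\<bar>ln (((l \<circ> m) t - (l \<circ> m) s) / (t - s))\<bar> \<le> \<bar>ln ?a\<bar> + \<bar>ln ?b\<bar>"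
    using pos by (simp only: ln_mult_pos)
  then have "ennreal \<bar>ln (((l \<circ> m) t - (l \<circ> m) s) / (t - s))\<bar> \<le> ennreal \<bar>ln ?a\<bar> + ennreal \<bar>ln ?b\<bar>"
    by (subst ennreal_plus[symmetric]) (auto intro!: ennreal_leI simp del: ennreal_plus)
  also have "\<dots> \<le> log_distortion I l + log_distortion I m"
    using st mst ne by (intro add_mono log_distortion_upper) auto
  finally show "ennreal \<bar>ln (((l \<circ> m) t - (l \<circ> m) s) / (t - s))\<bar> \<le> log_distortion I l + log_distortion I m" .
qed

lemma log_distortion_bound:
  assumes l: "l \<in> time_changes I" and c: "log_distortion I l \<le> ennreal c" "0 \<le> c" and st: "s \<in> I" "t \<in> I"
  shows "\<bar>l t - l s\<bar> \<le> exp c * \<bar>t - s\<bar>" "\<bar>t - s\<bar> \<le> exp c * \<bar>l t - l s\<bar>"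
proof -
  have "\<bar>l t - l s\<bar> \<le> exp c * \<bar>t - s\<bar> \<and> \<bar>t - s\<bar> \<le> exp c * \<bar>l t - l s\<bar>"
  proof (cases "s = t")
    case False
    let ?a = "(l t - l s) / (t - s)"
    have pos: "?a > 0" using time_changes_slope_pos l st False by blast
    have "ennreal \<bar>ln ?a\<bar> \<le> ennreal c"
      using log_distortion_upper[OF st False, of l] c(1) by (rule order_trans)
    then have "\<bar>ln ?a\<bar> \<le> c" using c by (simp add: ennreal_le_iff)
    then have "ln ?a \<le> c" "- c \<le> ln ?a" by auto
    then have b: "?a \<le> exp c" "exp (- c) \<le> ?a"
      using pos by (metis exp_le_cancel_iff exp_ln)+
    have e: "\<bar>l t - l s\<bar> = ?a * \<bar>t - s\<bar>"
      using pos False by (metis abs_divide abs_of_pos nonzero_eq_divide_eq abs_eq_0 eq_iff_diff_eq_0)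
    have "\<bar>t - s\<bar> = exp c * (exp (- c) * \<bar>t - s\<bar>)"
      by (simp add: exp_minus)
    also have "\<dots> \<le> exp c * (?a * \<bar>t - s\<bar>)"
      using b by (intro mult_left_mono mult_right_mono) auto
    finally have "\<bar>t - s\<bar> \<le> exp c * \<bar>l t - l s\<bar>" using e by simp
    moreover have "\<bar>l t - l s\<bar> \<le> exp c * \<bar>t - s\<bar>"
      unfolding e using b by (intro mult_right_mono) auto
    ultimately show ?thesis by simp
  qed simp
  then show "\<bar>l t - l s\<bar> \<le> exp c * \<bar>t - s\<bar>" "\<bar>t - s\<bar> \<le> exp c * \<bar>l t - l s\<bar>" by auto
qed

lemma time_changes_inv:
  assumes l: "l \<in> time_changes I" and fin: "log_distortion I l < \<top>"
  shows "inv_into I l \<in> time_changes I" "log_distortion I (inv_into I l) = log_distortion I l"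
proof -
  let ?k = "inv_into I l"
  have im: "l ` I = I" using l by (simp add: time_changes_def)
  have inj: "inj_on l I" using l by (rule time_changes_inj)
  have kI: "?k t \<in> I" if "t \<in> I" for t using that im by (metis inv_into_into)
  have lk: "l (?k t) = t" if "t \<in> I" for t using that im by (metis f_inv_into_f)
  have kl: "?k (l t) = t" if "t \<in> I" for t using that inj by simp
  obtain c where c: "log_distortion I l = ennreal c" "0 \<le> c"
    using fin by (cases "log_distortion I l") auto
  have img: "?k ` I = I"
  proof
    show "?k ` I \<subseteq> I" using kI by auto
    show "I \<subseteq> ?k ` I"
    proof
      fix t assume "t \<in> I"
      then have "t = ?k (l t)" "l t \<in> I" using kl time_changes_mem[OF l] by auto
      then show "t \<in> ?k ` I" by blast
    qed
  qed
  have "(exp c)-lipschitz_on I ?k"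
  proof (rule lipschitz_onI)
    fix x y assume xy: "x \<in> I" "y \<in> I"
    show "dist (?k x) (?k y) \<le> exp c * dist x y"
      using log_distortion_bound(2)[OF l eq_refl[OF c(1)] c(2) kI[OF xy(2)] kI[OF xy(1)]] xy
      by (simp add: lk dist_real_def)
  qed simp
  then have cont: "continuous_on I ?k" by (rule lipschitz_on_continuous_on)
  have "strict_mono_on I ?k"
  proof (rule strict_mono_onI)
    fix r s assume rs: "r \<in> I" "s \<in> I" "r < s"
    show "?k r < ?k s"
    proof (rule ccontr)
      assume "\<not> ?thesis"
      then have "?k s = ?k r \<or> ?k s < ?k r" by auto
      then have "l (?k s) \<le> l (?k r)"
        using l kI rs by (auto simp: time_changes_def strict_mono_on_def intro: less_imp_le)
      then show False using rs lk by simp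
    qed
  qed
  then show k: "?k \<in> time_changes I" using cont img by (simp add: time_changes_def)
  have ab: "\<bar>ln (a / b)\<bar> = \<bar>ln (b / a)\<bar>" if "a / b > 0" for a b :: real
  proof -
    have "b / a = inverse (a / b)" by simp
    then show ?thesis using that by (simp only: ln_inverse abs_minus_cancel)
  qed
  show "log_distortion I ?k = log_distortion I l"
  proof (rule antisym)
    show "log_distortion I ?k \<le> log_distortion I l"
    proof (rule log_distortion_least)
      fix s t assume st: "s \<in> I" "t \<in> I" "s \<noteq> t"
      then have ne: "?k s \<noteq> ?k t" using lk by metis
      have "ennreal \<bar>ln ((?k t - ?k s) / (t - s))\<bar> = ennreal \<bar>ln ((l (?k t) - l (?k s)) / (?k t - ?k s))\<bar>"
        using ab[OF time_changes_slope_pos[OF k st]] st by (simp add: lk)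
      also have "\<dots> \<le> log_distortion I l"
        using kI st ne by (intro log_distortion_upper) auto
      finally show "ennreal \<bar>ln ((?k t - ?k s) / (t - s))\<bar> \<le> log_distortion I l" .
    qed
    show "log_distortion I l \<le> log_distortion I ?k"
    proof (rule log_distortion_least)
      fix s t assume st: "s \<in> I" "t \<in> I" "s \<noteq> t"
      then have ne: "l s \<noteq> l t" using inj by (auto dest: inj_onD)
      have "ennreal \<bar>ln ((l t - l s) / (t - s))\<bar> = ennreal \<bar>ln ((?k (l t) - ?k (l s)) / (l t - l s))\<bar>"
        using ab[OF time_changes_slope_pos[OF l st]] st by (simp add: kl)
      also have "\<dots> \<le> log_distortion I ?k"
        using time_changes_mem[OF l] st ne by (intro log_distortion_upper) auto
      finally show "ennreal \<bar>ln ((l t - l s) / (t - s))\<bar> \<le> log_distortion I ?k" .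
    qed
  qed
qed

lemma INF_time_changes_sym:
  fixes P Q :: "(real \<Rightarrow> real) \<Rightarrow> ennreal"
  assumes "\<And>l. l \<in> time_changes I \<Longrightarrow> inv_into I l \<in> time_changes I \<Longrightarrow> Q (inv_into I l) \<le> P l"
  shows "(INF l\<in>time_changes I. max (log_distortion I l) (Q l)) \<le>
    (INF l\<in>time_changes I. max (log_distortion I l) (P l))"
proof (rule INF_greatest)
  fix l assume l: "l \<in> time_changes I"
  show "(INF l\<in>time_changes I. max (log_distortion I l) (Q l)) \<le> max (log_distortion I l) (P l)"
  proof (cases "log_distortion I l < \<top>")
    case True
    note k = time_changes_inv[OF l True]
    show ?thesis
      by (rule INF_lower2[OF k(1)]) (use assms[OF l k(1)] k(2) in \<open>auto simp: le_max_iff_disj\<close>)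
  next
    case False
    then have "log_distortion I l = \<top>" by (simp add: less_top[symmetric])
    then show ?thesis by simp
  qed
qed

lemma INF_time_changes_triangle:
  fixes P Q R :: "(real \<Rightarrow> real) \<Rightarrow> ennreal"
  assumes "\<And>l m. l \<in> time_changes I \<Longrightarrow> m \<in> time_changes I \<Longrightarrow> R (l \<circ> m) \<le> P l + Q m"
  shows "(INF l\<in>time_changes I. max (log_distortion I l) (R l)) \<le>
    (INF l\<in>time_changes I. max (log_distortion I l) (P l)) +
    (INF l\<in>time_changes I. max (log_distortion I l) (Q l))" (is "?r \<le> ?p + ?q")
proof (rule ennreal_le_epsilon)
  fix e :: real assume fin: "?p + ?q < \<top>" and e: "0 < e"
  have up: "p < p + ennreal (e / 2)" if "p < \<top>" for p :: ennreal
    using that e by (cases p) (auto simp: ennreal_plus[symmetric] ennreal_less_iff simp del: ennreal_plus)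
  from fin have "?p < \<top>" "?q < \<top>" unfolding less_top by auto
  then have "?p < ?p + ennreal (e / 2)" "?q < ?q + ennreal (e / 2)" by (blast intro: up)+
  then obtain l m where l: "l \<in> time_changes I" "max (log_distortion I l) (P l) < ?p + ennreal (e / 2)"
    and m: "m \<in> time_changes I" "max (log_distortion I m) (Q m) < ?q + ennreal (e / 2)"
    unfolding INF_less_iff by blast
  have "?r \<le> max (log_distortion I (l \<circ> m)) (R (l \<circ> m))"
    using time_changes_comp[OF l(1) m(1)] by (rule INF_lower)
  also have "\<dots> \<le> max (log_distortion I l + log_distortion I m) (P l + Q m)"
    by (rule max.mono[OF log_distortion_comp[OF l(1) m(1)] assms[OF l(1) m(1)]])
  also have "\<dots> \<le> max (log_distortion I l) (P l) + max (log_distortion I m) (Q m)"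
    by (auto intro: add_mono)
  also have "\<dots> \<le> (?p + ennreal (e / 2)) + (?q + ennreal (e / 2))"
    using l m by (intro add_mono) auto
  also have "\<dots> = ?p + ?q + (ennreal (e / 2) + ennreal (e / 2))"
    by (simp add: ac_simps)
  also have "ennreal (e / 2) + ennreal (e / 2) = ennreal e"
    using e by (simp add: ennreal_plus[symmetric] del: ennreal_plus)
  finally show "?r \<le> ?p + ?q + ennreal e" .
qed

lemma time_changes_zero:
  assumes "l \<in> time_changes I" "0 \<in> I" "\<And>t. t \<in> I \<Longrightarrow> 0 \<le> t"
  shows "l 0 = 0"
proof -
  have "0 \<in> l ` I" using assms by (simp add: time_changes_def)
  then obtain t where t: "t \<in> I" "l t = 0" by auto
  then have "t = 0 \<or> 0 < t" using assms(3) by force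
  then have "l 0 \<le> l t" using assms(1,2) t by (fastforce simp: time_changes_def strict_mono_on_def)
  then show ?thesis using t assms(3) time_changes_mem[OF assms(1,2)] by force
qed

lemma time_changes_close:
  assumes "0 \<in> I" "\<And>t. t \<in> I \<Longrightarrow> 0 \<le> t" "t \<in> I" "0 < d"
  obtains e where "0 < e" "\<And>l. l \<in> time_changes I \<Longrightarrow> log_distortion I l < ennreal e \<Longrightarrow> \<bar>l t - t\<bar> < d"
proof -
  have "((\<lambda>e. (exp e - 1) * t) \<longlongrightarrow> (exp 0 - 1) * t) (at_right 0)"
    by (intro tendsto_intros)
  then have "\<forall>\<^sub>F e in at_right 0. (exp e - 1) * t < d"
    using assms(4) by (auto dest: order_tendstoD(2))
  then obtain e0 where e0: "e0 > 0" "\<And>e. 0 < e \<Longrightarrow> e < e0 \<Longrightarrow> (exp e - 1) * t < d"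
    unfolding eventually_at_right_field by auto
  define e where "e = e0 / 2"
  have e: "0 < e" "(exp e - 1) * t < d" using e0 by (auto simp: e_def)
  have t0: "0 \<le> t" using assms by auto
  show ?thesis
  proof (rule that[OF e(1)])
    fix l assume l: "l \<in> time_changes I" "log_distortion I l < ennreal e"
    have z: "l 0 = 0" using time_changes_zero l assms by blast
    have b: "\<bar>l t - l 0\<bar> \<le> exp e * \<bar>t - 0\<bar>" "\<bar>t - 0\<bar> \<le> exp e * \<bar>l t - l 0\<bar>"
      using log_distortion_bound[OF l(1) less_imp_le[OF l(2)], of 0 t] e assms by auto
    have lt0: "0 \<le> l t" using time_changes_mem[OF l(1) assms(3)] assms by auto
    have b': "l t \<le> exp e * t" "t \<le> exp e * l t" using b z t0 lt0 by auto
    have "l t - t \<le> (exp e - 1) * t" using b' by (simp add: algebra_simps)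
    moreover have "t - l t \<le> (exp e - 1) * t"
    proof (cases "l t \<le> t")
      case True
      have "t - l t \<le> (exp e - 1) * l t" using b' by (simp add: algebra_simps)
      also have "\<dots> \<le> (exp e - 1) * t" using True e by (intro mult_left_mono) auto
      finally show ?thesis .
    next
      case False
      have "0 \<le> (exp e - 1) * t" using t0 e by simp
      then show ?thesis using False by simp
    qed
    ultimately show "\<bar>l t - t\<bar> < d" using e by linarith
  qed
qed

text \<open>
  The space \<open>D([0,1))\<close>: functions on the closed interval that are left continuous at \<open>1\<close>, with the
  metric of Billingsley type (logarithmic distortion) as \<open>dist\<close>.
\<close>

typedef D01 = "{x \<in> extensional {0..1::real}.
    (\<forall>t\<in>{0..<1}. continuous (at_right t) x) \<and>
    (\<forall>t\<in>{0<..<1}. \<exists>a::real. (x \<longlongrightarrow> a) (at_left t)) \<and>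
    continuous (at_left 1) x}"
  morphisms D01_fun Abs_D01
proof (intro exI[of _ "restrict (\<lambda>_. 0::real) {0..1::real}"] CollectI conjI ballI)
  let ?z = "restrict (\<lambda>_. 0::real) {0..1::real}"
  show "?z \<in> extensional {0..1}" by simp
  have ev: "\<forall>\<^sub>F u in at_right t. u \<in> {0..1}" if "t \<in> {0..<1}" for t :: real
    using that unfolding eventually_at_right_field by (auto intro!: exI[of _ 1])
  show "continuous (at_right t) ?z" if "t \<in> {0..<1}" for t
    unfolding continuous_within
  proof (rule tendsto_eventually)
    show "\<forall>\<^sub>F u in at_right t. ?z u = ?z t" using ev[OF that] by eventually_elim (use that in auto)
  qed
  have ev: "\<forall>\<^sub>F u in at_left t. u \<in> {0..1}" if "t \<in> {0<..1}" for t :: real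
    using that unfolding eventually_at_left_field by (auto intro!: exI[of _ 0])
  have l: "(?z \<longlongrightarrow> 0) (at_left t)" if "t \<in> {0<..1}" for t
  proof (rule tendsto_eventually)
    show "\<forall>\<^sub>F u in at_left t. ?z u = 0" using ev[OF that] by eventually_elim auto
  qed
  show "\<exists>a. (?z \<longlongrightarrow> a) (at_left t)" if "t \<in> {0<..<1}" for t using l that by force
  show "continuous (at_left 1) ?z" unfolding continuous_within using l[of 1] by simp
qed

lemma D01_bounded: "\<exists>B. \<forall>t\<in>{0..1}. \<bar>D01_fun x t\<bar> \<le> B"
proof -
  let ?x = "D01_fun x"
  have x: "?x \<in> extensional {0..1}" "\<And>t. t \<in> {0..<1} \<Longrightarrow> continuous (at_right t) ?x"
      "\<And>t. t \<in> {0<..<1} \<Longrightarrow> \<exists>a::real. (?x \<longlongrightarrow> a) (at_left t)" "continuous (at_left 1) ?x"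
    using D01_fun[of x] by auto
  have nb: "\<exists>B. \<forall>\<^sub>F u in F. \<bar>?x u\<bar> \<le> B" if "(?x \<longlongrightarrow> a) F" for a F
  proof -
    have "\<forall>\<^sub>F u in F. dist (?x u) a < 1" using that by (rule tendstoD) simp
    then have "\<forall>\<^sub>F u in F. \<bar>?x u\<bar> \<le> \<bar>a\<bar> + 1" by eventually_elim (auto simp: dist_real_def)
    then show ?thesis by blast
  qed
  have R: "\<exists>B. \<exists>d>0. \<forall>u\<in>{0..1}. t < u \<and> u < t + d \<longrightarrow> \<bar>?x u\<bar> \<le> B" if t: "t \<in> {0..1}" for t
  proof (cases "t = 1")
    case True then show ?thesis by (auto intro!: exI[of _ 1])
  next
    case False
    then have "(?x \<longlongrightarrow> ?x t) (at_right t)" using x(2)[of t] t by (simp add: continuous_within)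
    from nb[OF this] obtain B b where "b > t" "\<And>u. t < u \<Longrightarrow> u < b \<Longrightarrow> \<bar>?x u\<bar> \<le> B"
      unfolding eventually_at_right_field by auto
    then show ?thesis by (intro exI[of _ B] exI[of _ "b - t"]) auto
  qed
  have L: "\<exists>B. \<exists>d>0. \<forall>u\<in>{0..1}. t - d < u \<and> u < t \<longrightarrow> \<bar>?x u\<bar> \<le> B" if t: "t \<in> {0..1}" for t
  proof (cases "t = 0")
    case True then show ?thesis by (auto intro!: exI[of _ 1])
  next
    case False
    then have "\<exists>a. (?x \<longlongrightarrow> a) (at_left t)" using x(3)[of t] x(4) t
      by (cases "t = 1") (auto simp: continuous_within)
    then obtain a where "(?x \<longlongrightarrow> a) (at_left t)" by blast
    from nb[OF this] obtain B b where b: "b < t" "\<And>u. b < u \<Longrightarrow> u < t \<Longrightarrow> \<bar>?x u\<bar> \<le> B"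
      unfolding eventually_at_left_field by auto
    show ?thesis by (rule exI[of _ B], rule exI[of _ "t - b"]) (use b in simp)
  qed
  have "\<exists>B. \<forall>t\<in>{0..1}. \<bar>?x t\<bar> \<le> B"
  proof (rule Bolzano[where P = "\<lambda>a b. \<exists>B. \<forall>t\<in>{a..b}. \<bar>?x t\<bar> \<le> B \<or> t \<notin> {0..1}" and a = 0 and b = 1, THEN exE])
    fix a b c :: real
    assume "\<exists>B. \<forall>t\<in>{a..b}. \<bar>?x t\<bar> \<le> B \<or> t \<notin> {0..1}" "\<exists>B. \<forall>t\<in>{b..c}. \<bar>?x t\<bar> \<le> B \<or> t \<notin> {0..1}"
    then obtain B C where "\<forall>t\<in>{a..b}. \<bar>?x t\<bar> \<le> B \<or> t \<notin> {0..1}" "\<forall>t\<in>{b..c}. \<bar>?x t\<bar> \<le> C \<or> t \<notin> {0..1}"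
      by blast
    then show "\<exists>B. \<forall>t\<in>{a..c}. \<bar>?x t\<bar> \<le> B \<or> t \<notin> {0..1}"
      by (intro exI[of _ "max B C"]) (force simp: le_max_iff_disj)
  next
    fix t :: real assume "0 \<le> t" "t \<le> 1"
    then have t: "t \<in> {0..1}" by simp
    obtain B d where B: "d > 0" "\<forall>u\<in>{0..1}. t < u \<and> u < t + d \<longrightarrow> \<bar>?x u\<bar> \<le> B" using R[OF t] by blast
    obtain C e where C: "e > 0" "\<forall>u\<in>{0..1}. t - e < u \<and> u < t \<longrightarrow> \<bar>?x u\<bar> \<le> C" using L[OF t] by blast
    let ?M = "max (\<bar>?x t\<bar>) (max B C)"
    have "\<exists>B. \<forall>t\<in>{a..b}. \<bar>?x t\<bar> \<le> B \<or> t \<notin> {0..1}" if ab: "a \<le> t \<and> t \<le> b \<and> b - a < min d e" for a b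
    proof (rule exI[of _ ?M], rule ballI)
      fix u assume u: "u \<in> {a..b}"
      consider "u = t" | "t < u" "u < t + d" | "u < t" "t - e < u"
        using ab u by fastforce
      then show "\<bar>?x u\<bar> \<le> ?M \<or> u \<notin> {0..1}"
        using B C by cases (auto simp: le_max_iff_disj)
    qed
    moreover have "0 < min d e" using B C by simp
    ultimately show "\<exists>d>0. \<forall>a b. a \<le> t \<and> t \<le> b \<and> b - a < d \<longrightarrow> (\<exists>B. \<forall>t\<in>{a..b}. \<bar>?x t\<bar> \<le> B \<or> t \<notin> {0..1})"
      by blast
  qed auto
  then show ?thesis .
qed

instantiation D01 :: metric_space
begin

definition dist_D01 :: "D01 \<Rightarrow> D01 \<Rightarrow> real" where
  "dist_D01 x y = enn2real (INF l\<in>time_changes {0..1}. max (log_distortion {0..1} l)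
     (SUP t\<in>{0..1}. ennreal \<bar>D01_fun x (l t) - D01_fun y t\<bar>))"
definition uniformity_D01 :: "(D01 \<times> D01) filter"
  where "uniformity_D01 = (INF e\<in>{0<..}. principal {(x, y). dist x y < e})"
definition open_D01 :: "D01 set \<Rightarrow> bool"
  where "open_D01 U = (\<forall>x\<in>U. eventually (\<lambda>(x', y). x' = x \<longrightarrow> y \<in> U) uniformity)"

instance
proof
  fix x y z :: D01
  let ?S = "\<lambda>x y l. SUP t\<in>{0..1}. ennreal \<bar>D01_fun x (l t) - D01_fun y t\<bar>"
  let ?d = "\<lambda>x y. INF l\<in>time_changes {0..1}. max (log_distortion {0..1} l) (?S x y l)"
  have fin: "?d x y < \<top>" for x y
  proof -
    obtain B where B: "\<forall>t\<in>{0..1}. \<bar>D01_fun x t\<bar> \<le> B" using D01_bounded by blast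
    obtain C where C: "\<forall>t\<in>{0..1}. \<bar>D01_fun y t\<bar> \<le> C" using D01_bounded by blast
    have b: "\<bar>D01_fun x t - D01_fun y t\<bar> \<le> B + C" if "t \<in> {0..1}" for t
      using B C that by force
    have "?S x y (\<lambda>t. t) \<le> ennreal (B + C)"
      by (rule SUP_least) (use b in \<open>auto intro!: ennreal_leI\<close>)
    then have "max (log_distortion {0..1} (\<lambda>t. t)) (?S x y (\<lambda>t. t)) \<le> ennreal (B + C)"
      by (simp add: log_distortion_id)
    then have "?d x y \<le> ennreal (B + C)"
      by (intro INF_lower2[OF time_changes_id])
    then show ?thesis using le_less_trans by fastforce
  qed
  have sym_le: "?d y x \<le> ?d x y" for x y
  proof (rule INF_time_changes_sym, rule SUP_least)
    fix l t assume l: "l \<in> time_changes {0..1::real}" "inv_into {0..1} l \<in> time_changes {0..1}"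
      and t: "t \<in> {0..1::real}"
    let ?k = "inv_into {0..1} l"
    have lk: "l (?k t) = t" using l(1) t by (metis (mono_tags, lifting) f_inv_into_f mem_Collect_eq time_changes_def)
    have "ennreal \<bar>D01_fun y (?k t) - D01_fun x t\<bar> = ennreal \<bar>D01_fun x (l (?k t)) - D01_fun y (?k t)\<bar>"
      by (simp only: lk abs_minus_commute)
    also have "\<dots> \<le> ?S x y l" using time_changes_mem[OF l(2) t] by (rule SUP_upper)
    finally show "ennreal \<bar>D01_fun y (?k t) - D01_fun x t\<bar> \<le> ?S x y l" .
  qed
  have sym: "?d y x = ?d x y" for x y using sym_le by (intro antisym)
  have tri: "?d x z \<le> ?d x y + ?d y z" for x y z
  proof (rule INF_time_changes_triangle, rule SUP_least)
    fix l m t assume l: "l \<in> time_changes {0..1::real}" and m: "m \<in> time_changes {0..1::real}"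
      and t: "t \<in> {0..1::real}"
    have "ennreal \<bar>D01_fun x ((l \<circ> m) t) - D01_fun z t\<bar> \<le>
      ennreal \<bar>D01_fun x (l (m t)) - D01_fun y (m t)\<bar> + ennreal \<bar>D01_fun y (m t) - D01_fun z t\<bar>"
      by (subst ennreal_plus[symmetric]) (auto intro!: ennreal_leI simp del: ennreal_plus)
    also have "\<dots> \<le> ?S x y l + ?S y z m"
      by (intro add_mono SUP_upper) (use time_changes_mem[OF m t] t in auto)
    finally show "ennreal \<bar>D01_fun x ((l \<circ> m) t) - D01_fun z t\<bar> \<le> ?S x y l + ?S y z m" .
  qed
  have z: "?d x x = 0"
  proof -
    have "?S x x (\<lambda>t. t) \<le> 0" by (rule SUP_least) simp
    then have "max (log_distortion {0..1} (\<lambda>t. t)) (?S x x (\<lambda>t. t)) \<le> 0" by (simp add: log_distortion_id)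
    then have "?d x x \<le> 0" by (intro INF_lower2[OF time_changes_id])
    then show ?thesis by simp
  qed
  show "dist x y \<le> dist x z + dist y z"
  proof -
    have "?d x y \<le> ?d x z + ?d y z" using tri[of x y z] sym[of z y] by simp
    then show ?thesis
      unfolding dist_D01_def using fin[of x z] fin[of y z]
      by (simp add: enn2real_plus[symmetric] enn2real_mono)
  qed
  show "(dist x y = 0) = (x = y)"
  proof
    assume "x = y" then show "dist x y = 0" using z by (simp add: dist_D01_def)
  next
    assume "dist x y = 0"
    then have d0: "?d x y = 0"
      unfolding dist_D01_def using fin[of x y] by (auto simp: enn2real_eq_0_iff)
    have cl: "\<exists>l\<in>time_changes {0..1}. log_distortion {0..1} l < ennreal e \<and>
       (\<forall>t\<in>{0..1}. \<bar>D01_fun x (l t) - D01_fun y t\<bar> < e)" if e: "0 < e" for e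
    proof -
      have "?d x y < ennreal e" using e d0 by simp
      then obtain l where l: "l \<in> time_changes {0..1}" "log_distortion {0..1} l < ennreal e" "?S x y l < ennreal e"
        by (auto simp: INF_less_iff)
      have "\<bar>D01_fun x (l t) - D01_fun y t\<bar> < e" if "t \<in> {0..1}" for t
      proof -
        have "ennreal \<bar>D01_fun x (l t) - D01_fun y t\<bar> \<le> ?S x y l" using that by (rule SUP_upper)
        then have "ennreal \<bar>D01_fun x (l t) - D01_fun y t\<bar> < ennreal e" using l(3) by (rule le_less_trans)
        then show ?thesis by (simp add: ennreal_less_iff)
      qed
      then show ?thesis using l by blast
    qed
    have "D01_fun x t = D01_fun y t" if t: "t \<in> {0..1}" for t
    proof (rule ccontr)
      assume ne: "D01_fun x t \<noteq> D01_fun y t"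
      define e where "e = \<bar>D01_fun x t - D01_fun y t\<bar> / 3"
      have e: "e > 0" using ne by (simp add: e_def)
      show False
      proof (cases "t = 1")
        case True
        obtain l where l: "l \<in> time_changes {0..1}" "\<forall>t\<in>{0..1}. \<bar>D01_fun x (l t) - D01_fun y t\<bar> < e"
          using cl[OF e] by blast
        obtain s where s: "s \<in> {0..1}" "l s = 1"
        proof -
          have "1 \<in> l ` {0..1}" using l(1) by (simp add: time_changes_def)
          then show thesis using that by auto
        qed
        have "l 1 = 1"
        proof (cases "s = 1")
          case False
          then have "s < 1" using s by simp
          then have "l s < l 1" using time_changes_less[OF l(1), of s 1] s by simp
          then show ?thesis using s time_changes_mem[OF l(1), of 1] by simp
        qed (use s in simp)
        then have "\<bar>D01_fun x 1 - D01_fun y 1\<bar> < e" using l(2)[THEN bspec, of 1] by simp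
        then show False using e True by (simp add: e_def)
      next
        case False
        with t have t1: "t \<in> {0..<1}" by auto
        have cx: "(D01_fun w \<longlongrightarrow> D01_fun w t) (at_right t)" for w
          using D01_fun[of w] t1 by (simp add: continuous_within)
        have "\<forall>\<^sub>F u in at_right t. dist (D01_fun x u) (D01_fun x t) < e \<and> dist (D01_fun y u) (D01_fun y t) < e"
          by (intro eventually_conj tendstoD[OF cx] e)
        then obtain b0 where b0: "b0 > t"
          "\<And>u. t < u \<Longrightarrow> u < b0 \<Longrightarrow> \<bar>D01_fun x u - D01_fun x t\<bar> < e \<and> \<bar>D01_fun y u - D01_fun y t\<bar> < e"
          unfolding eventually_at_right_field dist_real_def by auto
        define b where "b = min b0 1"
        define s where "s = (t + b) / 2"
        have s: "t < s" "s < b" "s \<in> {0..1}" using b0 t1 by (auto simp: s_def b_def)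
        obtain e' where e': "0 < e'"
          "\<And>l. l \<in> time_changes {0..1} \<Longrightarrow> log_distortion {0..1} l < ennreal e' \<Longrightarrow> \<bar>l s - s\<bar> < (b - t) / 2"
          by (rule time_changes_close[of "{0..1}" s "(b - t) / 2"]) (use s in auto)
        obtain l where l: "l \<in> time_changes {0..1}" "log_distortion {0..1} l < ennreal (min e e')"
            "\<forall>t\<in>{0..1}. \<bar>D01_fun x (l t) - D01_fun y t\<bar> < min e e'"
          using cl[of "min e e'"] e e' by auto
        have "log_distortion {0..1} l < ennreal e'"
          using l(2) by (rule less_le_trans) (auto intro: ennreal_leI)
        then have "\<bar>l s - s\<bar> < (b - t) / 2" using e'(2) l(1) by blast
        then have "t < l s" "l s < b" by (auto simp: s_def abs_less_iff field_simps)
        then have "\<bar>D01_fun x (l s) - D01_fun x t\<bar> < e" "\<bar>D01_fun y s - D01_fun y t\<bar> < e"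
          using b0(2)[of "l s"] b0(2)[of s] s by (auto simp: b_def)
        moreover have "\<bar>D01_fun x (l s) - D01_fun y s\<bar> < e" using l(3)[THEN bspec, OF s(3)] by simp
        ultimately have "\<bar>D01_fun x t - D01_fun y t\<bar> < 3 * e" by linarith
        then show False by (simp add: e_def)
      qed
    qed
    then have "D01_fun x = D01_fun y"
      using D01_fun[of x] D01_fun[of y] by (auto intro: extensionalityI)
    then show "x = y" by (simp add: D01_fun_inject)
  qed
qed (simp_all only: uniformity_D01_def open_D01_def)

end


text \<open>
  The space \<open>D([0,\<infinity>),\<Theta>)\<close> and the metric of its \<open>J\<^sub>1\<close> topology. Functions are \<open>undefined\<close> on the
  negative half line, so that equality means equality on \<open>[0,\<infinity>)\<close>. Both the infimum and
  the integral are taken in \<open>ennreal\<close>; the infimum is at most \<open>1\<close> (take the identity).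
\<close>

definition skorokhod_space :: "(real \<Rightarrow> 'a::metric_space) set" where
  "skorokhod_space = {x \<in> extensional {0..}.
     (\<forall>t\<ge>0. continuous (at_right t) x) \<and> (\<forall>t>0. \<exists>a. (x \<longlongrightarrow> a) (at_left t))}"

definition J1_dist :: "(real \<Rightarrow> 'a::metric_space) \<Rightarrow> (real \<Rightarrow> 'a) \<Rightarrow> real" where
  "J1_dist x y = enn2real (INF l\<in>time_changes {0..}. max (log_distortion {0..} l)
     (\<integral>\<^sup>+u\<in>{0..}. (ennreal (exp (- u)) *
        (SUP t\<in>{0..}. ennreal (min 1 (dist (x (min (l t) u)) (y (min t u)))))) \<partial>lborel))"

text \<open>The supremum and the integral occurring in \<^const>\<open>J1_dist\<close>, named for the proof of the metric axioms.\<close>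

definition J1_gap :: "(real \<Rightarrow> 'a::metric_space) \<Rightarrow> (real \<Rightarrow> 'a) \<Rightarrow> (real \<Rightarrow> real) \<Rightarrow> real \<Rightarrow> ennreal" where
  "J1_gap x y l u = (SUP t\<in>{0..}. ennreal (min 1 (dist (x (min (l t) u)) (y (min t u)))))"

lemma borel_measurable_right_continuous:
  fixes h :: "real \<Rightarrow> real"
  assumes h: "\<And>u. continuous (at_right u) h"
  shows "h \<in> borel_measurable borel"
proof (rule borel_measurable_LIMSEQ_real)
  let ?q = "\<lambda>n u. (of_int \<lfloor>u * real (Suc n)\<rfloor> + 1) / real (Suc n)"
  show "(\<lambda>u. h (?q n u)) \<in> borel_measurable borel" for n
  proof -
    have "(\<lambda>u. \<lfloor>u * real (Suc n)\<rfloor>) \<in> borel \<rightarrow>\<^sub>M count_space UNIV"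
      by measurable
    moreover have "(\<lambda>k::int. h ((of_int k + 1) / real (Suc n))) \<in> count_space UNIV \<rightarrow>\<^sub>M borel" by simp
    ultimately have "(\<lambda>k::int. h ((of_int k + 1) / real (Suc n))) \<circ> (\<lambda>u. \<lfloor>u * real (Suc n)\<rfloor>) \<in> borel_measurable borel"
      by (rule measurable_comp)
    then show ?thesis by (simp add: comp_def)
  qed
  fix u :: real
  have gt: "u < ?q n u" for n
  proof -
    have "u * real (Suc n) < of_int \<lfloor>u * real (Suc n)\<rfloor> + 1" by linarith
    then show ?thesis by (simp only: pos_less_divide_eq of_nat_0_less_iff zero_less_Suc)
  qed
  have le: "?q n u \<le> u + 1 / real (Suc n)" for n
  proof -
    have "of_int \<lfloor>u * real (Suc n)\<rfloor> + 1 \<le> u * real (Suc n) + 1" by simp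
    then have "?q n u \<le> (u * real (Suc n) + 1) / real (Suc n)" by (rule divide_right_mono) simp
    also have "\<dots> = u + 1 / real (Suc n)" by (simp add: add_divide_distrib del: of_nat_Suc)
    finally show ?thesis .
  qed
  have "(\<lambda>n. ?q n u) \<longlonglongrightarrow> u"
  proof (rule tendsto_sandwich[where f = "\<lambda>_. u" and h = "\<lambda>n. u + 1 / real (Suc n)"])
    have "(\<lambda>n. u + 1 / real (Suc n)) \<longlonglongrightarrow> u + 0"
      by (intro tendsto_add tendsto_const LIMSEQ_Suc lim_1_over_n)
    then show "(\<lambda>n. u + 1 / real (Suc n)) \<longlonglongrightarrow> u" by simp
  qed (use gt le in \<open>auto intro!: always_eventually less_imp_le simp del: of_nat_Suc\<close>)
  then have "filterlim (\<lambda>n. ?q n u) (at_right u) sequentially"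
    using gt by (auto simp: filterlim_at simp del: of_nat_Suc intro!: always_eventually dest: less_imp_neq[THEN not_sym])
  moreover have "(h \<longlongrightarrow> h u) (at_right u)" using h by (simp add: continuous_within)
  ultimately show "(\<lambda>n. h (?q n u)) \<longlonglongrightarrow> h u" by (rule filterlim_compose[rotated])
qed

lemma right_continuous_compose:
  fixes x :: "real \<Rightarrow> 'a::metric_space" and g :: "real \<Rightarrow> real"
  assumes x: "x \<in> skorokhod_space" and g: "continuous (at_right t) g" "0 \<le> g t"
    and mono: "\<And>s. t < s \<Longrightarrow> g t \<le> g s"
  shows "((\<lambda>s. x (g s)) \<longlongrightarrow> x (g t)) (at_right t)"
proof -
  have "(x \<longlongrightarrow> x (g t)) (at_right (g t))"
    using x g(2) by (auto simp: skorokhod_space_def continuous_within)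
  then have "(x \<longlongrightarrow> x (g t)) (at (g t) within {g t..})"
    by (simp add: at_within_Ici_at_right)
  then have "continuous (at (g t) within {g t..}) x" by (simp add: continuous_within)
  then have "continuous (at (g t) within g ` {t<..}) x"
    by (rule continuous_within_subset) (use mono in auto)
  then have "continuous (at_right t) (x \<circ> g)"
    by (rule continuous_within_compose[OF g(1)])
  then show ?thesis by (simp add: continuous_within comp_def)
qed

lemma measurable_J1_gap:
  fixes x y :: "real \<Rightarrow> 'a::metric_space"
  assumes x: "x \<in> skorokhod_space" and y: "y \<in> skorokhod_space" and l: "l \<in> time_changes {0..}"
  shows "(\<lambda>u. J1_gap x y l u * indicator {0..} u) \<in> borel_measurable lborel"
proof -
  let ?h = "\<lambda>t u. dist (x (min (l t) u)) (y (min t u))"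
  let ?Q = "\<rat> \<inter> {0::real..}"
  have lpos: "0 \<le> l t" if "0 \<le> t" for t using time_changes_mem[OF l] that by auto
  have eq: "J1_gap x y l u = (SUP t\<in>?Q. ennreal (min 1 (?h t u)))" if u: "0 \<le> u" for u
  proof (rule antisym)
    show "(SUP t\<in>?Q. ennreal (min 1 (?h t u))) \<le> J1_gap x y l u"
      unfolding J1_gap_def by (rule SUP_subset_mono) auto
    show "J1_gap x y l u \<le> (SUP t\<in>?Q. ennreal (min 1 (?h t u)))" (is "_ \<le> ?s")
      unfolding J1_gap_def
    proof (rule SUP_least)
      fix t :: real assume "t \<in> {0..}"
      then have t: "0 \<le> t" by simp
      have lc: "continuous (at_right t) l"
      proof -
        have "continuous (at t within {0..}) l"
          using l t by (auto simp: time_changes_def continuous_on_eq_continuous_within)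
        then show ?thesis by (rule continuous_within_subset) (use t in auto)
      qed
      have c1: "((\<lambda>s. x (min (l s) u)) \<longlongrightarrow> x (min (l t) u)) (at_right t)"
      proof (rule right_continuous_compose[OF x])
        show "continuous (at_right t) (\<lambda>s. min (l s) u)"
          using lc by (auto simp: continuous_within intro!: tendsto_intros)
        show "0 \<le> min (l t) u" using u lpos[OF t] by simp
        fix s assume "t < s"
        then have "l t < l s" using l t by (auto simp: time_changes_def strict_mono_on_def)
        then show "min (l t) u \<le> min (l s) u" by (auto simp: min_def)
      qed
      have c2: "((\<lambda>s. y (min s u)) \<longlongrightarrow> y (min t u)) (at_right t)"
      proof (rule right_continuous_compose[OF y])
        show "continuous (at_right t) (\<lambda>s. min s u)"
          by (auto simp: continuous_within intro!: tendsto_intros)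
        show "0 \<le> min t u" using u t by simp
        show "min t u \<le> min s u" if "t < s" for s using that by auto
      qed
      have "((\<lambda>s. min 1 (?h s u)) \<longlongrightarrow> min 1 (?h t u)) (at_right t)"
        by (intro tendsto_min tendsto_const tendsto_dist c1 c2)
      then have lim: "((\<lambda>s. ennreal (min 1 (?h s u))) \<longlongrightarrow> ennreal (min 1 (?h t u))) (at_right t)"
        by (rule tendsto_ennrealI)
      show "ennreal (min 1 (?h t u)) \<le> ?s"
      proof (rule ccontr)
        assume "\<not> ?thesis"
        then have "?s < ennreal (min 1 (?h t u))" by simp
        with lim have "\<forall>\<^sub>F s in at_right t. ?s < ennreal (min 1 (?h s u))" by (rule order_tendstoD(1))
        then obtain b where b: "b > t" "\<And>s. t < s \<Longrightarrow> s < b \<Longrightarrow> ?s < ennreal (min 1 (?h s u))"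
          unfolding eventually_at_right_field by auto
        obtain q where q: "q \<in> \<rat>" "t < q" "q < b" using Rats_dense_in_real[OF b(1)] by blast
        have "ennreal (min 1 (?h q u)) \<le> ?s" by (rule SUP_upper) (use q t in auto)
        then show False using b(2)[OF q(2,3)] by simp
      qed
    qed
  qed
  have m: "(\<lambda>u. ?h t (max 0 u)) \<in> borel_measurable borel" if t: "0 \<le> t" for t
  proof (rule borel_measurable_right_continuous)
    fix u :: real
    have "((\<lambda>v. z (min a (max 0 v))) \<longlongrightarrow> z (min a (max 0 u))) (at_right u)"
      if z: "z \<in> skorokhod_space" and a: "0 \<le> a" for z :: "real \<Rightarrow> 'a" and a
    proof (rule right_continuous_compose[OF z])
      show "continuous (at_right u) (\<lambda>v. min a (max 0 v))"
        by (auto simp: continuous_within intro!: tendsto_intros)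
    qed (use a in auto)
    then show "continuous (at_right u) (\<lambda>u. ?h t (max 0 u))"
      using x y lpos[OF t] t by (auto simp: continuous_within intro!: tendsto_dist)
  qed
  have "(\<lambda>u. (SUP t\<in>?Q. ennreal (min 1 (?h t (max 0 u)))) * indicator {0..} u) \<in> borel_measurable borel"
  proof (intro borel_measurable_times_ennreal borel_measurable_SUP)
    show "countable ?Q" using countable_rat by (rule countable_subset[rotated]) auto
    show "(\<lambda>u. ennreal (min 1 (?h t (max 0 u)))) \<in> borel_measurable borel" if "t \<in> ?Q" for t
      using m[of t] that by (intro measurable_compose[OF _ measurable_ennreal] borel_measurable_min) auto
  qed auto
  also have "(\<lambda>u. (SUP t\<in>?Q. ennreal (min 1 (?h t (max 0 u)))) * indicator {0..} u)
    = (\<lambda>u. J1_gap x y l u * indicator {0..} u)"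
    by (rule ext) (auto simp: indicator_def eq)
  finally show ?thesis by simp
qed

lemma J1_gap_le_1: "J1_gap x y l u \<le> 1"
  unfolding J1_gap_def by (rule SUP_least) (auto simp: ennreal_leI intro: order_trans[OF ennreal_leI[of _ 1]])

definition J1_int :: "(real \<Rightarrow> 'a::metric_space) \<Rightarrow> (real \<Rightarrow> 'a) \<Rightarrow> (real \<Rightarrow> real) \<Rightarrow> ennreal" where
  "J1_int x y l = (\<integral>\<^sup>+u\<in>{0..}. (ennreal (exp (- u)) * J1_gap x y l u) \<partial>lborel)"

lemma J1_dist_alt:
  "J1_dist x y = enn2real (INF l\<in>time_changes {0..}. max (log_distortion {0..} l) (J1_int x y l))"
  by (simp add: J1_dist_def J1_int_def J1_gap_def)

lemma nn_integral_exp_minus: "(\<integral>\<^sup>+u\<in>{0..}. ennreal (exp (- u)) \<partial>lborel) = 1"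
proof -
  have "(\<integral>\<^sup>+u. ennreal (exp (- u)) * indicator {0..} u \<partial>lborel) = ennreal (0 - (- exp (- 0)))"
  proof (rule nn_integral_FTC_atLeast)
    show "((\<lambda>u::real. - exp (- u)) \<longlongrightarrow> 0) at_top" by real_asymp
  qed (auto intro!: derivative_eq_intros)
  then show ?thesis by simp
qed

lemma J1_int_le_1: "J1_int x y l \<le> 1"
proof -
  have "J1_int x y l \<le> (\<integral>\<^sup>+u\<in>{0..}. ennreal (exp (- u)) \<partial>lborel)"
    unfolding J1_int_def
    by (intro nn_integral_mono mult_right_mono) (use mult_left_mono[OF J1_gap_le_1] in auto)
  then show ?thesis by (simp add: nn_integral_exp_minus)
qed

lemma Metric_space_J1: "Metric_space skorokhod_space (J1_dist :: (real \<Rightarrow> 'a::metric_space) \<Rightarrow> _)"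
proof
  let ?d = "\<lambda>x y :: real \<Rightarrow> 'a. INF l\<in>time_changes {0..}. max (log_distortion {0..} l) (J1_int x y l)"
  have fin: "?d x y < \<top>" for x y
  proof -
    have "?d x y \<le> max (log_distortion {0..} (\<lambda>t. t)) (J1_int x y (\<lambda>t. t))"
      by (rule INF_lower[OF time_changes_id])
    also have "\<dots> \<le> 1" using J1_int_le_1 by (simp add: log_distortion_id)
    finally show ?thesis using le_less_trans by fastforce
  qed
  have sym_le: "?d y x \<le> ?d x y" for x y
  proof (rule INF_time_changes_sym)
    fix l assume l: "l \<in> time_changes {0::real..}" "inv_into {0..} l \<in> time_changes {0..}"
    let ?k = "inv_into {0..} l"
    have "J1_gap y x ?k u \<le> J1_gap x y l u" for u
      unfolding J1_gap_def
    proof (rule SUP_least)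
      fix t :: real assume t: "t \<in> {0..}"
      have lk: "l (?k t) = t" using l(1) t
        by (metis (mono_tags, lifting) f_inv_into_f mem_Collect_eq time_changes_def)
      have "ennreal (min 1 (dist (y (min (?k t) u)) (x (min t u)))) =
          ennreal (min 1 (dist (x (min (l (?k t)) u)) (y (min (?k t) u))))"
        by (simp only: lk dist_commute)
      also have "\<dots> \<le> (SUP t\<in>{0..}. ennreal (min 1 (dist (x (min (l t) u)) (y (min t u)))))"
        using time_changes_mem[OF l(2) t] by (rule SUP_upper)
      finally show "ennreal (min 1 (dist (y (min (?k t) u)) (x (min t u)))) \<le>
        (SUP t\<in>{0..}. ennreal (min 1 (dist (x (min (l t) u)) (y (min t u)))))" .
    qed
    then show "J1_int y x ?k \<le> J1_int x y l"
      unfolding J1_int_def by (intro nn_integral_mono mult_right_mono mult_left_mono) auto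
  qed
  have sym: "?d y x = ?d x y" for x y using sym_le by (intro antisym)
  show "0 \<le> J1_dist x y" for x y :: "real \<Rightarrow> 'a" by (simp add: J1_dist_def)
  show "J1_dist x y = J1_dist y x" for x y :: "real \<Rightarrow> 'a" using sym[of x y] by (simp add: J1_dist_alt)
  fix x y :: "real \<Rightarrow> 'a" assume x: "x \<in> skorokhod_space" and y: "y \<in> skorokhod_space"
  show "J1_dist x z \<le> J1_dist x y + J1_dist y z" if z: "z \<in> skorokhod_space" for z
  proof -
    have "?d x z \<le> ?d x y + ?d y z"
    proof (rule INF_time_changes_triangle)
      fix l m assume l: "l \<in> time_changes {0::real..}" and m: "m \<in> time_changes {0::real..}"
      have gap: "J1_gap x z (l \<circ> m) u \<le> J1_gap x y l u + J1_gap y z m u" for u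
      proof -
        have "J1_gap x z (l \<circ> m) u \<le> J1_gap x y l u + J1_gap y z m u"
          unfolding J1_gap_def[of x z]
        proof (rule SUP_least)
          fix t :: real assume t: "t \<in> {0..}"
          let ?a = "dist (x (min (l (m t)) u)) (y (min (m t) u))" and ?b = "dist (y (min (m t) u)) (z (min t u))"
          have "dist (x (min (l (m t)) u)) (z (min t u)) \<le> ?a + ?b" by (rule dist_triangle)
          moreover have "min 1 w \<le> min 1 a + min 1 b" if "w \<le> a + b" "0 \<le> a" "0 \<le> b" for w a b :: real
            using that by linarith
          ultimately have "min 1 (dist (x (min (l (m t)) u)) (z (min t u))) \<le> min 1 ?a + min 1 ?b"
            by simp
          then have "ennreal (min 1 (dist (x (min ((l \<circ> m) t) u)) (z (min t u)))) \<le> ennreal (min 1 ?a) + ennreal (min 1 ?b)"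
            by (subst ennreal_plus[symmetric]) (auto intro!: ennreal_leI simp del: ennreal_plus)
          also have "\<dots> \<le> J1_gap x y l u + J1_gap y z m u"
            unfolding J1_gap_def
            by (intro add_mono SUP_upper2[OF t] SUP_upper2[OF time_changes_mem[OF m t]] order_refl)
          finally show "ennreal (min 1 (dist (x (min ((l \<circ> m) t) u)) (z (min t u)))) \<le> J1_gap x y l u + J1_gap y z m u" .
        qed
        then show ?thesis .
      qed
      have meas: "(\<lambda>u. ennreal (exp (- u)) * J1_gap a b k u * indicator {0..} u) \<in> borel_measurable lborel"
        if "a \<in> skorokhod_space" "b \<in> skorokhod_space" "k \<in> time_changes {0..}" for a b :: "real \<Rightarrow> 'a" and k
        unfolding mult.assoc
        by (intro borel_measurable_times_ennreal measurable_J1_gap that) measurable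
      have "J1_int x z (l \<circ> m) \<le> (\<integral>\<^sup>+u. (ennreal (exp (- u)) * J1_gap x y l u * indicator {0..} u
          + ennreal (exp (- u)) * J1_gap y z m u * indicator {0..} u) \<partial>lborel)"
        unfolding J1_int_def
      proof (rule nn_integral_mono)
        fix u :: real
        show "ennreal (exp (- u)) * J1_gap x z (l \<circ> m) u * indicator {0..} u \<le>
          ennreal (exp (- u)) * J1_gap x y l u * indicator {0..} u + ennreal (exp (- u)) * J1_gap y z m u * indicator {0..} u"
          unfolding distrib_right[symmetric] distrib_left[symmetric]
          by (intro mult_right_mono mult_left_mono gap) auto
      qed
      also have "\<dots> = J1_int x y l + J1_int y z m"
        unfolding J1_int_def by (intro nn_integral_add meas x y z l m)
      finally show "J1_int x z (l \<circ> m) \<le> J1_int x y l + J1_int y z m" .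
    qed
    then show ?thesis
      unfolding J1_dist_alt using fin[of x y] fin[of y z]
      by (simp add: enn2real_plus[symmetric] enn2real_mono)
  qed
  show "(J1_dist x y = 0) = (x = y)"
  proof
    assume "x = y"
    have "J1_gap x x (\<lambda>t. t) u = 0" for u
      unfolding J1_gap_def by (simp add: SUP_constant)
    then have "max (log_distortion {0..} (\<lambda>t. t)) (J1_int x x (\<lambda>t. t)) \<le> 0"
      by (simp add: log_distortion_id J1_int_def)
    then have "?d x x \<le> 0" by (rule INF_lower2[OF time_changes_id])
    then show "J1_dist x y = 0" using \<open>x = y\<close> by (simp add: J1_dist_alt)
  next
    assume "J1_dist x y = 0"
    then have d0: "?d x y = 0"
      unfolding J1_dist_alt using fin[of x y] by (auto simp: enn2real_eq_0_iff)
    have "x t = y t" if t: "0 \<le> t" for t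
    proof (rule ccontr)
      assume ne: "x t \<noteq> y t"
      define e where "e = min 1 (dist (x t) (y t) / 3)"
      have e: "e > 0" "e \<le> 1" using ne by (auto simp: e_def)
      have cx: "(w \<longlongrightarrow> w t) (at_right t)" if "w \<in> skorokhod_space" for w :: "real \<Rightarrow> 'a"
        using that t by (simp add: skorokhod_space_def continuous_within)
      have "\<forall>\<^sub>F u in at_right t. dist (x u) (x t) < e \<and> dist (y u) (y t) < e"
        by (intro eventually_conj tendstoD[OF cx] e x y)
      then obtain b where b: "b > t"
        "\<And>u. t < u \<Longrightarrow> u < b \<Longrightarrow> dist (x u) (x t) < e \<and> dist (y u) (y t) < e"
        unfolding eventually_at_right_field by auto
      define s where "s = (t + b) / 2"
      have s: "t < s" "s < b" "0 \<le> s" using b t by (auto simp: s_def)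
      obtain e' where e': "0 < e'"
        "\<And>l. l \<in> time_changes {0..} \<Longrightarrow> log_distortion {0..} l < ennreal e' \<Longrightarrow> \<bar>l s - s\<bar> < (b - t) / 2"
        by (rule time_changes_close[of "{0..}" s "(b - t) / 2"]) (use s b in auto)
      define c where "c = min e' (exp (- (b + 1)) * e)"
      have c: "0 < c" using e e' by (simp add: c_def)
      have "?d x y < ennreal c" using c d0 by simp
      then obtain l where l: "l \<in> time_changes {0..}" "log_distortion {0..} l < ennreal c" "J1_int x y l < ennreal c"
        by (auto simp: INF_less_iff)
      have "ennreal c \<le> ennreal e'" by (rule ennreal_leI) (simp add: c_def)
      then have "\<bar>l s - s\<bar> < (b - t) / 2" using e'(2) l(1,2) by (meson less_le_trans)
      then have ls: "t < l s" "l s < b" by (auto simp: s_def abs_less_iff field_simps)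
      have "\<exists>u\<in>{b..b + 1}. J1_gap x y l u < ennreal e"
      proof (rule ccontr)
        assume "\<not> ?thesis"
        then have ge: "ennreal e \<le> J1_gap x y l u" if "u \<in> {b..b + 1}" for u using that by force
        have "ennreal c \<le> ennreal (exp (- (b + 1)) * e)" by (rule ennreal_leI) (simp add: c_def)
        also have "\<dots> = (\<integral>\<^sup>+u. ennreal (exp (- (b + 1)) * e) * indicator {b..b + 1} u \<partial>lborel)"
          by (simp add: nn_integral_cmult_indicator)
        also have "\<dots> \<le> J1_int x y l"
          unfolding J1_int_def
        proof (rule nn_integral_mono)
          fix u :: real
          show "ennreal (exp (- (b + 1)) * e) * indicator {b..b + 1} u \<le>
            ennreal (exp (- u)) * J1_gap x y l u * indicator {0..} u"
          proof (cases "u \<in> {b..b + 1}")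
            case True
            have "ennreal (exp (- (b + 1)) * e) = ennreal (exp (- (b + 1))) * ennreal e"
              using e by (simp add: ennreal_mult)
            also have "\<dots> \<le> ennreal (exp (- u)) * J1_gap x y l u"
              using True by (intro mult_mono ge ennreal_leI) auto
            finally show ?thesis using True b t by simp
          qed simp
        qed
        finally show False using l(3) by simp
      qed
      then obtain u where u: "b \<le> u" "J1_gap x y l u < ennreal e" by auto
      have "ennreal (min 1 (dist (x (min (l s) u)) (y (min s u)))) \<le> J1_gap x y l u"
        unfolding J1_gap_def by (rule SUP_upper) (use s in simp)
      then have "ennreal (min 1 (dist (x (l s)) (y s))) < ennreal e"
        using u ls s by (simp add: min_absorb1)
      then have "min 1 (dist (x (l s)) (y s)) < e" by (subst (asm) ennreal_less_iff) auto
      then have d1: "dist (x (l s)) (y s) < e" using e by auto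
      have d2: "dist (x (l s)) (x t) < e" "dist (y s) (y t) < e" using b(2) ls s by auto
      have "dist (x t) (y t) \<le> dist (x t) (x (l s)) + dist (x (l s)) (y t)" by (rule dist_triangle)
      also have "dist (x (l s)) (y t) \<le> dist (x (l s)) (y s) + dist (y s) (y t)" by (rule dist_triangle)
      finally have "dist (x t) (y t) < 3 * e" using d1 d2 by (simp add: dist_commute)
      then show False by (simp add: e_def)
    qed
    then show "x = y"
      using x y by (auto simp: skorokhod_space_def intro: extensionalityI)
  qed
qed

definition J1_topology :: "(real \<Rightarrow> 'a::metric_space) topology" where
  "J1_topology = Metric_space.mtopology skorokhod_space J1_dist"

text \<open>
  Step functions form a subspace of \<open>L2\<close>. One-sided limits of such a class are those of its unique
  representative in \<^typ>\<open>D01\<close>; for classes without such a representative \<open>cadlag_rep\<close> is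
  unspecified.
\<close>

definition step_functions :: "L2 set" where
  "step_functions = span {L2_indicator s t | s t. 0 \<le> s \<and> s < t \<and> t \<le> 1}"

lift_definition L2_represents :: "(real \<Rightarrow> real) \<Rightarrow> L2 \<Rightarrow> bool" is
  "\<lambda>h f. AE x in leb01. f x = h x"
proof -
  fix h f g :: "real \<Rightarrow> real"
  assume "square_integrable01 f \<and> square_integrable01 g \<and> (AE x in leb01. f x = g x)"
  then have fg: "AE x in leb01. f x = g x" by simp
  show "(AE x in leb01. f x = h x) = (AE x in leb01. g x = h x)"
  proof
    assume "AE x in leb01. f x = h x" with fg show "AE x in leb01. g x = h x" by eventually_elim simp
  next
    assume "AE x in leb01. g x = h x" with fg show "AE x in leb01. f x = h x" by eventually_elim simp
  qed
qed

definition cadlag_rep :: "L2 \<Rightarrow> D01" where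
  "cadlag_rep g = (THE h. L2_represents (D01_fun h) g)"

lemma D01_fun_right: "t \<in> {0..<1} \<Longrightarrow> (D01_fun h \<longlongrightarrow> D01_fun h t) (at_right t)"
  using D01_fun[of h] by (simp add: continuous_within)

lemma D01_fun_left1: "(D01_fun h \<longlongrightarrow> D01_fun h 1) (at_left 1)"
  using D01_fun[of h] by (simp add: continuous_within)

lemma D01_eq_AE:
  assumes "AE x in leb01. D01_fun h x = D01_fun k x"
  shows "h = k"
proof -
  have eq: "D01_fun h t = D01_fun k t" if t: "t \<in> {0..<1}" for t
  proof (rule ccontr)
    assume ne: "D01_fun h t \<noteq> D01_fun k t"
    have "((\<lambda>u. D01_fun h u - D01_fun k u) \<longlongrightarrow> D01_fun h t - D01_fun k t) (at_right t)"
      by (intro tendsto_diff D01_fun_right t)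
    then have "\<forall>\<^sub>F u in at_right t. D01_fun h u - D01_fun k u \<noteq> 0"
      by (rule tendsto_imp_eventually_ne) (use ne in simp)
    then obtain b0 where b0: "t < b0" "\<And>u. t < u \<Longrightarrow> u < b0 \<Longrightarrow> D01_fun h u \<noteq> D01_fun k u"
      unfolding eventually_at_right_field by auto
    define b where "b = min b0 1"
    have b: "t < b" "b \<le> 1" using b0 t by (auto simp: b_def)
    have "AE x in lebesgue. x \<in> {0..<1} \<longrightarrow> D01_fun h x = D01_fun k x"
      using assms by (simp add: AE_restrict_space_iff)
    then have "AE x in lebesgue. x \<notin> {t<..<b}"
      by eventually_elim (use b0(2) t in \<open>force simp: b_def\<close>)
    then have "{t<..<b} \<in> null_sets lebesgue" by (subst AE_iff_null_sets) auto
    then have "emeasure lebesgue {t<..<b} = 0" by (rule null_setsD1)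
    then show False using b by simp
  qed
  have "D01_fun h 1 = D01_fun k 1"
  proof (rule tendsto_unique[OF _ D01_fun_left1])
    have "\<forall>\<^sub>F u in at_left (1::real). u \<in> {0<..<1}" by (rule eventually_at_leftI[of 0]) auto
    then have "\<forall>\<^sub>F u in at_left 1. D01_fun k u = D01_fun h u"
      by eventually_elim (use eq in auto)
    then show "(D01_fun h \<longlongrightarrow> D01_fun k 1) (at_left 1)"
      using D01_fun_left1 by (rule Lim_transform_eventually[rotated])
  qed simp
  with eq have "D01_fun h t = D01_fun k t" if "t \<in> {0..1}" for t using that by (cases "t = 1") auto
  then have "D01_fun h = D01_fun k"
    using D01_fun[of h] D01_fun[of k] by (auto intro: extensionalityI)
  then show ?thesis by (simp add: D01_fun_inject)
qed

lemma cadlag_rep_eq: "L2_represents (D01_fun h) g \<Longrightarrow> cadlag_rep g = h"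
  unfolding cadlag_rep_def
proof (rule the_equality)
  fix k assume "L2_represents (D01_fun h) g" "L2_represents (D01_fun k) g"
  then have "AE x in leb01. D01_fun k x = D01_fun h x"
  proof transfer
    fix h k g :: "real \<Rightarrow> real"
    assume "AE x in leb01. g x = h x" "AE x in leb01. g x = k x"
    then show "AE x in leb01. k x = h x" by eventually_elim simp
  qed
  then show "k = h" by (rule D01_eq_AE)
qed

lemma ex_D01_fun:
  assumes R: "\<And>t. t \<in> {0..<1} \<Longrightarrow> (h \<longlongrightarrow> h t) (at_right t)"
    and L: "\<And>t. t \<in> {0<..<1} \<Longrightarrow> \<exists>a::real. (h \<longlongrightarrow> a) (at_left t)"
    and one: "(h \<longlongrightarrow> h 1) (at_left 1)"
  shows "\<exists>k. \<forall>t\<in>{0..1}. D01_fun k t = h t"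
proof -
  let ?k = "restrict h {0..1}"
  have r: "(?k \<longlongrightarrow> a) (at_right t)" if "(h \<longlongrightarrow> a) (at_right t)" "t \<in> {0..<1}" for a t
  proof (rule Lim_transform_eventually[OF that(1)])
    have "\<forall>\<^sub>F u in at_right t. u \<in> {t<..<1}" by (rule eventually_at_rightI[of _ 1]) (use that in auto)
    then show "\<forall>\<^sub>F u in at_right t. h u = ?k u" by eventually_elim (use that in auto)
  qed
  have l: "(?k \<longlongrightarrow> a) (at_left t)" if "(h \<longlongrightarrow> a) (at_left t)" "t \<in> {0<..1}" for a t
  proof (rule Lim_transform_eventually[OF that(1)])
    have "\<forall>\<^sub>F u in at_left t. u \<in> {0<..<t}" by (rule eventually_at_leftI[of 0]) (use that in auto)
    then show "\<forall>\<^sub>F u in at_left t. h u = ?k u" by eventually_elim (use that in auto)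
  qed
  have "D01_fun (Abs_D01 ?k) = ?k"
  proof (rule Abs_D01_inverse, intro CollectI conjI ballI)
    show "continuous (at_right t) ?k" if "t \<in> {0..<1}" for t
      using r[OF R[OF that] that] that by (simp add: continuous_within)
    show "\<exists>a. (?k \<longlongrightarrow> a) (at_left t)" if "t \<in> {0<..<1}" for t
      using L[OF that] l[of _ t] that by auto
    show "continuous (at_left 1) ?k" using l[OF one] by (simp add: continuous_within)
  qed simp
  then show ?thesis by (intro exI[of _ "Abs_D01 ?k"]) simp
qed

lemma ex_cadlag_rep:
  assumes "g \<in> step_functions"
  shows "\<exists>h. L2_represents (D01_fun h) g"
  using assms unfolding step_functions_def
proof (induction rule: span_induct_alt)
  case base
  obtain h where h: "\<forall>t\<in>{0..1}. D01_fun h t = 0" using ex_D01_fun[of "\<lambda>_. 0"] by auto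
  then have "AE x in leb01. (0::real) = D01_fun h x" by (auto intro!: AE_I2)
  then have "L2_represents (D01_fun h) 0" by transfer
  then show ?case by blast
next
  case (step c i g)
  then obtain s t where i: "i = L2_indicator s t" "0 \<le> s" "s < t" "t \<le> 1" by auto
  from step obtain h where h: "L2_represents (D01_fun h) g" by blast
  define T where "T = (if t = 1 then 2 else t)"
  define e :: "real \<Rightarrow> real" where "e = indicator {s..<T}"
  have ev: "\<forall>\<^sub>F v in at_right u. e v = e u" for u
  proof -
    consider "u < s" | "s \<le> u" "u < T" | "T \<le> u" by linarith
    then show ?thesis
    proof cases
      case 1
      show ?thesis by (rule eventually_at_rightI[of _ s]) (use 1 i in \<open>auto simp: e_def\<close>)
    next
      case 2
      show ?thesis by (rule eventually_at_rightI[of _ T]) (use 2 i in \<open>auto simp: e_def\<close>)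
    next
      case 3
      show ?thesis by (rule eventually_at_rightI[of _ "u + 1"]) (use 3 i in \<open>auto simp: e_def\<close>)
    qed
  qed
  have el: "(e \<longlongrightarrow> (if s < u \<and> u \<le> T then 1 else 0)) (at_left u)" for u
  proof (rule tendsto_eventually)
    consider "u \<le> s" | "s < u" "u \<le> T" | "T < u" by linarith
    then show "\<forall>\<^sub>F v in at_left u. e v = (if s < u \<and> u \<le> T then 1 else 0)"
    proof cases
      case 1
      show ?thesis by (rule eventually_at_leftI[of "u - 1"]) (use 1 i in \<open>auto simp: e_def\<close>)
    next
      case 2
      show ?thesis by (rule eventually_at_leftI[of s]) (use 2 i in \<open>auto simp: e_def\<close>)
    next
      case 3
      show ?thesis by (rule eventually_at_leftI[of T]) (use 3 i in \<open>auto simp: e_def\<close>)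
    qed
  qed
  have e1: "e 1 = (if s < 1 \<and> 1 \<le> T then 1 else 0)" using i by (auto simp: e_def T_def)
  let ?h = "\<lambda>u. c * e u + D01_fun h u"
  have "\<exists>k. \<forall>u\<in>{0..1}. D01_fun k u = ?h u"
  proof (rule ex_D01_fun)
    show "(?h \<longlongrightarrow> ?h u) (at_right u)" if "u \<in> {0..<1}" for u
      by (intro tendsto_intros D01_fun_right that tendsto_eventually ev)
    show "\<exists>a. (?h \<longlongrightarrow> a) (at_left u)" if "u \<in> {0<..<1}" for u
    proof -
      have "\<forall>t\<in>{0<..<1}. \<exists>a. (D01_fun h \<longlongrightarrow> a) (at_left t)" using D01_fun[of h] by simp
      from bspec[OF this that] obtain a where a: "(D01_fun h \<longlongrightarrow> a) (at_left u)" ..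
      show ?thesis by (rule exI, rule tendsto_add[OF tendsto_mult[OF tendsto_const el] a])
    qed
    show "(?h \<longlongrightarrow> ?h 1) (at_left 1)"
      unfolding e1 by (intro tendsto_add tendsto_mult tendsto_const el D01_fun_left1)
  qed
  then obtain k where k: "\<And>u. u \<in> {0..1} \<Longrightarrow> D01_fun k u = ?h u" by blast
  have "e u = indicator {s..<t} u" if "u < 1" for u
    using that by (auto simp: e_def T_def indicator_def)
  then have k': "\<forall>u\<in>{0..<1}. D01_fun k u = c * indicator {s..<t} u + D01_fun h u"
    using k by simp
  have "L2_represents (D01_fun k) (c *\<^sub>R i + g)"
    unfolding i(1) using h k'
  proof transfer
    fix h g k :: "real \<Rightarrow> real" and c s t
    assume gh: "AE x in leb01. g x = h x" and k: "\<forall>u\<in>{0..<1}. k u = c * indicator {s..<t} u + h u"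
    have "AE x in leb01. x \<in> {0..<1}" by (rule AE_I2) simp
    with gh show "AE x in leb01. c * indicator {s..<t} x + g x = k x"
      by eventually_elim (use k in auto)
  qed
  then show ?case by blast
qed

lemma cadlag_rep_represents: "g \<in> step_functions \<Longrightarrow> L2_represents (D01_fun (cadlag_rep g)) g"
  using ex_cadlag_rep cadlag_rep_eq by metis

definition jump_set :: "L2 \<Rightarrow> real set" where
  "jump_set g = {t \<in> {0<..<1}.
     Lim (at_left t) (D01_fun (cadlag_rep g)) \<noteq> Lim (at_right t) (D01_fun (cadlag_rep g))}"

definition argmin :: "('a \<Rightarrow> 'b::ord) \<Rightarrow> 'a set \<Rightarrow> 'a set" where
  "argmin F X = {x. is_arg_min F (\<lambda>x. x \<in> X) x}"

text \<open>
  The penalty \<open>\<gamma>\<close> is an \<open>ennreal\<close>, in which \<open>1 / 0 = \<infinity>\<close> and \<open>\<infinity> * 0 = 0\<close>. So \<open>\<gamma> = \<infinity>\<close> needs no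
  separate case: every candidate with a jump gets the value \<open>\<infinity>\<close>.
\<close>

lemma "1 / ennreal 0 = \<infinity>" "(\<infinity>::ennreal) * of_nat 0 = 0"
  by (simp_all add: divide_ennreal_def)

definition H_limit :: "ennreal \<Rightarrow> L2 \<Rightarrow> L2 \<Rightarrow> ennreal" where
  "H_limit \<gamma> g f =
     (if \<gamma> = 0 then ennreal ((norm (f - g))\<^sup>2)
      else if g \<in> step_functions then \<gamma> * of_nat (card (jump_set g)) + ennreal ((norm (f - g))\<^sup>2)
      else \<infinity>)"

text \<open>
  Vectors of \<open>\<real>\<^sup>n\<close> are functions in \<open>{1..n} \<rightarrow>\<^sub>E UNIV\<close>. In \<open>H_emp\<close> only the values
  on \<open>{1..n}\<close> of the data \<open>y\<close> are used.
\<close>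

definition jumps :: "nat \<Rightarrow> (nat \<Rightarrow> real) \<Rightarrow> nat set" where
  "jumps n u = {i. 1 \<le> i \<and> i < n \<and> u i \<noteq> u (i + 1)}"

definition H_emp :: "ennreal \<Rightarrow> nat \<Rightarrow> (nat \<Rightarrow> real) \<Rightarrow> (nat \<Rightarrow> real) \<Rightarrow> ennreal" where
  "H_emp \<gamma> n u y =
     \<gamma> * of_nat (card (jumps n u)) + ennreal (1 / real n * (\<Sum>i = 1..n. (u i - y i)\<^sup>2))"

definition step_embed :: "nat \<Rightarrow> (nat \<Rightarrow> real) \<Rightarrow> L2" where
  "step_embed n u = (\<Sum>i = 1..n. u i *\<^sub>R L2_indicator ((real i - 1) / real n) (real i / real n))"

definition regression_data ::
    "L2 \<Rightarrow> (nat \<Rightarrow> nat \<Rightarrow> 'w \<Rightarrow> real) \<Rightarrow> nat \<Rightarrow> 'w \<Rightarrow> nat \<Rightarrow> real" where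
  "regression_data f \<xi> n \<omega> i =
     real n * L2_integral f ((real i - 1) / real n) (real i / real n) + \<xi> n i \<omega>"

definition centered_array :: "'w measure \<Rightarrow> (nat \<Rightarrow> nat \<Rightarrow> 'w \<Rightarrow> real) \<Rightarrow> bool" where
  "centered_array M \<xi> \<longleftrightarrow>
     (\<forall>n. \<forall>i\<in>{1..n}. integrable M (\<xi> n i) \<and> (LINT \<omega>|M. \<xi> n i \<omega>) = 0)"

definition condition_A :: "'w measure \<Rightarrow> (nat \<Rightarrow> nat \<Rightarrow> 'w \<Rightarrow> real) \<Rightarrow> bool" where
  "condition_A M \<xi> \<longleftrightarrow>
     (\<forall>n\<ge>1. prob_space.indep_vars M (\<lambda>_. borel) (\<xi> n) {1..n}) \<and>
     (\<exists>\<beta> :: nat \<Rightarrow> real. (\<lambda>n. \<beta> n / real n) \<longlonglongrightarrow> 0 \<and>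
        (AE \<omega> in M. \<forall>\<^sub>F n in sequentially.
           (MAX (i, j)\<in>{(i, j). 1 \<le> i \<and> i \<le> j \<and> j \<le> n}.
              (\<Sum>k = i..j. \<xi> n k \<omega>)\<^sup>2 / real (j - i + 1)) \<le> \<beta> n))"

end

theory Submission
  imports Defs
begin

text \<open>
  Put \<open>\<gamma> = 1 / \<zeta>\<close>. If \<open>E k\<close> is the least squared error of a step function with at most \<open>k\<close> jumps,
  then \<open>g\<close> is a minimizer at \<open>\<zeta>\<close> if and only if its number \<open>k\<close> of jumps minimizes \<open>k + \<zeta> * E k\<close> and
  \<open>g\<close> is a best fit with at most \<open>k\<close> jumps. The optimal \<open>k\<close> increase with \<open>\<zeta>\<close>, and the hypotheses
  leave exactly one best fit for each of them. Hence a cadlag selection \<open>\<tau>\<close> is piecewise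
  constant and is determined by the integer valued path of its numbers of jumps.

  An empirical minimizer is the projection of \<open>f\<close> plus noise onto the step functions of its own
  partition. This projection of \<open>f\<close> depends continuously on the partition, even where intervals
  degenerate, and Condition (A) makes the projection of the noise small. So empirical minimizers
  are compact: along a subsequence the partitions converge and the limit is a minimizer with the
  same number of jumps, which gives convergence in \<open>L\<^sup>2\<close> as well as in \<open>D([0,1))\<close>. It remains to
  compare the numbers of jumps, which are nondecreasing in \<open>\<zeta>\<close>: a time change that carries the
  passage times of the limit to those of the empirical path matches them on a compact interval.
\<close>

section \<open>Indicators and interval means in \<open>L\<^sup>2\<close>\<close>

text \<open>The noise, seen as an element of \<open>L2\<close>, need not become small in norm. Only
  its inner products with indicators of grid intervals do, uniformly over all of them, which is
  required because the data choose the partition. Its projection onto \<open>k + 1\<close> intervals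
  has squared norm at most \<open>(k + 1) * \<beta> n / n\<close>, so compactness needs an a priori
  bound on the number of jumps; comparison with the zero function supplies it. In a limit of
  minimizers with \<open>k\<close> jumps, partition points might collide. The limit would then be a
  competitor with the same error and fewer jumps, which optimality excludes. This is what lifts
  convergence in \<open>L2\<close> to convergence in \<open>D01\<close>. For the paths, the obstacle
  is a time at which the limit count jumps by more than one, since a time change can carry it to one
  point only. The bound of two minimizers leaves just the counts before and after such a time, and
  nearby empirical counts take no other value, so they too make the whole jump at once.\<close>

lemma L2_inner_indicator:
  assumes "0 \<le> a" "b \<le> 1" "0 \<le> c" "d \<le> 1"
  shows "inner (L2_indicator a b) (L2_indicator c d) = max 0 (min b d - max a c)"
  using assms
proof transfer
  fix a b c d :: real assume *: "0 \<le> a" "b \<le> 1" "0 \<le> c" "d \<le> 1"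
  have "(\<lambda>x. indicator {a..<b} x * indicator {c..<d} x :: real) = indicator {max a c..<min b d}"
    by (auto simp: indicator_def fun_eq_iff)
  then have "(LINT x|leb01. indicator {a..<b} x * indicator {c..<d} x :: real) = (LINT x|leb01. indicator {max a c..<min b d} x)"
    by simp
  also have "\<dots> = measure leb01 ({max a c..<min b d} \<inter> space leb01)"
    by simp
  also have "{max a c..<min b d} \<inter> space leb01 = {max a c..<min b d}"
    using * by auto
  also have "measure leb01 {max a c..<min b d} = measure lebesgue {max a c..<min b d}"
    by (rule measure_restrict_space) (use * in auto)
  also have "\<dots> = max 0 (min b d - max a c)"
    by (cases "max a c \<le> min b d") auto
  finally show "(LINT x|leb01. indicator {a..<b} x * indicator {c..<d} x :: real) = max 0 (min b d - max a c)" .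
qed

lemma L2_indicator_empty: "b \<le> a \<Longrightarrow> L2_indicator a b = 0"
  
proof transfer
  fix a b :: real assume "b \<le> a"
  then have "(indicator {a..<b} :: real \<Rightarrow> real) = (\<lambda>x. 0)" by (auto simp: fun_eq_iff)
  then show "square_integrable01 (indicator {a..<b}) \<and> square_integrable01 (\<lambda>x. 0) \<and>
      (AE x in leb01. indicator {a..<b} x = (0::real))"
    by (simp add: square_integrable01_0)
qed

text \<open>The squared norm is the measure of the symmetric difference, all of which lies between
  the two left ends or between the two right ends.\<close>

lemma norm_L2_indicator_diff_le:
  assumes "0 \<le> a" "a \<le> b" "b \<le> 1" "0 \<le> c" "c \<le> d" "d \<le> 1"
  shows "(norm (L2_indicator a b - L2_indicator c d))\<^sup>2 \<le> \<bar>a - c\<bar> + \<bar>b - d\<bar>"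
  unfolding power2_norm_eq_inner inner_diff_left inner_diff_right
  using assms by (simp add: L2_inner_indicator)

lemma tendsto_L2_indicator:
  assumes "a \<longlonglongrightarrow> a'" "b \<longlonglongrightarrow> b'" "\<And>n::nat. 0 \<le> a n" "\<And>n. a n \<le> b n" "\<And>n. b n \<le> 1"
  shows "(\<lambda>n. L2_indicator (a n) (b n)) \<longlonglongrightarrow> L2_indicator a' b'"
proof -
  have lim: "0 \<le> a'" "a' \<le> b'" "b' \<le> 1"
    using assms LIMSEQ_le_const[OF assms(1)] LIMSEQ_le[OF assms(1,2)] LIMSEQ_le_const2[OF assms(2)] by auto
  have "(\<lambda>n. sqrt (\<bar>a n - a'\<bar> + \<bar>b n - b'\<bar>)) \<longlonglongrightarrow> sqrt (\<bar>a' - a'\<bar> + \<bar>b' - b'\<bar>)"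
    by (intro tendsto_intros assms)
  then have lim0: "(\<lambda>n. sqrt (\<bar>a n - a'\<bar> + \<bar>b n - b'\<bar>)) \<longlonglongrightarrow> 0" by simp
  have le: "norm (L2_indicator (a n) (b n) - L2_indicator a' b') \<le> sqrt (\<bar>a n - a'\<bar> + \<bar>b n - b'\<bar>)" for n
    using assms lim by (intro real_le_rsqrt norm_L2_indicator_diff_le) auto
  have "(\<lambda>n. L2_indicator (a n) (b n) - L2_indicator a' b') \<longlonglongrightarrow> 0"
    by (rule Lim_null_comparison[OF always_eventually lim0]) (use le in blast)
  then show ?thesis by (simp add: LIM_zero_iff)
qed

text \<open>Truncation: \<open>h\<close> agrees with \<open>f\<close> where the modulus of
  \<open>f\<close> exceeds a level and vanishes elsewhere. Its squared norm tends to zero as the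
  level grows, by dominated convergence, and \<open>f - h\<close> is bounded by the level.\<close>

lemma L2_bounded_approx:
  fixes f :: L2
  assumes "0 < e"
  shows "\<exists>N h. inner h h < e \<and> (\<forall>a b. 0 \<le> a \<and> a \<le> b \<and> b \<le> 1 \<longrightarrow> \<bar>inner (f - h) (L2_indicator a b)\<bar> \<le> N * (b - a))"
  using assms
proof transfer
  fix e :: real and f :: "real \<Rightarrow> real"
  assume e: "0 < e" and "square_integrable01 f \<and> square_integrable01 f \<and> (AE x in leb01. f x = f x)"
  then have f: "square_integrable01 f" by simp
  then have fm [measurable]: "f \<in> borel_measurable leb01" and fi: "integrable leb01 (\<lambda>x. (f x)\<^sup>2)"
    by (auto simp: square_integrable01_def)
  define h where "h n x = (if \<bar>f x\<bar> \<le> real n then 0 else f x)" for n x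
  have hm [measurable]: "h n \<in> borel_measurable leb01" for n unfolding h_def by measurable
  have hf: "(h n x)\<^sup>2 \<le> (f x)\<^sup>2" for n x by (simp add: h_def)
  have hs: "square_integrable01 (h n)" for n
    unfolding square_integrable01_def using hf
    by (intro conjI hm Bochner_Integration.integrable_bound[OF fi]) auto
  have "(\<lambda>n. LINT x|leb01. (h n x)\<^sup>2) \<longlonglongrightarrow> (LINT x|leb01. (0::real))"
  proof (rule integral_dominated_convergence[where w = "\<lambda>x. (f x)\<^sup>2"])
    show "AE x in leb01. (\<lambda>n. (h n x)\<^sup>2) \<longlonglongrightarrow> 0"
    proof (rule AE_I2, rule tendsto_eventually)
      fix x
      obtain N where "\<bar>f x\<bar> \<le> real N" using real_arch_simple by blast
      then show "\<forall>\<^sub>F n in sequentially. (h n x)\<^sup>2 = 0"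
        by (intro eventually_sequentiallyI[of N]) (auto simp: h_def)
    qed
    show "AE x in leb01. norm ((h n x)\<^sup>2) \<le> (f x)\<^sup>2" for n using hf by (intro AE_I2) simp
  qed (use fi in auto)
  then have "\<forall>\<^sub>F n in sequentially. (LINT x|leb01. (h n x)\<^sup>2) < e"
    using e by (intro order_tendstoD(2)) auto
  then obtain n where n: "(LINT x|leb01. (h n x)\<^sup>2) < e" by (auto simp: eventually_sequentially)
  have bd: "\<bar>LINT x|leb01. (f x - h n x) * indicator {a..<b} x\<bar> \<le> real n * (b - a)"
    if ab: "0 \<le> a \<and> a \<le> b \<and> b \<le> 1" for a b
  proof -
    have "norm (LINT x|leb01. (f x - h n x) * indicator {a..<b} x) \<le> (LINT x|leb01. real n * indicator {a..<b} x)"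
    proof (rule Bochner_Integration.integral_norm_bound_integral)
      show "integrable leb01 (\<lambda>x. (f x - h n x) * indicator {a..<b} x)"
        by (intro square_integrable01_mult square_integrable01_diff f hs square_integrable01_indicator)
      show "integrable leb01 (\<lambda>x. real n * indicator {a..<b} x)"
        using square_integrable01_mult[OF square_integrable01_indicator[of a b] square_integrable01_indicator[of a b]]
        by (intro integrable_mult_right) (simp add: indicator_inter_arith[symmetric])
    qed (auto simp: h_def indicator_def)
    also have "\<dots> = real n * measure leb01 ({a..<b} \<inter> space leb01)" by simp
    also have "{a..<b} \<inter> space leb01 = {a..<b}" using ab by auto
    also have "measure leb01 {a..<b} = measure lebesgue {a..<b}"
      by (rule measure_restrict_space) (use ab in auto)
    finally show ?thesis using ab by simp
  qed
  show "\<exists>N. \<exists>h\<in>{f. square_integrable01 f \<and> square_integrable01 f \<and> (AE x in leb01. f x = f x)}.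
    (LINT x|leb01. h x * h x) < e \<and> (\<forall>a b. 0 \<le> a \<and> a \<le> b \<and> b \<le> 1 \<longrightarrow>
      \<bar>LINT x|leb01. (f x - h x) * indicator {a..<b} x\<bar> \<le> N * (b - a))"
    by (rule exI[of _ "real n"], rule bexI[of _ "h n"]) (use n bd hs in \<open>auto simp: power2_eq_square\<close>)
qed

text \<open>Cauchy-Schwarz alone gives the factor \<open>inner f f\<close>. On short intervals it
  can be replaced by any \<open>e > 0\<close>: the bounded part of \<open>f\<close> contributes only
  the order \<open>(b - a)\<^sup>2\<close>, and the remainder has small norm. This makes projections
  vanish on collapsing intervals.\<close>

lemma L2_inner_small_interval:
  fixes f :: L2
  assumes "0 < e"
  obtains d where "0 < d"
    "\<And>a b. 0 \<le> a \<Longrightarrow> a \<le> b \<Longrightarrow> b \<le> 1 \<Longrightarrow> b - a < d \<Longrightarrow> (inner f (L2_indicator a b))\<^sup>2 \<le> e * (b - a)"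
proof -
  obtain N h where h: "inner h h < e / 4"
    and N: "\<And>a b. 0 \<le> a \<Longrightarrow> a \<le> b \<Longrightarrow> b \<le> 1 \<Longrightarrow> \<bar>inner (f - h) (L2_indicator a b)\<bar> \<le> N * (b - a)"
    using L2_bounded_approx[of "e / 4" f] assms by auto
  \<comment> \<open>Chosen so that \<open>N\<^sup>2 * (b - a) \<le> e / 4\<close> whenever
    \<open>b - a < d\<close>; the added 1 covers \<open>N = 0\<close>.\<close>
  define d where "d = e / (4 * (N\<^sup>2 + 1))"
  have d: "0 < d" using assms by (simp add: d_def add_nonneg_pos)
  have "(inner f (L2_indicator a b))\<^sup>2 \<le> e * (b - a)" if ab: "0 \<le> a" "a \<le> b" "b \<le> 1" "b - a < d" for a b
  proof -
    let ?p = "inner (f - h) (L2_indicator a b)" and ?q = "inner h (L2_indicator a b)"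
    have "?p\<^sup>2 \<le> (N * (b - a))\<^sup>2" using N[OF ab(1-3)] by (rule abs_le_square_iff[THEN iffD1, OF order_trans]) auto
    also have "\<dots> = N\<^sup>2 * (b - a) * (b - a)" by (simp add: power2_eq_square algebra_simps)
    also have "\<dots> \<le> (N\<^sup>2 + 1) * d * (b - a)" using ab by (intro mult_right_mono mult_mono) auto
    also have "(N\<^sup>2 + 1) * d = e / 4" by (simp add: d_def field_simps add_nonneg_eq_0_iff)
    finally have p: "?p\<^sup>2 \<le> e / 4 * (b - a)" .
    have "?q\<^sup>2 \<le> inner h h * inner (L2_indicator a b) (L2_indicator a b)" by (rule Cauchy_Schwarz_ineq)
    also have "\<dots> = inner h h * (b - a)" using ab by (simp add: L2_inner_indicator)
    also have "\<dots> \<le> e / 4 * (b - a)" using h ab by (intro mult_right_mono) auto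
    finally have q: "?q\<^sup>2 \<le> e / 4 * (b - a)" .
    have "inner f (L2_indicator a b) = ?p + ?q" by (simp add: inner_diff_left)
    then have "(inner f (L2_indicator a b))\<^sup>2 \<le> 2 * ?p\<^sup>2 + 2 * ?q\<^sup>2"
      using sum_squares_bound[of ?p ?q] by (simp add: power2_sum)
    with p q show ?thesis by simp
  qed
  with d show thesis by (rule that)
qed

definition L2_mean :: "L2 \<Rightarrow> real \<Rightarrow> real \<Rightarrow> real" where
  "L2_mean f a b = inner f (L2_indicator a b) / (b - a)"

lemma norm_L2_mean_indicator:
  assumes "0 \<le> a" "a \<le> b" "b \<le> 1"
  shows "(norm (L2_mean f a b *\<^sub>R L2_indicator a b))\<^sup>2 = (inner f (L2_indicator a b))\<^sup>2 / (b - a)"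
  using assms unfolding power2_norm_eq_inner
  by (simp add: L2_inner_indicator L2_mean_def power2_eq_square)

text \<open>Continuity also holds where the interval degenerates; there \<^const>\<open>L2_mean\<close> is \<open>x / 0 = 0\<close>.\<close>

lemma tendsto_L2_mean_indicator:
  assumes "a \<longlonglongrightarrow> a'" "b \<longlonglongrightarrow> b'" "\<And>n::nat. 0 \<le> a n" "\<And>n. a n \<le> b n" "\<And>n. b n \<le> 1"
  shows "(\<lambda>n. L2_mean f (a n) (b n) *\<^sub>R L2_indicator (a n) (b n)) \<longlonglongrightarrow> L2_mean f a' b' *\<^sub>R L2_indicator a' b'"
proof (cases "a' = b'")
  case False
  then show ?thesis unfolding L2_mean_def
    by (intro tendsto_intros tendsto_L2_indicator assms) auto
next
  case True
  have "(\<lambda>n. L2_mean f (a n) (b n) *\<^sub>R L2_indicator (a n) (b n)) \<longlonglongrightarrow> 0"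
  proof (rule tendstoI)
    fix e :: real assume e: "0 < e"
    then have "0 < e\<^sup>2 / 2" by simp
    then obtain d where d: "0 < d" "\<And>a b. 0 \<le> a \<Longrightarrow> a \<le> b \<Longrightarrow> b \<le> 1 \<Longrightarrow> b - a < d \<Longrightarrow>
        (inner f (L2_indicator a b))\<^sup>2 \<le> e\<^sup>2 / 2 * (b - a)"
      by (rule L2_inner_small_interval[of _ f]) (rule that)
    have "(\<lambda>n. b n - a n) \<longlonglongrightarrow> b' - a'" by (intro tendsto_intros assms)
    then have "\<forall>\<^sub>F n in sequentially. b n - a n < d" using d True by (intro order_tendstoD(2)) auto
    then show "\<forall>\<^sub>F n in sequentially. dist (L2_mean f (a n) (b n) *\<^sub>R L2_indicator (a n) (b n)) 0 < e"
    proof eventually_elim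
      case (elim n)
      have "(inner f (L2_indicator (a n) (b n)))\<^sup>2 / (b n - a n) \<le> e\<^sup>2 / 2"
        using d(2)[OF assms(3-5) elim] assms(4)[of n] by (cases "a n = b n") (simp_all add: pos_divide_le_eq)
      also have "\<dots> < e\<^sup>2" using e by simp
      finally have "(norm (L2_mean f (a n) (b n) *\<^sub>R L2_indicator (a n) (b n)))\<^sup>2 < e\<^sup>2"
        using norm_L2_mean_indicator[OF assms(3-5)] by simp
      then show ?case using e by (auto simp: dist_norm intro: power_less_imp_less_base)
    qed
  qed
  then show ?thesis using True by (simp add: L2_indicator_empty)
qed

section \<open>Piecewise constant representatives of step functions\<close>

text \<open>\<open>B\<close> may contain points at which \<open>h\<close> does not jump. The half
  open interval encodes right continuity, and since \<open>B\<close> omits 1, the case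
  \<open>y = 1\<close> also gives left continuity at 1.\<close>

definition piecewise_const :: "real set \<Rightarrow> (real \<Rightarrow> real) \<Rightarrow> bool" where
  "piecewise_const B h \<longleftrightarrow> finite B \<and> B \<subseteq> {0<..<1} \<and>
     (\<forall>x y. 0 \<le> x \<longrightarrow> x \<le> y \<longrightarrow> y \<le> 1 \<longrightarrow> B \<inter> {x<..y} = {} \<longrightarrow> h x = h y)"

abbreviation cadlag_fun :: "L2 \<Rightarrow> real \<Rightarrow> real" where
  "cadlag_fun g \<equiv> D01_fun (cadlag_rep g)"

lemma piecewise_constD:
  "piecewise_const B h \<Longrightarrow> 0 \<le> x \<Longrightarrow> x \<le> y \<Longrightarrow> y \<le> 1 \<Longrightarrow> B \<inter> {x<..y} = {} \<Longrightarrow> h x = h y"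
  unfolding piecewise_const_def by blast

lemma piecewise_const_finite: "piecewise_const B h \<Longrightarrow> finite B"
  and piecewise_const_subset: "piecewise_const B h \<Longrightarrow> B \<subseteq> {0<..<1}"
  by (auto simp: piecewise_const_def)

lemma piecewise_const_cong:
  "piecewise_const B h \<Longrightarrow> (\<And>x. x \<in> {0..1} \<Longrightarrow> h x = k x) \<Longrightarrow> piecewise_const B k"
proof -
  assume h: "piecewise_const B h" and eq: "\<And>x. x \<in> {0..1} \<Longrightarrow> h x = k x"
  have "k x = k y" if "0 \<le> x" "x \<le> y" "y \<le> 1" "B \<inter> {x<..y} = {}" for x y
    using piecewise_constD[OF h that] eq[of x] eq[of y] that by simp
  then show ?thesis using h unfolding piecewise_const_def by blast
qed

lemma piecewise_const_right:
  assumes "piecewise_const B h" "t \<in> {0..<1}"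
  shows "\<forall>\<^sub>F u in at_right t. h u = h t"
proof -
  define b where "b = Min (insert 1 (B \<inter> {t<..}))"
  have fin: "finite (insert 1 (B \<inter> {t<..}))" using piecewise_const_finite[OF assms(1)] by auto
  have b: "t < b" "b \<le> 1" unfolding b_def using fin assms(2) by (auto simp: Min_gr_iff)
  have "h t = h u" if "u \<in> {t<..<b}" for u
  proof (rule piecewise_constD[OF assms(1)])
    show "B \<inter> {t<..u} = {}"
    proof (rule ccontr)
      assume "B \<inter> {t<..u} \<noteq> {}"
      then obtain v where v: "v \<in> B" "t < v" "v \<le> u" by auto
      then have "b \<le> v" unfolding b_def using fin by (intro Min_le) auto
      then show False using v that by auto
    qed
  qed (use that b assms in auto)
  then show ?thesis by (intro eventually_at_rightI[OF _ b(1)]) auto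
qed

lemma piecewise_const_left:
  assumes "piecewise_const B h" "0 < t" "t \<le> 1"
  shows "\<exists>s. 0 \<le> s \<and> s < t \<and> B \<inter> {s<..<t} = {} \<and> (\<forall>u. s \<le> u \<longrightarrow> u < t \<longrightarrow> h u = h s) \<and>
    (\<forall>\<^sub>F u in at_left t. h u = h s)"
proof -
  define s where "s = Max (insert 0 (B \<inter> {..<t}))"
  have fin: "finite (insert 0 (B \<inter> {..<t}))" using piecewise_const_finite[OF assms(1)] by auto
  have s: "0 \<le> s" "s < t" unfolding s_def using fin assms(2) by auto
  have e: "B \<inter> {s<..<t} = {}"
  proof (rule ccontr)
    assume "B \<inter> {s<..<t} \<noteq> {}"
    then obtain v where v: "v \<in> B" "s < v" "v < t" by auto
    then have "v \<le> s" unfolding s_def using fin by (intro Max_ge) auto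
    then show False using v by auto
  qed
  have eq: "h u = h s" if "s \<le> u" "u < t" for u
    by (rule piecewise_constD[OF assms(1), symmetric]) (use that s e assms(3) in auto)
  moreover have "\<forall>\<^sub>F u in at_left t. h u = h s"
    by (rule eventually_at_leftI[OF _ s(2)], rule eq) auto
  ultimately show ?thesis using s e by blast
qed

lemma piecewise_const_ex_D01:
  assumes "piecewise_const B h"
  shows "\<exists>k. \<forall>t\<in>{0..1}. D01_fun k t = h t"
proof (rule ex_D01_fun)
  show "(h \<longlongrightarrow> h t) (at_right t)" if "t \<in> {0..<1}" for t
    by (rule tendsto_eventually) (rule piecewise_const_right[OF assms that])
  show "\<exists>a. (h \<longlongrightarrow> a) (at_left t)" if "t \<in> {0<..<1}" for t
  proof -
    have pos: "0 < t" "t \<le> 1" using that by auto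
    obtain s where "\<forall>\<^sub>F u in at_left t. h u = h s"
      using piecewise_const_left[OF assms pos] by blast
    then show ?thesis by (blast intro: tendsto_eventually)
  qed
  obtain s where s: "0 \<le> s" "s < 1" "B \<inter> {s<..<1} = {}" "\<forall>\<^sub>F u in at_left 1. h u = h s"
    using piecewise_const_left[OF assms zero_less_one order_refl] by blast
  have "B \<inter> {s<..1} = {}" using s(3) piecewise_const_subset[OF assms] by force
  then have "h s = h 1" by (intro piecewise_constD[OF assms]) (use s(1,2) in auto)
  then show "(h \<longlongrightarrow> h 1) (at_left 1)" using s(4) by (intro tendsto_eventually) simp
qed

lemma L2_represents_cong:
  "(\<And>x. x \<in> {0..<1} \<Longrightarrow> h x = k x) \<Longrightarrow> L2_represents h g \<longleftrightarrow> L2_represents k g"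
proof -
  assume "\<And>x. x \<in> {0..<1} \<Longrightarrow> h x = k x"
  then have "\<forall>x\<in>{0..<1}. h x = k x" by blast
  then show ?thesis
  proof transfer
    fix h k g :: "real \<Rightarrow> real"
    assume "\<forall>x\<in>{0..<1}. h x = k x"
    then show "(AE x in leb01. g x = h x) = (AE x in leb01. g x = k x)" by (intro AE_cong) auto
  qed
qed

lemma L2_represents_unique: "L2_represents h g \<Longrightarrow> L2_represents h g' \<Longrightarrow> g = g'"
proof transfer
  fix h g g' :: "real \<Rightarrow> real"
  assume *: "AE x in leb01. g x = h x" "AE x in leb01. g' x = h x"
    "square_integrable01 g \<and> square_integrable01 g \<and> (AE x in leb01. g x = g x)"
    "square_integrable01 g' \<and> square_integrable01 g' \<and> (AE x in leb01. g' x = g' x)"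
  from *(1,2) have "AE x in leb01. g x = g' x" by eventually_elim simp
  then show "square_integrable01 g \<and> square_integrable01 g' \<and> (AE x in leb01. g x = g' x)" using * by simp
qed

lemma L2_represents_0: "L2_represents (\<lambda>x. 0) 0"
  by transfer simp

lemma L2_represents_indicator: "L2_represents (\<lambda>x. indicator {s..<t} x) (L2_indicator s t)"
  by transfer simp

lemma L2_represents_scale: "L2_represents h g \<Longrightarrow> L2_represents (\<lambda>x. c * h x) (c *\<^sub>R g)"
  by transfer (auto elim: AE_mp intro!: AE_I2)

lemma L2_represents_add:
  "L2_represents h g \<Longrightarrow> L2_represents h' g' \<Longrightarrow> L2_represents (\<lambda>x. h x + h' x) (g + g')"
proof transfer
  fix h g h' g' :: "real \<Rightarrow> real"
  assume "AE x in leb01. g x = h x" "AE x in leb01. g' x = h' x"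
  then show "AE x in leb01. g x + g' x = h x + h' x" by eventually_elim simp
qed

lemma L2_represents_sum:
  "finite A \<Longrightarrow> (\<And>i. i \<in> A \<Longrightarrow> L2_represents (h i) (g i)) \<Longrightarrow> L2_represents (\<lambda>x. \<Sum>i\<in>A. h i x) (\<Sum>i\<in>A. g i)"
  by (induction A rule: finite_induct) (auto intro: L2_represents_0 L2_represents_add)

lemma cadlag_fun_eq:
  assumes "piecewise_const B h" "L2_represents h g"
  shows "\<And>t. t \<in> {0..1} \<Longrightarrow> cadlag_fun g t = h t"
proof -
  obtain k where k: "\<forall>t\<in>{0..1}. D01_fun k t = h t" using piecewise_const_ex_D01[OF assms(1)] by blast
  then have "L2_represents (D01_fun k) g"
    using assms(2) L2_represents_cong[of "D01_fun k" h g] by simp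
  then have "cadlag_rep g = k" by (rule cadlag_rep_eq)
  then show "\<And>t. t \<in> {0..1} \<Longrightarrow> cadlag_fun g t = h t" using k by simp
qed

lemma piecewise_const_cadlag_fun:
  assumes "piecewise_const B h" "L2_represents h g"
  shows "piecewise_const B (cadlag_fun g)"
  by (rule piecewise_const_cong[OF assms(1)]) (simp add: cadlag_fun_eq[OF assms])

lemma ex_piecewise_const:
  assumes "g \<in> step_functions"
  shows "\<exists>B. piecewise_const B (cadlag_fun g)"
proof -
  have "\<exists>B h. piecewise_const B h \<and> L2_represents h g"
    using assms unfolding step_functions_def
  proof (induction rule: span_induct_alt)
    case base
    show ?case by (intro exI[of _ "{}"] exI[of _ "\<lambda>_. 0"]) (auto simp: piecewise_const_def L2_represents_0)
  next
    case (step c i g)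
    then obtain s t where i: "i = L2_indicator s t" "0 \<le> s" "s < t" "t \<le> 1" by auto
    from step obtain B h where h: "piecewise_const B h" "L2_represents h g" by blast
    \<comment> \<open>An indicator that ends at 1 has to keep its value at 1 to be left continuous
      there, so its end is moved beyond 1.\<close>
    define T where "T = (if t = 1 then 2 else t)"
    let ?h = "\<lambda>x. c * indicator {s..<T} x + h x" and ?B = "B \<union> ({s, t} \<inter> {0<..<1})"
    have "piecewise_const ?B ?h"
      unfolding piecewise_const_def
    proof (intro conjI allI impI)
      fix x y :: real assume *: "0 \<le> x" "x \<le> y" "y \<le> 1" "?B \<inter> {x<..y} = {}"
      have "h x = h y" by (rule piecewise_constD[OF h(1)]) (use * in auto)
      moreover have st: "s \<notin> {x<..y} \<or> s \<notin> {0<..<1}" "t \<notin> {x<..y} \<or> t \<notin> {0<..<1}" using *(4) by auto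
      have "(indicator {s..<T} x :: real) = indicator {s..<T} y"
      proof -
        have "s \<le> x \<longleftrightarrow> s \<le> y" using st(1) * i by auto
        moreover have "x < T \<longleftrightarrow> y < T"
        proof (cases "t = 1")
          case False
          then have "\<not> (x < t \<and> t \<le> y)" using st(2) i by simp
          then show ?thesis using False *(2) by (simp add: T_def) linarith
        qed (use * in \<open>simp add: T_def\<close>)
        ultimately show ?thesis by (simp add: indicator_def)
      qed
      ultimately show "?h x = ?h y" by simp
    qed (use h in \<open>auto simp: piecewise_const_def\<close>)
    moreover have "L2_represents ?h (c *\<^sub>R i + g)"
    proof (rule L2_represents_add[OF _ h(2)])
      have "L2_represents (\<lambda>x. c * indicator {s..<t} x) (c *\<^sub>R i)"
        unfolding i(1) by (intro L2_represents_scale L2_represents_indicator)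
      then show "L2_represents (\<lambda>x. c * indicator {s..<T} x) (c *\<^sub>R i)"
        by (subst L2_represents_cong[where k = "\<lambda>x. c * indicator {s..<t} x"]) (auto simp: T_def indicator_def)
    qed
    ultimately show ?case by blast
  qed
  then show ?thesis using piecewise_const_cadlag_fun by blast
qed

lemma jump_set_iff:
  assumes "piecewise_const B (cadlag_fun g)" "t \<in> {0<..<1}" "\<forall>\<^sub>F u in at_left t. cadlag_fun g u = a"
  shows "t \<in> jump_set g \<longleftrightarrow> a \<noteq> cadlag_fun g t"
proof -
  have "Lim (at_right t) (cadlag_fun g) = cadlag_fun g t"
    by (rule tendsto_Lim) (use D01_fun_right[of t] assms(2) in auto)
  moreover have "Lim (at_left t) (cadlag_fun g) = a"
    by (rule tendsto_Lim) (use assms(3) tendsto_eventually in auto)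
  ultimately show ?thesis using assms(2) by (simp add: jump_set_def)
qed

lemma jump_set_subset:
  assumes "piecewise_const B (cadlag_fun g)"
  shows "jump_set g \<subseteq> B"
proof
  fix t assume t: "t \<in> jump_set g"
  then have t01: "t \<in> {0<..<1}" by (simp add: jump_set_def)
  have pos: "0 < t" "t \<le> 1" using t01 by auto
  obtain s where s: "0 \<le> s" "s < t" "B \<inter> {s<..<t} = {}" "\<forall>\<^sub>F u in at_left t. cadlag_fun g u = cadlag_fun g s"
    using piecewise_const_left[OF assms pos] by blast
  have "cadlag_fun g s \<noteq> cadlag_fun g t" using jump_set_iff[OF assms t01 s(4)] t by simp
  show "t \<in> B"
  proof (rule ccontr)
    assume "t \<notin> B"
    then have "B \<inter> {s<..t} = {}" using s(3) by (auto simp: less_le)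
    then have "cadlag_fun g s = cadlag_fun g t"
      by (intro piecewise_constD[OF assms]) (use s t01 in auto)
    then show False using \<open>cadlag_fun g s \<noteq> cadlag_fun g t\<close> by simp
  qed
qed

text \<open>Where there is no jump, the left limit equals the value, so the pieces on both sides of
  \<open>b\<close> can be joined.\<close>

lemma piecewise_const_remove:
  assumes "piecewise_const B (cadlag_fun g)" "b \<notin> jump_set g"
  shows "piecewise_const (B - {b}) (cadlag_fun g)"
proof (cases "b \<in> B")
  case True
  then have b: "b \<in> {0<..<1}" using piecewise_const_subset[OF assms(1)] by auto
  have pos: "0 < b" "b \<le> 1" using b by auto
  obtain s where s: "0 \<le> s" "s < b" "\<And>u. s \<le> u \<Longrightarrow> u < b \<Longrightarrow> cadlag_fun g u = cadlag_fun g s"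
    "\<forall>\<^sub>F u in at_left b. cadlag_fun g u = cadlag_fun g s"
    using piecewise_const_left[OF assms(1) pos] by blast
  have sb: "cadlag_fun g s = cadlag_fun g b" using jump_set_iff[OF assms(1) b s(4)] assms(2) by simp
  show ?thesis
    unfolding piecewise_const_def
  proof (intro conjI allI impI)
    fix x y :: real assume *: "0 \<le> x" "x \<le> y" "y \<le> 1" "(B - {b}) \<inter> {x<..y} = {}"
    show "cadlag_fun g x = cadlag_fun g y"
    proof (cases "x < b \<and> b \<le> y")
      case True
      have "cadlag_fun g b = cadlag_fun g y"
        by (rule piecewise_constD[OF assms(1)]) (use * True b in auto)
      \<comment> \<open>The value at \<open>x\<close> is carried to \<open>max x s\<close>, where
        the function already has its left limit at \<open>b\<close>.\<close>
      moreover have "cadlag_fun g x = cadlag_fun g (max x s)"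
      proof (rule piecewise_constD[OF assms(1)])
        have "{x<..max x s} \<subseteq> {x<..y} - {b}" using True s(2) by auto
        then show "B \<inter> {x<..max x s} = {}" using *(4) by blast
      qed (use *(1,2,3) True s(2) in auto)
      moreover have "cadlag_fun g (max x s) = cadlag_fun g s" by (rule s(3)) (use s(2) True in auto)
      ultimately show ?thesis using sb by simp
    next
      case False
      then have "b \<notin> {x<..y}" by simp
      then have "B \<inter> {x<..y} = {}" using *(4) by blast
      then show ?thesis by (rule piecewise_constD[OF assms(1) *(1-3)])
    qed
  qed (use piecewise_const_finite[OF assms(1)] piecewise_const_subset[OF assms(1)] in auto)
qed (use assms in simp)

text \<open>Any admissible finite set can be thinned out by discarding, one at a time, the points
  that are not jumps.\<close>

lemma piecewise_const_jump_set:
  assumes "g \<in> step_functions"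
  shows "piecewise_const (jump_set g) (cadlag_fun g)"
proof -
  obtain B where B: "piecewise_const B (cadlag_fun g)" using ex_piecewise_const[OF assms] by blast
  have "piecewise_const (B - F) (cadlag_fun g)" if "finite F" "F \<inter> jump_set g = {}" for F
    using that
  proof (induction F rule: finite_induct)
    case (insert b F)
    then have "piecewise_const (B - F - {b}) (cadlag_fun g)" by (intro piecewise_const_remove) auto
    then show ?case by (simp only: Diff_insert[of B b F])
  qed (use B in simp)
  then have "piecewise_const (B - (B - jump_set g)) (cadlag_fun g)"
    using piecewise_const_finite[OF B] by auto
  moreover have "B - (B - jump_set g) = jump_set g" using jump_set_subset[OF B] by auto
  ultimately show ?thesis by simp
qed

lemma finite_jump_set: "g \<in> step_functions \<Longrightarrow> finite (jump_set g)"
  using piecewise_const_jump_set piecewise_const_finite by blast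

section \<open>Projection onto the step functions of a partition\<close>

text \<open>Equal neighbours are allowed, so that the partitions with a fixed number of points form
  a compact set.\<close>

definition partition_pts :: "nat \<Rightarrow> (nat \<Rightarrow> real) \<Rightarrow> bool" where
  "partition_pts k t \<longleftrightarrow> t 0 = 0 \<and> t (Suc k) = 1 \<and> (\<forall>i\<le>k. t i \<le> t (Suc i))"

lemma partition_pts_mono:
  assumes "partition_pts k t" "i \<le> j" "j \<le> Suc k"
  shows "t i \<le> t j"
  using assms(2,3)
proof (induction j)
  case (Suc j)
  show ?case
  proof (cases "i = Suc j")
    case False
    then have "t i \<le> t j" using Suc by simp
    also have "t j \<le> t (Suc j)" using assms(1) Suc.prems by (simp add: partition_pts_def)
    finally show ?thesis .
  qed simp
qed simp

lemma partition_pts_bounds: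
  assumes "partition_pts k t" "i \<le> Suc k"
  shows "0 \<le> t i" "t i \<le> 1"
  using partition_pts_mono[OF assms(1), of 0 i] partition_pts_mono[OF assms(1), of i "Suc k"] assms
  by (simp_all add: partition_pts_def)

text \<open>The index of the interval containing \<open>x\<close>. Leaving out points equal to 1
  gives \<open>x = 1\<close> the index of the last nonempty interval, hence left continuity at 1
  even if some interior points have moved to 1.\<close>

definition piece :: "nat \<Rightarrow> (nat \<Rightarrow> real) \<Rightarrow> real \<Rightarrow> nat" where
  "piece k t x = card {i \<in> {1..k}. t i \<le> x \<and> t i < 1}"

lemma piece_eqI:
  assumes "partition_pts k t" "i \<le> k" "t i \<le> x" "x < t (Suc i)"
  shows "piece k t x = i"
proof -
  have x1: "x < 1" using assms(4) partition_pts_bounds(2)[OF assms(1), of "Suc i"] assms(2) by simp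
  have "{j \<in> {1..k}. t j \<le> x \<and> t j < 1} = {1..i}"
  proof (intro set_eqI iffI)
    fix j assume j: "j \<in> {j \<in> {1..k}. t j \<le> x \<and> t j < 1}"
    have "\<not> Suc i \<le> j"
    proof
      assume "Suc i \<le> j"
      then have "t (Suc i) \<le> t j" using j by (intro partition_pts_mono[OF assms(1)]) auto
      then show False using j assms(4) by simp
    qed
    then show "j \<in> {1..i}" using j by simp
  next
    fix j assume j: "j \<in> {1..i}"
    then have "t j \<le> t i" using assms(2) by (intro partition_pts_mono[OF assms(1)]) auto
    then show "j \<in> {j \<in> {1..k}. t j \<le> x \<and> t j < 1}" using j assms(2,3) x1 by simp
  qed
  then show ?thesis by (simp add: piece_def)
qed

lemma ex_piece:
  assumes "partition_pts k t" "0 \<le> x" "x < 1"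
  shows "\<exists>i\<le>k. t i \<le> x \<and> x < t (Suc i)"
proof -
  have "\<exists>i\<le>m. t i \<le> x \<and> x < t (Suc i)" if "x < t (Suc m)" "m \<le> k" for m
    using that
  proof (induction m)
    case 0
    then show ?case using assms by (simp add: partition_pts_def)
  next
    case (Suc m)
    show ?case
    proof (cases "x < t (Suc m)")
      case True
      then show ?thesis using Suc by (metis Suc_leD le_SucI)
    next
      case False
      then show ?thesis using Suc.prems by (intro exI[of _ "Suc m"]) simp
    qed
  qed
  then show ?thesis using assms by (simp add: partition_pts_def)
qed

lemma piece_mem:
  assumes "partition_pts k t" "0 \<le> x" "x < 1"
  shows "piece k t x \<le> k" "t (piece k t x) \<le> x" "x < t (Suc (piece k t x))"
proof -
  obtain i where "i \<le> k" "t i \<le> x" "x < t (Suc i)" using ex_piece[OF assms] by blast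
  then show "piece k t x \<le> k" "t (piece k t x) \<le> x" "x < t (Suc (piece k t x))"
    using piece_eqI[OF assms(1)] by auto
qed

lemma piece_le: "piece k t x \<le> k"
proof -
  have "piece k t x \<le> card {1..k}" unfolding piece_def by (rule card_mono) auto
  then show ?thesis by simp
qed

definition step_comb :: "nat \<Rightarrow> (nat \<Rightarrow> real) \<Rightarrow> (nat \<Rightarrow> real) \<Rightarrow> L2" where
  "step_comb k c t = (\<Sum>i\<le>k. c i *\<^sub>R L2_indicator (t i) (t (Suc i)))"

lemma L2_represents_step_comb:
  assumes "partition_pts k t"
  shows "L2_represents (\<lambda>x. c (piece k t x)) (step_comb k c t)"
proof -
  have eq: "(\<Sum>i\<le>k. c i * indicator {t i..<t (Suc i)} x) = c (piece k t x)" if x: "x \<in> {0..<1}" for x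
  proof -
    have x': "0 \<le> x" "x < 1" using x by auto
    note m = piece_mem[OF assms x']
    have "(\<Sum>i\<le>k. c i * indicator {t i..<t (Suc i)} x) = (\<Sum>i\<le>k. if i = piece k t x then c i else 0)"
    proof (intro sum.cong refl)
      fix i assume i: "i \<in> {..k}"
      show "c i * indicator {t i..<t (Suc i)} x = (if i = piece k t x then c i else 0)"
      proof (cases "t i \<le> x \<and> x < t (Suc i)")
        case True
        then show ?thesis using piece_eqI[OF assms, of i x] i by simp
      next
        case False
        then have "i \<noteq> piece k t x" using m(2,3) by metis
        then show ?thesis using False by (simp add: indicator_def)
      qed
    qed
    also have "\<dots> = c (piece k t x)" using m(1) by simp
    finally show ?thesis .
  qed
  have "L2_represents (\<lambda>x. \<Sum>i\<le>k. c i * indicator {t i..<t (Suc i)} x) (step_comb k c t)"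
    unfolding step_comb_def
    by (intro L2_represents_sum L2_represents_scale L2_represents_indicator) simp
  then show ?thesis by (subst (asm) L2_represents_cong[OF eq])
qed

lemma piecewise_const_piece:
  "piecewise_const (t ` {1..k} \<inter> {0<..<1}) (\<lambda>x. c (piece k t x))"
  unfolding piecewise_const_def
proof (intro conjI allI impI)
  fix x y :: real assume *: "0 \<le> x" "x \<le> y" "y \<le> 1" "t ` {1..k} \<inter> {0<..<1} \<inter> {x<..y} = {}"
  have "t i \<le> x" if "i \<in> {1..k}" "t i \<le> y" "t i < 1" for i
  proof (rule ccontr)
    assume "\<not> t i \<le> x"
    then have "t i \<in> t ` {1..k} \<inter> {0<..<1} \<inter> {x<..y}" using that *(1) by auto
    then show False using *(4) by blast
  qed
  then have "{i \<in> {1..k}. t i \<le> x \<and> t i < 1} = {i \<in> {1..k}. t i \<le> y \<and> t i < 1}"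
    using *(2) by force
  then show "c (piece k t x) = c (piece k t y)" by (simp add: piece_def)
qed auto

lemma step_comb_step:
  assumes "partition_pts k t"
  shows "step_comb k c t \<in> step_functions"
  unfolding step_comb_def step_functions_def
proof (intro span_sum span_scale)
  fix i assume "i \<in> {..k}"
  then have i: "0 \<le> t i" "t i \<le> t (Suc i)" "t (Suc i) \<le> 1"
    using partition_pts_bounds[OF assms, of i] partition_pts_bounds[OF assms, of "Suc i"]
      partition_pts_mono[OF assms, of i "Suc i"] by auto
  show "L2_indicator (t i) (t (Suc i)) \<in> span {L2_indicator s t |s t. 0 \<le> s \<and> s < t \<and> t \<le> 1}"
  proof (cases "t i = t (Suc i)")
    case True
    then show ?thesis by (simp add: L2_indicator_empty span_zero)
  next
    case False
    then show ?thesis using i by (intro span_base) (auto simp: less_le)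
  qed
qed

lemma cadlag_fun_step_comb:
  assumes "partition_pts k t" "x \<in> {0..1}"
  shows "cadlag_fun (step_comb k c t) x = c (piece k t x)"
  by (rule cadlag_fun_eq[OF piecewise_const_piece L2_represents_step_comb[OF assms(1)] assms(2)])

lemma jump_set_step_comb:
  assumes "partition_pts k t"
  shows "jump_set (step_comb k c t) \<subseteq> t ` {1..k} \<inter> {0<..<1}"
  by (rule jump_set_subset[OF piecewise_const_cadlag_fun[OF piecewise_const_piece L2_represents_step_comb[OF assms]]])

lemma card_jump_set_step_comb:
  assumes "partition_pts k t"
  shows "card (jump_set (step_comb k c t)) \<le> k"
proof -
  have "card (jump_set (step_comb k c t)) \<le> card (t ` {1..k})"
    using jump_set_step_comb[OF assms] by (intro card_mono) auto
  also have "\<dots> \<le> k" using card_image_le[of "{1..k}" t] by simp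
  finally show ?thesis .
qed

text \<open>All indices beyond \<open>card B\<close> give 1. The result is thus a partition for
  every \<open>k \<ge> card B\<close>, padded by empty intervals at the right end.\<close>

definition pts_of :: "real set \<Rightarrow> nat \<Rightarrow> real" where
  "pts_of B i = (if i = 0 then 0 else if i \<le> card B then sorted_list_of_set B ! (i - 1) else 1)"

lemma pts_of_mem: "finite B \<Longrightarrow> 1 \<le> i \<Longrightarrow> i \<le> card B \<Longrightarrow> pts_of B i \<in> B"
  using nth_mem[of "i - 1" "sorted_list_of_set B"] by (simp add: pts_of_def)

lemma ex_pts_of:
  assumes "finite B" "b \<in> B"
  shows "\<exists>i. 1 \<le> i \<and> i \<le> card B \<and> pts_of B i = b"
proof -
  have "b \<in> set (sorted_list_of_set B)" using assms by simp
  then obtain j where "j < card B" "sorted_list_of_set B ! j = b" by (metis in_set_conv_nth length_sorted_list_of_set)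
  then show ?thesis by (intro exI[of _ "Suc j"]) (simp add: pts_of_def)
qed

lemma partition_pts_of:
  assumes "finite B" "B \<subseteq> {0<..<1}" "card B \<le> k"
  shows "partition_pts k (pts_of B)"
  unfolding partition_pts_def
proof (intro conjI allI impI)
  fix i assume "i \<le> k"
  have b: "0 \<le> pts_of B j \<and> pts_of B j \<le> 1" for j
    using pts_of_mem[OF assms(1), of j] assms(2) by (cases "1 \<le> j \<and> j \<le> card B") (force simp: pts_of_def)+
  show "pts_of B i \<le> pts_of B (Suc i)"
  proof (cases "i = 0 \<or> card B < Suc i")
    case True
    then show ?thesis using b[of i] b[of "Suc i"] by (auto simp: pts_of_def)
  next
    case False
    then show ?thesis
      by (auto simp: pts_of_def intro!: sorted_nth_mono)
  qed
qed (use assms in \<open>auto simp: pts_of_def\<close>)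

text \<open>No jump lies strictly after the left end of a piece and up to \<open>x\<close>, so the
  representative keeps its value at that left end; surplus indices name empty intervals.\<close>

lemma step_function_eq_comb:
  assumes "g \<in> step_functions" "card (jump_set g) \<le> k"
  shows "g = step_comb k (\<lambda>i. cadlag_fun g (pts_of (jump_set g) i)) (pts_of (jump_set g))"
proof -
  let ?t = "pts_of (jump_set g)"
  note pc = piecewise_const_jump_set[OF assms(1)]
  note fin = piecewise_const_finite[OF pc]
  have P: "partition_pts k ?t"
    using fin piecewise_const_subset[OF pc] assms(2) by (rule partition_pts_of)
  have eq: "cadlag_fun g x = cadlag_fun g (?t (piece k ?t x))" if "x \<in> {0..<1}" for x
  proof (rule piecewise_constD[OF pc, symmetric])
    have x: "0 \<le> x" "x < 1" using that by auto
    note m = piece_mem[OF P x]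
    show "0 \<le> ?t (piece k ?t x)" "?t (piece k ?t x) \<le> x" "x \<le> 1"
      using partition_pts_bounds[OF P, of "piece k ?t x"] m x by auto
    show "jump_set g \<inter> {?t (piece k ?t x)<..x} = {}"
    proof (rule ccontr)
      assume "jump_set g \<inter> {?t (piece k ?t x)<..x} \<noteq> {}"
      then obtain b where b: "b \<in> jump_set g" "?t (piece k ?t x) < b" "b \<le> x" by auto
      obtain j where j: "j \<le> card (jump_set g)" "?t j = b" using ex_pts_of[OF fin b(1)] by blast
      show False
      proof (cases "j \<le> piece k ?t x")
        case True
        then have "?t j \<le> ?t (piece k ?t x)" using m(1) by (intro partition_pts_mono[OF P]) auto
        then show False using b j by simp
      next
        case False
        then have "?t (Suc (piece k ?t x)) \<le> ?t j" using j(1) assms(2) by (intro partition_pts_mono[OF P]) auto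
        then show False using b j m by simp
      qed
    qed
  qed
  have "L2_represents (cadlag_fun g) g" by (rule cadlag_rep_represents[OF assms(1)])
  then have "L2_represents (\<lambda>x. cadlag_fun g (?t (piece k ?t x))) g"
    by (subst (asm) L2_represents_cong[OF eq])
  then show ?thesis using L2_represents_step_comb[OF P, of "\<lambda>i. cadlag_fun g (?t i)"] by (rule L2_represents_unique)
qed

definition step_proj :: "nat \<Rightarrow> L2 \<Rightarrow> (nat \<Rightarrow> real) \<Rightarrow> L2" where
  "step_proj k f t = step_comb k (\<lambda>i. L2_mean f (t i) (t (Suc i))) t"

lemma inner_partition_indicators:
  assumes "partition_pts k t" "i \<le> k" "j \<le> k"
  shows "inner (L2_indicator (t i) (t (Suc i))) (L2_indicator (t j) (t (Suc j))) = (if i = j then t (Suc i) - t i else 0)"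
proof -
  note b = partition_pts_bounds[OF assms(1)]
  have e: "inner (L2_indicator (t i) (t (Suc i))) (L2_indicator (t j) (t (Suc j))) =
      max 0 (min (t (Suc i)) (t (Suc j)) - max (t i) (t j))"
    using assms by (intro L2_inner_indicator b) auto
  consider "i = j" | "Suc i \<le> j" | "Suc j \<le> i" by linarith
  then show ?thesis
  proof cases
    case 1
    then show ?thesis using e partition_pts_mono[OF assms(1), of i "Suc i"] assms by simp
  next
    case 2
    then have "t (Suc i) \<le> t j" using assms by (intro partition_pts_mono[OF assms(1)]) auto
    then show ?thesis using 2 e by simp
  next
    case 3
    then have "t (Suc j) \<le> t i" using assms by (intro partition_pts_mono[OF assms(1)]) auto
    then show ?thesis using 3 e by simp
  qed
qed

lemma inner_step_proj:
  assumes "partition_pts k t"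
  shows "inner (step_proj k f t) (step_comb k c t) = inner f (step_comb k c t)"
proof -
  have j: "inner (step_proj k f t) (L2_indicator (t j) (t (Suc j))) = inner f (L2_indicator (t j) (t (Suc j)))"
    if "j \<le> k" for j
  proof -
    have "inner (step_proj k f t) (L2_indicator (t j) (t (Suc j))) =
      (\<Sum>i\<le>k. if i = j then L2_mean f (t i) (t (Suc i)) * (t (Suc i) - t i) else 0)"
      unfolding step_proj_def step_comb_def inner_sum_left
      using inner_partition_indicators[OF assms _ that] by (intro sum.cong) auto
    also have "\<dots> = L2_mean f (t j) (t (Suc j)) * (t (Suc j) - t j)" using that by simp
    also have "\<dots> = inner f (L2_indicator (t j) (t (Suc j)))"
      by (cases "t j = t (Suc j)") (simp_all add: L2_mean_def L2_indicator_empty)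
    finally show ?thesis .
  qed
  show ?thesis unfolding step_comb_def[of k c t] inner_sum_right
    using j by (intro sum.cong) auto
qed

lemma step_comb_diff: "step_comb k c t - step_comb k d t = step_comb k (\<lambda>i. c i - d i) t"
  unfolding step_comb_def by (simp add: sum_subtractf[symmetric] scaleR_diff_left)

lemma step_proj_add: "step_proj k (f + g) t = step_proj k f t + step_proj k g t"
  unfolding step_proj_def step_comb_def L2_mean_def
  by (simp add: sum.distrib[symmetric] inner_add_left add_divide_distrib scaleR_add_left)

text \<open>Pythagoras. On a fixed partition the best values are those of the projection, so that
  only the partition remains to be optimized.\<close>

lemma norm_diff_step_comb:
  assumes "partition_pts k t"
  shows "(norm (f - step_comb k c t))\<^sup>2 = (norm (f - step_proj k f t))\<^sup>2 + (norm (step_proj k f t - step_comb k c t))\<^sup>2"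
proof -
  obtain d where d: "step_proj k f t - step_comb k c t = step_comb k d t"
    unfolding step_proj_def step_comb_diff by blast
  have o: "inner (f - step_proj k f t) (step_comb k d t) = 0"
    using inner_step_proj[OF assms, of f d] by (simp add: inner_diff_left)
  have "f - step_comb k c t = (f - step_proj k f t) + step_comb k d t" using d by (simp add: algebra_simps)
  moreover have "(norm ((f - step_proj k f t) + step_comb k d t))\<^sup>2 = (norm (f - step_proj k f t))\<^sup>2 + (norm (step_comb k d t))\<^sup>2"
    by (rule norm_add_Pythagorean) (simp add: orthogonal_def o)
  ultimately show ?thesis unfolding d by (simp only:)
qed

lemma step_comb_eq_proj:
  assumes "partition_pts k t" "norm (f - step_comb k c t) \<le> norm (f - step_proj k f t)"
  shows "step_comb k c t = step_proj k f t"
proof -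
  have "(norm (f - step_comb k c t))\<^sup>2 \<le> (norm (f - step_proj k f t))\<^sup>2" using assms(2) by (intro power_mono) auto
  then have "(norm (step_proj k f t - step_comb k c t))\<^sup>2 \<le> 0" using norm_diff_step_comb[OF assms(1), of f c] by simp
  then show ?thesis by simp
qed

text \<open>An interval contributes the squared inner product divided by its length, hence at most
  \<open>C\<close> however short it is. This is why the noise condition is normalized by the length
  of the block.\<close>

lemma norm_step_proj_le:
  assumes "partition_pts k t" "0 \<le> C"
    and "\<And>i. i \<le> k \<Longrightarrow> (inner e (L2_indicator (t i) (t (Suc i))))\<^sup>2 \<le> C * (t (Suc i) - t i)"
  shows "(norm (step_proj k e t))\<^sup>2 \<le> real (Suc k) * C"
proof -
  have "(norm (step_proj k e t))\<^sup>2 = inner e (step_proj k e t)"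
    using inner_step_proj[OF assms(1)] by (simp add: power2_norm_eq_inner step_proj_def)
  also have "\<dots> = (\<Sum>i\<le>k. L2_mean e (t i) (t (Suc i)) * inner e (L2_indicator (t i) (t (Suc i))))"
    by (simp add: step_proj_def step_comb_def inner_sum_right)
  also have "\<dots> \<le> (\<Sum>i\<le>k. C)"
  proof (rule sum_mono)
    fix i assume "i \<in> {..k}"
    then have i: "i \<le> k" by simp
    have "t i \<le> t (Suc i)" using i assms(1) by (simp add: partition_pts_def)
    then have "(inner e (L2_indicator (t i) (t (Suc i))))\<^sup>2 / (t (Suc i) - t i) \<le> C"
      using assms(2) assms(3)[OF i] by (cases "t i = t (Suc i)") (simp_all add: pos_divide_le_eq)
    then show "L2_mean e (t i) (t (Suc i)) * inner e (L2_indicator (t i) (t (Suc i))) \<le> C"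
      by (simp add: L2_mean_def power2_eq_square)
  qed
  also have "\<dots> = real (Suc k) * C" by simp
  finally show ?thesis .
qed

text \<open>Combinations over the partition see only the projection of \<open>e\<close>, which can
  be small even if \<open>e\<close> is not.\<close>

lemma abs_inner_step_comb_le:
  assumes "partition_pts k t"
  shows "\<bar>inner e (step_comb k c t)\<bar> \<le> norm (step_proj k e t) * norm (step_comb k c t)"
  using Cauchy_Schwarz_ineq2[of "step_proj k e t" "step_comb k c t"] inner_step_proj[OF assms, of e c] by simp

section \<open>Compactness of partitions and continuity of the projection\<close>

lemma partition_pts_limit:
  assumes "\<And>n::nat. partition_pts k (T n)" "\<And>i. i \<le> Suc k \<Longrightarrow> (\<lambda>n. T n i) \<longlonglongrightarrow> t i"
  shows "partition_pts k t"
  unfolding partition_pts_def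
proof (intro conjI allI impI)
  show "t 0 = 0"
    using assms(2)[of 0] assms(1) by (intro LIMSEQ_unique[OF assms(2)[of 0]]) (simp_all add: partition_pts_def)
  show "t (Suc k) = 1"
    using assms(1) by (intro LIMSEQ_unique[OF assms(2)[of "Suc k"]]) (simp_all add: partition_pts_def)
  show "t i \<le> t (Suc i)" if "i \<le> k" for i
    using assms(1) that by (intro LIMSEQ_le[OF assms(2)[of i] assms(2)[of "Suc i"]]) (auto simp: partition_pts_def)
qed

lemma tendsto_step_proj:
  assumes "\<And>n::nat. partition_pts k (T n)" "\<And>i. i \<le> Suc k \<Longrightarrow> (\<lambda>n. T n i) \<longlonglongrightarrow> t i"
  shows "(\<lambda>n. step_proj k f (T n)) \<longlonglongrightarrow> step_proj k f t"
  unfolding step_proj_def step_comb_def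
proof (intro tendsto_sum)
  fix i assume "i \<in> {..k}"
  then show "(\<lambda>n. L2_mean f (T n i) (T n (Suc i)) *\<^sub>R L2_indicator (T n i) (T n (Suc i)))
      \<longlonglongrightarrow> L2_mean f (t i) (t (Suc i)) *\<^sub>R L2_indicator (t i) (t (Suc i))"
    using partition_pts_bounds[OF assms(1)] partition_pts_mono[OF assms(1), of i "Suc i"]
    by (intro tendsto_L2_mean_indicator assms(2)) auto
qed

text \<open>Bolzano-Weierstrass one coordinate at a time, each time refining the previous
  subsequence.\<close>

lemma bounded_family_subseq:
  fixes T :: "nat \<Rightarrow> nat \<Rightarrow> real"
  assumes "\<And>n i. i < m \<Longrightarrow> T n i \<in> {0..1}"
  shows "\<exists>r t. strict_mono (r :: nat \<Rightarrow> nat) \<and> (\<forall>i<m. (\<lambda>n. T (r n) i) \<longlonglongrightarrow> t i)"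
  using assms
proof (induction m)
  case 0
  show ?case by (intro exI[of _ id]) (simp add: strict_mono_def)
next
  case (Suc m)
  then obtain r t where r: "strict_mono r" "\<And>i. i < m \<Longrightarrow> (\<lambda>n. T (r n) i) \<longlonglongrightarrow> t i" by (meson less_SucI)
  have "\<forall>n. T (r n) m \<in> {0..1}" using Suc.prems by blast
  then obtain l s where s: "strict_mono s" "((\<lambda>n. T (r n) m) \<circ> s) \<longlonglongrightarrow> l"
    using seq_compactE[OF compact_imp_seq_compact[OF compact_Icc[of "0::real" 1]]] by metis
  have "(\<lambda>n. T ((r \<circ> s) n) i) \<longlonglongrightarrow> (t(m := l)) i" if "i < Suc m" for i
  proof (cases "i = m")
    case True
    then show ?thesis using s(2) by (simp add: comp_def)
  next
    case False
    then have "(\<lambda>n. T (r n) i) \<longlonglongrightarrow> t i" using r(2) that by simp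
    from LIMSEQ_subseq_LIMSEQ[OF this s(1)] show ?thesis using False by (simp add: comp_def)
  qed
  then show ?case using strict_mono_o[OF r(1) s(1)] by blast
qed

lemma partition_pts_compact:
  assumes "\<And>n. partition_pts k (T n)"
  obtains r t where "strict_mono (r :: nat \<Rightarrow> nat)" "partition_pts k t"
    "\<And>i. i \<le> Suc k \<Longrightarrow> (\<lambda>n. T (r n) i) \<longlonglongrightarrow> t i"
proof -
  have "T n i \<in> {0..1}" if "i < Suc (Suc k)" for n i
    using partition_pts_bounds[OF assms, of i n] that by simp
  from bounded_family_subseq[of "Suc (Suc k)" T, OF this] obtain r t where
    r: "strict_mono (r :: nat \<Rightarrow> nat)" "\<And>i. i < Suc (Suc k) \<Longrightarrow> (\<lambda>n. T (r n) i) \<longlonglongrightarrow> t i" by blast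
  then have lim: "\<And>i. i \<le> Suc k \<Longrightarrow> (\<lambda>n. T (r n) i) \<longlonglongrightarrow> t i" by simp
  have "partition_pts k t" by (rule partition_pts_limit[OF assms lim])
  from that[OF r(1) this lim] show thesis .
qed

section \<open>Time changes\<close>

text \<open>Stated on the whole line, so that one construction can be restricted both to
  \<open>{0..1}\<close> and to \<open>{0..}\<close>.\<close>

definition small_time_change :: "real \<Rightarrow> real set \<Rightarrow> (real \<Rightarrow> real) \<Rightarrow> (real \<Rightarrow> real) \<Rightarrow> bool" where
  "small_time_change e P q l \<longleftrightarrow> strict_mono l \<and> continuous_on UNIV l \<and> (\<forall>p\<in>P. l p = q p) \<and> (\<forall>t. \<bar>l t - t\<bar> \<le> e) \<and>
      (\<forall>s t. s \<noteq> t \<longrightarrow> \<bar>ln ((l t - l s) / (t - s))\<bar> \<le> e)"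

text \<open>
  Adding tent functions of height \<open>q p - p\<close> around the points of \<open>P\<close> to the identity moves each \<open>p\<close>
  to \<open>q p\<close>; the slopes are controlled by the tents' Lipschitz constants.
\<close>

lemma ex_small_time_change:
  fixes P :: "real set"
  assumes "finite P" "0 < e"
  shows "\<exists>d>0. \<forall>q. (\<forall>p\<in>P. \<bar>q p - p\<bar> < d) \<longrightarrow> (\<exists>l. small_time_change e P q l)"
proof -
  have "uniform_discrete P" using assms(1) by (metis uniform_discrete_finite_iff finite_imp_bounded)
  then obtain r where r: "0 < r" "\<And>p q. p \<in> P \<Longrightarrow> q \<in> P \<Longrightarrow> p \<noteq> q \<Longrightarrow> r \<le> \<bar>p - q\<bar>"
    unfolding uniform_discrete_def dist_real_def by (metis not_less)
  define m where "m = real (card P) + 1"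
  \<comment> \<open>Slopes within \<open>eta\<close> of 1 lie between \<open>exp (- e)\<close> and
    \<open>2 - exp (- e)\<close>, and the latter is at most \<open>exp e\<close> because
    \<open>cosh e \<ge> 1\<close>.\<close>
  define eta where "eta = 1 - exp (- e)"
  have eta: "0 < eta" "eta < 1" using assms(2) by (auto simp: eta_def)
  have m: "0 < m" by (simp add: m_def)
  \<comment> \<open>Fewer than \<open>m\<close> tents of height at most \<open>d\<close> and slope
    at most \<open>d / r\<close> are added. The first bound keeps the slope of their sum at most
    \<open>eta\<close>, the second keeps the displacement at most \<open>e\<close>.\<close>
  define d where "d = min (eta * r / m) (e / m)"
  have d: "0 < d" "d * m \<le> eta * r" "d * m \<le> e"
    using eta r(1) m assms(2) by (auto simp: d_def min_def field_simps)
  show ?thesis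
  proof (intro exI[of _ d] conjI allI impI d(1))
    fix q assume "\<forall>p\<in>P. \<bar>q p - p\<bar> < d"
    then have q: "\<And>p. p \<in> P \<Longrightarrow> \<bar>q p - p\<bar> < d" by blast
    \<comment> \<open>A tent of radius \<open>r\<close>: distinct points of \<open>P\<close> are at
      least \<open>r\<close> apart, so it vanishes at every point of \<open>P\<close> but its
      own.\<close>
    define v where "v p t = max 0 (1 - \<bar>t - p\<bar> / r)" for p t
    define l where "l t = t + (\<Sum>p\<in>P. (q p - p) * v p t)" for t
    have v1: "\<bar>v p t\<bar> \<le> 1" for p t using r(1) by (auto simp: v_def)
    have v2: "\<bar>v p t - v p s\<bar> \<le> \<bar>t - s\<bar> / r" for p s t
    proof -
      have "\<bar>v p t - v p s\<bar> \<le> \<bar>\<bar>t - p\<bar> / r - \<bar>s - p\<bar> / r\<bar>" unfolding v_def by linarith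
      also have "\<dots> = \<bar>\<bar>t - p\<bar> - \<bar>s - p\<bar>\<bar> / r" using r(1) by (simp add: diff_divide_distrib[symmetric])
      also have "\<dots> \<le> \<bar>t - s\<bar> / r" using r(1) by (intro divide_right_mono) linarith+
      finally show ?thesis .
    qed
    have sumle: "(\<Sum>p\<in>P. \<bar>q p - p\<bar> * w p) \<le> d * m * b" if "\<And>p. p \<in> P \<Longrightarrow> w p \<le> b" "\<And>p. 0 \<le> w p" "0 \<le> b" for w b
    proof -
      have "(\<Sum>p\<in>P. \<bar>q p - p\<bar> * w p) \<le> (\<Sum>p\<in>P. d * b)"
        by (rule sum_mono, rule mult_mono) (use less_imp_le[OF q] that d(1) in auto)
      also have "\<dots> = real (card P) * (d * b)" by simp
      also have "\<dots> \<le> m * (d * b)" using d(1) that(3) by (intro mult_right_mono) (auto simp: m_def)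
      finally show ?thesis by (simp add: algebra_simps)
    qed
    have close: "\<bar>l t - t\<bar> \<le> e" for t
    proof -
      have "\<bar>l t - t\<bar> \<le> (\<Sum>p\<in>P. \<bar>q p - p\<bar> * \<bar>v p t\<bar>)"
        unfolding l_def using sum_abs[of "\<lambda>p. (q p - p) * v p t" P] by (simp add: abs_mult)
      also have "\<dots> \<le> d * m * 1" using v1 by (intro sumle) auto
      finally show ?thesis using d(3) by simp
    qed
    have lip: "\<bar>(l t - l s) - (t - s)\<bar> \<le> eta * \<bar>t - s\<bar>" for s t
    proof -
      have "(l t - l s) - (t - s) = (\<Sum>p\<in>P. (q p - p) * (v p t - v p s))"
        by (simp add: l_def right_diff_distrib sum_subtractf)
      also have "\<bar>\<dots>\<bar> \<le> (\<Sum>p\<in>P. \<bar>q p - p\<bar> * \<bar>v p t - v p s\<bar>)"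
        using sum_abs[of "\<lambda>p. (q p - p) * (v p t - v p s)" P] by (simp add: abs_mult)
      also have "\<dots> \<le> d * m * (\<bar>t - s\<bar> / r)" using v2 r(1) by (intro sumle) auto
      also have "\<dots> \<le> eta * r * (\<bar>t - s\<bar> / r)" using d(2) r(1) by (intro mult_right_mono) auto
      also have "\<dots> = eta * \<bar>t - s\<bar>" using r(1) by simp
      finally show ?thesis .
    qed
    have mono: "strict_mono l"
    proof (rule strict_monoI)
      fix s t :: real assume "s < t"
      then have "eta * \<bar>t - s\<bar> < t - s" using eta by simp
      then show "l s < l t" using lip[of t s] by linarith
    qed
    have slope: "\<bar>ln ((l t - l s) / (t - s))\<bar> \<le> e" if "s \<noteq> t" for s t
    proof -
      define x where "x = (l t - l s) / (t - s)"
      have "x - 1 = ((l t - l s) - (t - s)) / (t - s)"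
        using that by (simp add: x_def diff_divide_distrib)
      then have "\<bar>x - 1\<bar> = \<bar>(l t - l s) - (t - s)\<bar> / \<bar>t - s\<bar>" by (simp only: abs_divide)
      also have "\<dots> \<le> eta" using lip[of t s] that by (simp add: pos_divide_le_eq)
      finally have x: "\<bar>x - 1\<bar> \<le> eta" .
      then have lo: "exp (- e) \<le> x" unfolding eta_def by linarith
      have "2 \<le> exp e + exp (- e)"
        using cosh_real_ge_1[of e] by (simp add: cosh_def)
      then have hi: "x \<le> exp e" using x unfolding eta_def by linarith
      have "0 < x" using lo by (rule less_le_trans[rotated]) simp
      have "- e \<le> ln x" using lo \<open>0 < x\<close> by (simp add: ln_ge_iff)
      moreover have "ln x \<le> ln (exp e)" using hi \<open>0 < x\<close> by (subst ln_le_cancel_iff) auto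
      ultimately have "\<bar>ln x\<bar> \<le> e" by simp
      then show ?thesis unfolding x_def by simp
    qed
    have "continuous_on UNIV l"
      unfolding l_def v_def using r(1) by (intro continuous_intros) auto
    moreover have "l p = q p" if p: "p \<in> P" for p
    proof -
      have "(\<Sum>p'\<in>P. (q p' - p') * v p' p) = (\<Sum>p'\<in>P. if p' = p then q p - p else 0)"
      proof (intro sum.cong refl)
        fix p' assume p': "p' \<in> P"
        show "(q p' - p') * v p' p = (if p' = p then q p - p else 0)"
        proof (cases "p' = p")
          case False
          then have "1 \<le> \<bar>p - p'\<bar> / r" using r(1) r(2)[OF p p'] by simp
          then have "v p' p = 0" by (simp add: v_def)
          then show ?thesis using False by simp
        qed (simp add: v_def)
      qed
      also have "\<dots> = q p - p" using assms(1) p by simp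
      finally show ?thesis by (simp add: l_def)
    qed
    ultimately show "\<exists>l. small_time_change e P q l"
      unfolding small_time_change_def using mono slope close by blast
  qed
qed

lemma time_changesI:
  fixes l :: "real \<Rightarrow> real"
  assumes l: "strict_mono l" "continuous_on UNIV l" and I: "is_interval I" "l ` I \<subseteq> I"
    and bound: "\<And>y. y \<in> I \<Longrightarrow> \<exists>a\<in>I. \<exists>b\<in>I. l a \<le> y \<and> y \<le> l b"
  shows "l \<in> time_changes I"
proof -
  have "y \<in> l ` I" if y: "y \<in> I" for y
  proof -
    obtain a b where ab: "a \<in> I" "b \<in> I" "l a \<le> y" "y \<le> l b" using bound[OF y] by blast
    have "a \<le> b" using order_trans[OF ab(3,4)] strict_mono_less_eq[OF l(1)] by simp
    then have "\<exists>x. a \<le> x \<and> x \<le> b \<and> l x = y"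
      using ab(3,4) by (intro IVT' continuous_on_subset[OF l(2)]) auto
    then show ?thesis using I(1) ab(1,2) unfolding is_interval_1 by blast
  qed
  then show ?thesis
    using l(1) I(2) continuous_on_subset[OF l(2) subset_UNIV]
    by (auto simp: time_changes_def strict_mono_on_def strict_mono_def)
qed

text \<open>A time change carrying each \<open>t i\<close> to \<open>T n i\<close> matches the
  pieces exactly and leaves only the differences of their values. The strict inequalities keep the
  points \<open>t i\<close> distinct, so that each can be given its own image.\<close>

lemma tendsto_cadlag_rep_step_comb:
  assumes T: "\<And>n::nat. partition_pts k (T n)" "\<And>i. i \<le> Suc k \<Longrightarrow> (\<lambda>n. T n i) \<longlonglongrightarrow> t i"
    and C: "\<And>i. i \<le> k \<Longrightarrow> (\<lambda>n. C n i) \<longlonglongrightarrow> c i"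
    and t: "\<And>i. i \<le> k \<Longrightarrow> t i < t (Suc i)"
  shows "(\<lambda>n. cadlag_rep (step_comb k (C n) (T n))) \<longlonglongrightarrow> cadlag_rep (step_comb k c t)"
proof (rule tendstoI)
  fix e :: real assume e: "0 < e"
  have P: "partition_pts k t" by (rule partition_pts_limit[OF T])
  have less: "t i < t j" if "i < j" "j \<le> Suc k" for i j
  proof -
    have "t i < t (Suc i)" using that by (intro t) auto
    also have "\<dots> \<le> t j" using that by (intro partition_pts_mono[OF P]) auto
    finally show ?thesis .
  qed
  have inj: "inj_on t {..Suc k}"
    by (rule linorder_inj_onI) (use less in force)+
  have "finite (t ` {..Suc k})" "0 < e / 2" using e by auto
  then obtain d where d: "0 < d"
    "\<forall>q. (\<forall>p\<in>t ` {..Suc k}. \<bar>q p - p\<bar> < d) \<longrightarrow> (\<exists>l. small_time_change (e / 2) (t ` {..Suc k}) q l)"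
    using ex_small_time_change by blast
  have "\<forall>\<^sub>F n in sequentially. \<forall>i\<in>{..Suc k}. dist (T n i) (t i) < d"
    by (intro eventually_ball_finite ballI tendstoD[OF T(2)] d(1)) auto
  moreover have "\<forall>\<^sub>F n in sequentially. \<forall>i\<in>{..k}. dist (C n i) (c i) < e / 2"
    using e by (intro eventually_ball_finite ballI tendstoD[OF C]) auto
  ultimately show "\<forall>\<^sub>F n in sequentially. dist (cadlag_rep (step_comb k (C n) (T n))) (cadlag_rep (step_comb k c t)) < e"
  proof eventually_elim
    case (elim n)
    let ?q = "\<lambda>p. T n (inv_into {..Suc k} t p)"
    have q: "?q (t i) = T n i" if "i \<le> Suc k" for i using inj that by simp
    have "\<bar>?q (t i) - t i\<bar> < d" if "i \<le> Suc k" for i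
      using bspec[OF elim(1), of i] that q[OF that] by (simp add: dist_real_def)
    then have "\<forall>p\<in>t ` {..Suc k}. \<bar>?q p - p\<bar> < d" by blast
    then have "\<exists>l. small_time_change (e / 2) (t ` {..Suc k}) ?q l" using d(2) by simp
    then obtain l where "small_time_change (e / 2) (t ` {..Suc k}) ?q l" ..
    then have l: "strict_mono l" "continuous_on UNIV l" "\<And>p. p \<in> t ` {..Suc k} \<Longrightarrow> l p = ?q p"
      "\<And>s t. s \<noteq> t \<Longrightarrow> \<bar>ln ((l t - l s) / (t - s))\<bar> \<le> e / 2"
      unfolding small_time_change_def by blast+
    have lt: "l (t i) = T n i" if "i \<le> Suc k" for i using l(3)[of "t i"] q[OF that] that by simp
    have l01: "l 0 = 0" "l 1 = 1"
      using lt[of 0] lt[of "Suc k"] P T(1)[of n] by (simp_all add: partition_pts_def)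
    have tc: "l \<in> time_changes {0..1}" 
    proof (rule time_changesI[OF l(1,2)])
      show "l ` {0..1} \<subseteq> {0..1}"
        using strict_mono_less_eq[OF l(1), of 0] strict_mono_less_eq[OF l(1), of _ 1] l01 by (simp add: image_subset_iff)
      show "\<exists>a\<in>{0..1}. \<exists>b\<in>{0..1}. l a \<le> y \<and> y \<le> l b" if "y \<in> {0..1}" for y
        by (rule bexI[of _ 0], rule bexI[of _ 1]) (use that l01 in auto)
    qed (simp add: is_interval_cc)
    have piece: "piece k (T n) (l x) = piece k t x" if x: "x \<in> {0..1}" for x
    \<comment> \<open>The point 1 lies in none of the half open intervals; there the two counts in
      \<open>piece\<close> are compared directly.\<close>
    proof (cases "x = 1")
      case True
      have "t i < 1" if "i \<in> {1..k}" for i using less[of i "Suc k"] P that by (simp add: partition_pts_def)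
      moreover have "T n i < 1" if "i \<in> {1..k}" for i
        using lt[of i] l01(2) strict_monoD[OF l(1) calculation[OF that]] that by simp
      ultimately have "{i \<in> {1..k}. T n i \<le> 1 \<and> T n i < 1} = {i \<in> {1..k}. t i \<le> 1 \<and> t i < 1}"
        by (auto simp: less_imp_le)
      then show ?thesis using True l01 by (simp add: piece_def)
    next
      case False
      then have x': "0 \<le> x" "x < 1" using x by auto
      note m = piece_mem[OF P x']
      show ?thesis
      proof (rule piece_eqI[OF T(1) m(1)])
        show "T n (piece k t x) \<le> l x"
          using lt[of "piece k t x"] m(1) monoD[OF strict_mono_mono[OF l(1)] m(2)] by simp
        show "l x < T n (Suc (piece k t x))"
          using lt[of "Suc (piece k t x)"] m(1) strict_monoD[OF l(1) m(3)] by simp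
      qed
    qed
    let ?x = "cadlag_rep (step_comb k (C n) (T n))" and ?y = "cadlag_rep (step_comb k c t)"
    have "(SUP t\<in>{0..1}. ennreal \<bar>D01_fun ?x (l t) - D01_fun ?y t\<bar>) \<le> ennreal (e / 2)"
    proof (rule SUP_least)
      fix x :: real assume x: "x \<in> {0..1}"
      have "D01_fun ?x (l x) - D01_fun ?y x = C n (piece k t x) - c (piece k t x)"
        using cadlag_fun_step_comb[OF T(1) time_changes_mem[OF tc x]] cadlag_fun_step_comb[OF P x] piece[OF x] by simp
      also have "\<bar>\<dots>\<bar> \<le> e / 2" using elim(2) piece_le[of k t x] by (auto simp: dist_real_def intro: less_imp_le)
      finally show "ennreal \<bar>D01_fun ?x (l x) - D01_fun ?y x\<bar> \<le> ennreal (e / 2)" by (rule ennreal_leI)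
    qed
    moreover have "log_distortion {0..1} l \<le> ennreal (e / 2)"
      by (rule log_distortion_least) (intro ennreal_leI l(4))
    ultimately have "(INF l\<in>time_changes {0..1}. max (log_distortion {0..1} l)
        (SUP t\<in>{0..1}. ennreal \<bar>D01_fun ?x (l t) - D01_fun ?y t\<bar>)) \<le> ennreal (e / 2)"
      by (intro INF_lower2[OF tc]) simp
    then have "dist ?x ?y \<le> e / 2" unfolding dist_D01_def using e by (intro enn2real_leI) auto
    then show ?case using e by simp
  qed
qed

section \<open>Compactness of minimizers\<close>

abbreviation njumps :: "L2 \<Rightarrow> nat" where
  "njumps g \<equiv> card (jump_set g)"

abbreviation sq_err :: "L2 \<Rightarrow> L2 \<Rightarrow> real" where
  "sq_err \<phi> g \<equiv> (norm (\<phi> - g))\<^sup>2"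

definition grid :: "nat \<Rightarrow> real set" where
  "grid m = {real i / real m | i. i \<le> m}"

text \<open>For \<open>1 \<le> m\<close> this is the range of \<open>step_embed m\<close>, described
  without vectors so that the empirical and the limit problem take the same form.\<close>

definition grid_steps :: "nat \<Rightarrow> L2 set" where
  "grid_steps m = {g \<in> step_functions. jump_set g \<subseteq> grid m}"

text \<open>
  The minimizers of the functional with penalty \<open>\<gamma> = 1 / \<zeta>\<close>, multiplied by \<open>\<zeta>\<close>. The second clause
  follows from the first one unless \<open>\<zeta> = 0\<close>, where it selects the best constant.
\<close>

definition opt_set :: "L2 set \<Rightarrow> L2 \<Rightarrow> real \<Rightarrow> L2 set" where
  "opt_set X \<phi> z = {g \<in> X. \<forall>h\<in>X.
     real (njumps g) + z * sq_err \<phi> g \<le> real (njumps h) + z * sq_err \<phi> h \<and>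
     (njumps h \<le> njumps g \<longrightarrow> sq_err \<phi> g \<le> sq_err \<phi> h)}"

text \<open>Condition (A) for the embedded noise at level \<open>c = \<beta> m / m\<close>: its
  inner product with the indicator of a grid interval is a partial sum divided by
  \<open>m\<close>.\<close>

definition noise_le :: "nat \<Rightarrow> L2 \<Rightarrow> real \<Rightarrow> bool" where
  "noise_le m e c \<longleftrightarrow> 0 \<le> c \<and>
     (\<forall>a\<in>grid m. \<forall>b\<in>grid m. a \<le> b \<longrightarrow> (inner e (L2_indicator a b))\<^sup>2 \<le> c * (b - a))"

lemma partition_jump_set: "g \<in> step_functions \<Longrightarrow> partition_pts (njumps g) (pts_of (jump_set g))"
  using piecewise_const_jump_set[of g]
  by (intro partition_pts_of) (auto simp: piecewise_const_def)

lemma pts_of_jump_set_grid: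
  assumes "u \<in> grid_steps m" "1 \<le> m" "i \<le> Suc (njumps u)"
  shows "pts_of (jump_set u) i \<in> grid m"
proof -
  have u: "u \<in> step_functions" "jump_set u \<subseteq> grid m" using assms(1) by (auto simp: grid_steps_def)
  have "0 \<in> grid m" "1 \<in> grid m"
    using assms(2) unfolding grid_def by (auto intro: exI[of _ 0] exI[of _ m])
  then show ?thesis
    using pts_of_mem[OF finite_jump_set[OF u(1)], of i] u(2)
    by (cases "1 \<le> i \<and> i \<le> njumps u") (auto simp: pts_of_def)
qed

lemma step_comb_grid_steps:
  assumes "partition_pts k t" "\<And>i. i \<in> {1..k} \<Longrightarrow> t i \<in> grid m"
  shows "step_comb k c t \<in> grid_steps m"
  using step_comb_step[OF assms(1), of c] jump_set_step_comb[OF assms(1), of c] assms(2)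
  unfolding grid_steps_def by blast

text \<open>Projecting \<open>\<phi>\<close> onto the partition of \<open>u\<close> adds no jumps
  and keeps to the grid, so by the second clause of \<open>opt_set\<close> the projection is no
  closer to \<open>\<phi>\<close> than \<open>u\<close>. The nearest combination over a partition is
  unique.\<close>

lemma opt_set_eq_proj:
  assumes "u \<in> opt_set (grid_steps m) \<phi> z" "1 \<le> m"
  shows "u = step_proj (njumps u) \<phi> (pts_of (jump_set u))"
proof -
  let ?t = "pts_of (jump_set u)" and ?k = "njumps u"
  have ug: "u \<in> grid_steps m" and us: "u \<in> step_functions"
    using assms by (auto simp: opt_set_def grid_steps_def)
  note P = partition_jump_set[OF us]
  have "step_proj ?k \<phi> ?t \<in> grid_steps m"
    unfolding step_proj_def
    by (rule step_comb_grid_steps[OF P]) (use pts_of_jump_set_grid[OF ug assms(2)] in simp)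
  moreover have "njumps (step_proj ?k \<phi> ?t) \<le> njumps u"
    unfolding step_proj_def by (rule card_jump_set_step_comb[OF P])
  ultimately have "sq_err \<phi> u \<le> sq_err \<phi> (step_proj ?k \<phi> ?t)"
    using assms(1) unfolding opt_set_def by blast
  then have le: "norm (\<phi> - u) \<le> norm (\<phi> - step_proj ?k \<phi> ?t)" by (rule power2_le_imp_le) simp
  obtain c where c: "u = step_comb ?k c ?t" using step_function_eq_comb[OF us order_refl] by blast
  show ?thesis using step_comb_eq_proj[OF P, of \<phi> c] le c by simp
qed

lemma norm_step_proj_noise:
  assumes "noise_le m e c" "partition_pts k t" "\<And>i. i \<le> Suc k \<Longrightarrow> t i \<in> grid m"
  shows "norm (step_proj k e t) \<le> sqrt (real (Suc k) * c)"
proof (rule real_le_rsqrt, rule norm_step_proj_le[OF assms(2)])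
  show "0 \<le> c" using assms(1) by (simp add: noise_le_def)
  fix i assume "i \<le> k"
  then have "t i \<in> grid m" "t (Suc i) \<in> grid m" "t i \<le> t (Suc i)"
    using assms(2,3) by (auto simp: partition_pts_def)
  then show "(inner e (L2_indicator (t i) (t (Suc i))))\<^sup>2 \<le> c * (t (Suc i) - t i)"
    using assms(1) by (simp add: noise_le_def)
qed

lemma tendsto_step_proj_noise:
  assumes "\<And>n::nat. noise_le (m n) (e n) (c n)" "c \<longlonglongrightarrow> 0" "\<And>n. partition_pts k (T n)"
    "\<And>n i. i \<le> Suc k \<Longrightarrow> T n i \<in> grid (m n)"
  shows "(\<lambda>n. step_proj k (e n) (T n)) \<longlonglongrightarrow> 0"
proof (rule Lim_null_comparison)
  show "\<forall>\<^sub>F n in sequentially. norm (step_proj k (e n) (T n)) \<le> sqrt (real (Suc k) * c n)"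
    using norm_step_proj_noise[OF assms(1,3,4)] by (intro always_eventually allI) blast
  have "(\<lambda>n. sqrt (real (Suc k) * c n)) \<longlonglongrightarrow> sqrt (real (Suc k) * 0)"
    by (intro tendsto_intros assms(2))
  then show "(\<lambda>n. sqrt (real (Suc k) * c n)) \<longlonglongrightarrow> 0" by simp
qed

lemma tendsto_inner_noise:
  assumes "(\<lambda>n. step_proj k (e n) (T n)) \<longlonglongrightarrow> 0" "\<And>n::nat. partition_pts k (T n)"
    "(\<lambda>n. step_comb k (C n) (T n)) \<longlonglongrightarrow> h"
  shows "(\<lambda>n. inner (e n) (step_comb k (C n) (T n))) \<longlonglongrightarrow> 0"
proof (rule Lim_null_comparison)
  show "\<forall>\<^sub>F n in sequentially. norm (inner (e n) (step_comb k (C n) (T n)))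
      \<le> norm (step_proj k (e n) (T n)) * norm (step_comb k (C n) (T n))"
    using abs_inner_step_comb_le[OF assms(2)] by simp
  have "(\<lambda>n. norm (step_proj k (e n) (T n)) * norm (step_comb k (C n) (T n))) \<longlonglongrightarrow> norm (0 :: L2) * norm h"
    by (intro tendsto_intros assms(1,3))
  then show "(\<lambda>n. norm (step_proj k (e n) (T n)) * norm (step_comb k (C n) (T n))) \<longlonglongrightarrow> 0" by simp
qed

text \<open>The last bracket, which contains the possibly large norm of the noise, does not depend
  on \<open>a\<close> and cancels when two candidates are compared.\<close>

lemma norm_diff_noise:
  fixes f e a :: L2
  shows "sq_err (f + e) a = sq_err f a - 2 * inner e a + ((norm e)\<^sup>2 + 2 * inner e f)"
  unfolding power2_norm_eq_inner
  by (simp add: inner_diff_left inner_diff_right inner_add_left inner_add_right inner_commute[of f e]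
      inner_commute[of a e] inner_commute[of a f])

text \<open>Rounding up to the grid is monotone and, for \<open>m \<ge> 1\<close>, fixes 0 and 1; it
  therefore maps partitions to partitions with grid points.\<close>

definition grid_ceil :: "nat \<Rightarrow> real \<Rightarrow> real" where
  "grid_ceil m x = of_int \<lceil>real m * x\<rceil> / real m"

lemma grid_ceil_mem:
  assumes "1 \<le> m" "0 \<le> x" "x \<le> 1"
  shows "grid_ceil m x \<in> grid m"
proof -
  have "real m * x \<le> real m" using assms by (simp add: mult_left_le)
  then have "\<lceil>real m * x\<rceil> \<le> int m" by (simp add: ceiling_le_iff)
  then have "nat \<lceil>real m * x\<rceil> \<le> m" by (simp only: nat_le_iff)
  moreover have "0 \<le> \<lceil>real m * x\<rceil>"
  proof -
    have "0 \<le> real m * x" using assms by simp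
    then show ?thesis by linarith
  qed
  ultimately have "grid_ceil m x = real (nat \<lceil>real m * x\<rceil>) / real m \<and> nat \<lceil>real m * x\<rceil> \<le> m"
    by (simp only: grid_ceil_def of_nat_nat simp_thms)
  then show ?thesis unfolding grid_def by blast
qed

lemma tendsto_grid_ceil:
  assumes "filterlim m at_top sequentially" "\<And>n. 1 \<le> m n"
  shows "(\<lambda>n. grid_ceil (m n) x) \<longlonglongrightarrow> x"
proof (rule LIM_zero_cancel, rule Lim_null_comparison)
  show "(\<lambda>n. 1 / real (m n)) \<longlonglongrightarrow> 0" by (rule filterlim_compose[OF lim_1_over_n assms(1)])
  have "norm (grid_ceil (m n) x - x) \<le> 1 / real (m n)" for n
  proof -
    have m: "0 < real (m n)" using assms(2)[of n] by simp
    have "grid_ceil (m n) x - x = (of_int \<lceil>real (m n) * x\<rceil> - real (m n) * x) / real (m n)"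
      using m by (simp add: grid_ceil_def diff_divide_distrib)
    moreover have "\<bar>of_int \<lceil>real (m n) * x\<rceil> - real (m n) * x\<bar> \<le> 1" by linarith
    ultimately show ?thesis using m by (simp add: divide_right_mono)
  qed
  then show "\<forall>\<^sub>F n in sequentially. norm (grid_ceil (m n) x - x) \<le> 1 / real (m n)" by simp
qed

lemma partition_grid_ceil:
  assumes "partition_pts k t" "1 \<le> m"
  shows "partition_pts k (\<lambda>i. grid_ceil m (t i))"
  using assms unfolding partition_pts_def grid_ceil_def
  by (auto intro!: divide_right_mono ceiling_mono mult_left_mono simp: of_int_le_iff)

lemma tendsto_step_comb:
  assumes "\<And>n::nat. partition_pts k (T n)" "\<And>i. i \<le> Suc k \<Longrightarrow> (\<lambda>n. T n i) \<longlonglongrightarrow> t i"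
  shows "(\<lambda>n. step_comb k c (T n)) \<longlonglongrightarrow> step_comb k c t"
  unfolding step_comb_def
proof (intro tendsto_sum tendsto_scaleR tendsto_const)
  fix i assume "i \<in> {..k}"
  then show "(\<lambda>n. L2_indicator (T n i) (T n (Suc i))) \<longlonglongrightarrow> L2_indicator (t i) (t (Suc i))"
    using partition_pts_bounds[OF assms(1)] partition_pts_mono[OF assms(1), of i "Suc i"]
    by (intro tendsto_L2_indicator assms(2)) auto
qed

text \<open>A step function with jumps off the grid is no candidate in the empirical problem.
  Rounding its jump points to the grid and keeping its values gives candidates that converge to it;
  points that merge can only remove jumps.\<close>

lemma grid_competitor:
  assumes h: "h \<in> step_functions" and m: "filterlim m at_top sequentially" "\<And>n. 1 \<le> m n"
    and e: "\<And>n. noise_le (m n) (e n) (c n)" "c \<longlonglongrightarrow> 0"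
  obtains h' where "\<And>n. h' n \<in> grid_steps (m n)" "\<And>n. njumps (h' n) \<le> njumps h" "h' \<longlonglongrightarrow> h"
    "(\<lambda>n. inner (e n) (h' n)) \<longlonglongrightarrow> 0"
proof -
  let ?k = "njumps h" and ?s = "pts_of (jump_set h)"
  note P = partition_jump_set[OF h]
  obtain d where d: "h = step_comb ?k d ?s" using step_function_eq_comb[OF h order_refl] by blast
  define T where "T n i = grid_ceil (m n) (?s i)" for n i
  have PT: "partition_pts ?k (T n)" for n unfolding T_def by (rule partition_grid_ceil[OF P m(2)])
  have TG: "T n i \<in> grid (m n)" if "i \<le> Suc ?k" for n i
    unfolding T_def using partition_pts_bounds[OF P that] by (intro grid_ceil_mem m(2))
  have lim: "(\<lambda>n. step_comb ?k d (T n)) \<longlonglongrightarrow> step_comb ?k d ?s"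
  proof (rule tendsto_step_comb[OF PT])
    show "(\<lambda>n. T n i) \<longlonglongrightarrow> ?s i" for i unfolding T_def by (rule tendsto_grid_ceil[OF m])
  qed
  show thesis
  proof (rule that[of "\<lambda>n. step_comb ?k d (T n)"])
    show "step_comb ?k d (T n) \<in> grid_steps (m n)" for n
      by (rule step_comb_grid_steps[OF PT]) (use TG in simp)
    show "njumps (step_comb ?k d (T n)) \<le> ?k" for n by (rule card_jump_set_step_comb[OF PT])
    show "(\<lambda>n. step_comb ?k d (T n)) \<longlonglongrightarrow> h" using lim d by simp
    show "(\<lambda>n. inner (e n) (step_comb ?k d (T n))) \<longlonglongrightarrow> 0"
      by (rule tendsto_inner_noise[OF tendsto_step_proj_noise[OF e PT TG] PT lim])
  qed
qed

text \<open>Only \<open>t 1\<close> to \<open>t k\<close> can be jumps, so \<open>k\<close> jumps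
  force these points to be distinct and interior.\<close>

lemma jump_set_strict_partition:
  assumes P: "partition_pts k t" and k: "k \<le> njumps (step_comb k c t)" and i: "i \<le> k"
  shows "t i < t (Suc i)"
proof -
  let ?J = "t ` {1..k} \<inter> {0<..<1}"
  have "k \<le> card ?J"
    using k card_mono[OF _ jump_set_step_comb[OF P, of c]] by simp
  moreover have "card ?J \<le> card (t ` {1..k})" by (rule card_mono) auto
  moreover have "card (t ` {1..k}) \<le> k" using card_image_le[of "{1..k}" t] by simp
  ultimately have eq: "card ?J = card (t ` {1..k})" "card (t ` {1..k}) = card {1..k}" by simp_all
  have "?J = t ` {1..k}" by (rule card_subset_eq) (use eq in auto)
  then have J: "t j \<in> {0<..<1}" if "j \<in> {1..k}" for j using that by blast
  have inj: "inj_on t {1..k}" by (rule eq_card_imp_inj_on[OF _ eq(2)]) simp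
  have le: "t i \<le> t (Suc i)" using P i by (simp add: partition_pts_def)
  have 0: "t 0 = 0" "t (Suc k) = 1" using P by (simp_all add: partition_pts_def)
  have "t i \<noteq> t (Suc i)"
  proof (cases "i = 0")
    case True
    then show ?thesis using 0 J[of 1] by (cases "k = 0") auto
  next
    case False
    show ?thesis
    proof (cases "i = k")
      case True
      then show ?thesis using 0 J[of k] False by auto
    next
      case False': False
      then show ?thesis using inj_onD[OF inj, of i "Suc i"] i False by auto
    qed
  qed
  then show ?thesis using le by simp
qed

lemma opt_subsequence:
  assumes m: "filterlim m at_top sequentially" "\<And>n::nat. 1 \<le> m n"
    and e: "\<And>n. noise_le (m n) (e n) (c n)" "c \<longlonglongrightarrow> 0"
    and u: "\<And>n. u n \<in> opt_set (grid_steps (m n)) (f + e n) (z n)" "\<And>n. njumps (u n) = k"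
    and z: "z \<longlonglongrightarrow> \<zeta>"
  obtains r g where "strict_mono (r :: nat \<Rightarrow> nat)" "g \<in> step_functions" "(u \<circ> r) \<longlonglongrightarrow> g" "njumps g \<le> k"
    "\<And>h. h \<in> step_functions \<Longrightarrow> real k + \<zeta> * sq_err f g \<le> real (njumps h) + \<zeta> * sq_err f h"
    "\<And>h. h \<in> step_functions \<Longrightarrow> njumps h \<le> k \<Longrightarrow> sq_err f g \<le> sq_err f h"
    "njumps g = k \<Longrightarrow> (\<lambda>n. cadlag_rep (u (r n))) \<longlonglongrightarrow> cadlag_rep g"
proof -
  define T where "T n = pts_of (jump_set (u n))" for n
  have ug: "u n \<in> grid_steps (m n)" for n using u(1)[of n] by (simp add: opt_set_def)
  then have us: "u n \<in> step_functions" for n by (simp add: grid_steps_def)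
  have PT: "partition_pts k (T n)" for n using partition_jump_set[OF us[of n]] u(2) by (simp add: T_def)
  have TG: "T n i \<in> grid (m n)" if "i \<le> Suc k" for n i
    unfolding T_def using pts_of_jump_set_grid[OF ug m(2)] u(2) that by simp
  have proj: "u n = step_proj k (f + e n) (T n)" for n
    using opt_set_eq_proj[OF u(1) m(2), of n] u(2) by (simp add: T_def)
  obtain r t where r: "strict_mono (r :: nat \<Rightarrow> nat)" and Pt: "partition_pts k t"
    and Tt: "\<And>i. i \<le> Suc k \<Longrightarrow> (\<lambda>n. T (r n) i) \<longlonglongrightarrow> t i"
    using partition_pts_compact[of k T, OF PT] by metis
  have mr: "filterlim (\<lambda>n. m (r n)) at_top sequentially"
    using filterlim_compose[OF m(1) filterlim_subseq[OF r]] .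
  have cr: "(\<lambda>n. c (r n)) \<longlonglongrightarrow> 0" using LIMSEQ_subseq_LIMSEQ[OF e(2) r] by (simp add: comp_def)
  have zr: "(\<lambda>n. z (r n)) \<longlonglongrightarrow> \<zeta>" using LIMSEQ_subseq_LIMSEQ[OF z r] by (simp add: comp_def)
  define g where "g = step_proj k f t"
  have gs: "g \<in> step_functions" unfolding g_def step_proj_def by (rule step_comb_step[OF Pt])
  have noise: "(\<lambda>n. step_proj k (e (r n)) (T (r n))) \<longlonglongrightarrow> 0"
    by (rule tendsto_step_proj_noise[OF e(1) cr PT TG])
  have "(\<lambda>n. step_proj k f (T (r n)) + step_proj k (e (r n)) (T (r n))) \<longlonglongrightarrow> g + 0"
    unfolding g_def by (intro tendsto_add noise tendsto_step_proj[OF PT Tt])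
  then have ulim: "(\<lambda>n. u (r n)) \<longlonglongrightarrow> g" unfolding proj step_proj_add by simp
  have eu: "(\<lambda>n. inner (e (r n)) (u (r n))) \<longlonglongrightarrow> 0"
  proof -
    have "(\<lambda>n. step_comb k (\<lambda>i. L2_mean (f + e (r n)) (T (r n) i) (T (r n) (Suc i))) (T (r n))) \<longlonglongrightarrow> g"
      using ulim unfolding proj step_proj_def .
    from tendsto_inner_noise[OF noise PT this] show ?thesis unfolding proj step_proj_def .
  qed
  have jg: "njumps g \<le> k" unfolding g_def step_proj_def by (rule card_jump_set_step_comb[OF Pt])
  have cmp: "real k + \<zeta> * sq_err f g \<le> real (njumps h) + \<zeta> * sq_err f h \<and>
      (njumps h \<le> k \<longrightarrow> sq_err f g \<le> sq_err f h)" if h: "h \<in> step_functions" for h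
  proof -
    obtain h' where h': "\<And>n. h' n \<in> grid_steps (m (r n))" "\<And>n. njumps (h' n) \<le> njumps h" "h' \<longlonglongrightarrow> h"
      "(\<lambda>n. inner (e (r n)) (h' n)) \<longlonglongrightarrow> 0"
      using grid_competitor[OF h mr m(2) e(1) cr] by metis
    \<comment> \<open>These are the errors with respect to \<open>f + e (r n)\<close> up to a
      summand common to all candidates; without that summand they converge.\<close>
    let ?A = "\<lambda>n. sq_err f (u (r n)) - 2 * inner (e (r n)) (u (r n))"
    let ?B = "\<lambda>n. sq_err f (h' n) - 2 * inner (e (r n)) (h' n)"
    have A: "?A \<longlonglongrightarrow> sq_err f g - 2 * 0"
      by (intro tendsto_intros ulim eu)
    have B: "?B \<longlonglongrightarrow> sq_err f h - 2 * 0"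
      by (intro tendsto_intros h'(3,4))
    have opt: "real k + z (r n) * sq_err (f + e (r n)) (u (r n)) \<le> real (njumps (h' n)) + z (r n) * sq_err (f + e (r n)) (h' n) \<and>
        (njumps (h' n) \<le> k \<longrightarrow> sq_err (f + e (r n)) (u (r n)) \<le> sq_err (f + e (r n)) (h' n))" for n
      using u(1)[of "r n"] h'(1)[of n] u(2)[of "r n"] unfolding opt_set_def by blast
    have "real k + \<zeta> * (sq_err f g - 2 * 0) \<le> real (njumps h) + \<zeta> * (sq_err f h - 2 * 0)"
    proof (rule LIMSEQ_le)
      show "(\<lambda>n. real k + z (r n) * ?A n)
          \<longlonglongrightarrow> real k + \<zeta> * (sq_err f g - 2 * 0)"
        by (intro tendsto_add tendsto_mult tendsto_const zr A)
      show "(\<lambda>n. real (njumps h) + z (r n) * ?B n)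
          \<longlonglongrightarrow> real (njumps h) + \<zeta> * (sq_err f h - 2 * 0)"
        by (intro tendsto_add tendsto_mult tendsto_const zr B)
      have "real k + z (r n) * ?A n \<le> real (njumps h) + z (r n) * ?B n" for n
      proof -
        have "real k + z (r n) * ?A n
            \<le> real (njumps (h' n)) + z (r n) * ?B n"
          using opt[of n, THEN conjunct1]
            norm_diff_noise[of f "e (r n)" "u (r n)"] norm_diff_noise[of f "e (r n)" "h' n"]
          by (simp add: distrib_left)
        then show ?thesis using h'(2)[of n] by linarith
      qed
      then show "\<exists>N. \<forall>n\<ge>N. real k + z (r n) * ?A n
          \<le> real (njumps h) + z (r n) * ?B n" by blast
    qed
    moreover have "sq_err f g - 2 * 0 \<le> sq_err f h - 2 * 0" if hk: "njumps h \<le> k"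
    proof (rule LIMSEQ_le[OF A B])
      have "?A n \<le> ?B n" for n
        using opt[of n, THEN conjunct2] order_trans[OF h'(2)[of n] hk]
          norm_diff_noise[of f "e (r n)" "u (r n)"] norm_diff_noise[of f "e (r n)" "h' n"] by simp
      then show "\<exists>N. \<forall>n\<ge>N. ?A n
          \<le> ?B n" by blast
    qed
    ultimately show ?thesis by simp
  qed
  have cad: "(\<lambda>n. cadlag_rep (u (r n))) \<longlonglongrightarrow> cadlag_rep g" if gk: "njumps g = k"
  proof -
    have strict: "t i < t (Suc i)" if "i \<le> k" for i
      by (rule jump_set_strict_partition[OF Pt eq_refl[OF gk[unfolded g_def step_proj_def, symmetric]] that])
    show ?thesis
      unfolding proj g_def step_proj_def
    proof (rule tendsto_cadlag_rep_step_comb[OF PT Tt _ strict])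
      fix i assume i: "i \<le> k"
      let ?a = "\<lambda>n. T (r n) i" and ?b = "\<lambda>n. T (r n) (Suc i)"
      have ab: "?a \<longlonglongrightarrow> t i" "?b \<longlonglongrightarrow> t (Suc i)" using i by (auto intro: Tt)
      have bnd: "0 \<le> ?a n" "?a n \<le> ?b n" "?b n \<le> 1" for n
        using partition_pts_bounds[OF PT[of "r n"], of i] partition_pts_bounds[OF PT[of "r n"], of "Suc i"]
          partition_pts_mono[OF PT[of "r n"], of i "Suc i"] i by auto
      have ne: "t (Suc i) - t i \<noteq> 0" using strict[OF i] by simp
      have f: "(\<lambda>n. L2_mean f (?a n) (?b n)) \<longlonglongrightarrow> L2_mean f (t i) (t (Suc i))"
        unfolding L2_mean_def using ne by (intro tendsto_intros tendsto_L2_indicator ab bnd)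
      have e0: "(\<lambda>n. inner (e (r n)) (L2_indicator (?a n) (?b n))) \<longlonglongrightarrow> 0"
      proof (rule Lim_null_comparison)
        have "\<bar>inner (e (r n)) (L2_indicator (?a n) (?b n))\<bar> \<le> sqrt (c (r n) * (?b n - ?a n))" for n
        proof (rule real_le_rsqrt)
          have "(inner (e (r n)) (L2_indicator (?a n) (?b n)))\<^sup>2 \<le> c (r n) * (?b n - ?a n)"
            using e(1)[of "r n"] TG[of i "r n"] TG[of "Suc i" "r n"] i bnd(2)[of n] by (simp add: noise_le_def)
          then show "\<bar>inner (e (r n)) (L2_indicator (?a n) (?b n))\<bar>\<^sup>2 \<le> c (r n) * (?b n - ?a n)" by simp
        qed
        then show "\<forall>\<^sub>F n in sequentially. norm (inner (e (r n)) (L2_indicator (?a n) (?b n))) \<le> sqrt (c (r n) * (?b n - ?a n))"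
          by simp
        have "(\<lambda>n. sqrt (c (r n) * (?b n - ?a n))) \<longlonglongrightarrow> sqrt (0 * (t (Suc i) - t i))"
          by (intro tendsto_intros cr ab)
        then show "(\<lambda>n. sqrt (c (r n) * (?b n - ?a n))) \<longlonglongrightarrow> 0" by simp
      qed
      have "(\<lambda>n. L2_mean f (?a n) (?b n) + inner (e (r n)) (L2_indicator (?a n) (?b n)) / (?b n - ?a n))
          \<longlonglongrightarrow> L2_mean f (t i) (t (Suc i)) + 0 / (t (Suc i) - t i)"
        using ne by (intro tendsto_add tendsto_divide tendsto_diff f e0 ab)
      then show "(\<lambda>n. L2_mean (f + e (r n)) (?a n) (?b n)) \<longlonglongrightarrow> L2_mean f (t i) (t (Suc i))"
        by (simp add: L2_mean_def inner_add_left add_divide_distrib)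
    qed
  qed
  show thesis
    by (rule that[OF r gs _ jg]) (use ulim cmp cad in \<open>auto simp: comp_def\<close>)
qed

text \<open>The distance from \<open>f\<close> to its projection depends continuously on the
  partition, and partitions are compact. A minimizing sequence of partitions thus has a limit that
  attains the infimum.\<close>

lemma ex_best_step_function:
  obtains g where "g \<in> step_functions" "njumps g \<le> k"
    "\<And>h. h \<in> step_functions \<Longrightarrow> njumps h \<le> k \<Longrightarrow> sq_err f g \<le> sq_err f h"
proof -
  let ?F = "\<lambda>t. norm (f - step_proj k f t)"
  define E where "E = Inf (?F ` Collect (partition_pts k))"
  have ne: "?F ` Collect (partition_pts k) \<noteq> {}"
  proof -
    have "partition_pts k (pts_of {})" by (rule partition_pts_of) auto
    then show ?thesis by blast
  qed
  have bdd: "bdd_below (?F ` Collect (partition_pts k))" by (rule bdd_belowI[of _ 0]) auto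
  have lower: "E \<le> ?F t" if "partition_pts k t" for t
    unfolding E_def using that bdd by (intro cInf_lower) auto
  have "\<exists>t. partition_pts k t \<and> ?F t < E + 1 / real (Suc n)" for n
  proof -
    have "Inf (?F ` Collect (partition_pts k)) < E + 1 / real (Suc n)" by (simp add: E_def)
    then show ?thesis using cInf_less_iff[OF ne bdd] by auto
  qed
  then obtain T where T: "\<And>n. partition_pts k (T n)" "\<And>n. ?F (T n) < E + 1 / real (Suc n)" by metis
  obtain r t where r: "strict_mono (r :: nat \<Rightarrow> nat)" and Pt: "partition_pts k t"
    and Tt: "\<And>i. i \<le> Suc k \<Longrightarrow> (\<lambda>n. T (r n) i) \<longlonglongrightarrow> t i"
    using partition_pts_compact[of k T, OF T(1)] by metis
  have "(\<lambda>n. ?F (T (r n))) \<longlonglongrightarrow> ?F t"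
    by (intro tendsto_intros tendsto_step_proj[OF T(1) Tt])
  moreover have "(\<lambda>n. E + 1 / real (Suc (r n))) \<longlonglongrightarrow> E + 0"
    by (intro tendsto_add tendsto_const filterlim_compose[OF LIMSEQ_Suc[OF lim_1_over_n] filterlim_subseq[OF r]])
  ultimately have "?F t \<le> E + 0"
    by (rule LIMSEQ_le) (use less_imp_le[OF T(2)] in blast)
  then have F: "?F t \<le> E" by simp
  show thesis
  proof (rule that[of "step_proj k f t"])
    show "step_proj k f t \<in> step_functions" "njumps (step_proj k f t) \<le> k"
      unfolding step_proj_def by (rule step_comb_step[OF Pt], rule card_jump_set_step_comb[OF Pt])
    fix h assume h: "h \<in> step_functions" "njumps h \<le> k"
    have P: "partition_pts k (pts_of (jump_set h))"
      using piecewise_const_jump_set[OF h(1)] h(2) by (intro partition_pts_of) (auto simp: piecewise_const_def)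
    obtain c where c: "h = step_comb k c (pts_of (jump_set h))" using step_function_eq_comb[OF h] by blast
    have "(?F t)\<^sup>2 \<le> (?F (pts_of (jump_set h)))\<^sup>2" using F lower[OF P] by (intro power_mono) auto
    also have "\<dots> \<le> sq_err f (step_comb k c (pts_of (jump_set h)))"
      using norm_diff_step_comb[OF P, of f c] by simp
    finally show "(?F t)\<^sup>2 \<le> sq_err f h" using c by simp
  qed
qed

section \<open>The optimal numbers of jumps\<close>

text \<open>Jumps can disappear in a limit, so a best function with exactly \<open>k\<close> jumps
  may fail to exist; allowing fewer guarantees one.\<close>

definition best_fits :: "L2 \<Rightarrow> nat \<Rightarrow> L2 set" where
  "best_fits f k = {g \<in> step_functions. njumps g \<le> k \<and>
     (\<forall>h\<in>step_functions. njumps h \<le> k \<longrightarrow> sq_err f g \<le> sq_err f h)}"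

definition fit_error :: "L2 \<Rightarrow> nat \<Rightarrow> real" where
  "fit_error f k = sq_err f ((SOME g. g \<in> best_fits f k))"

text \<open>The indices of those lines \<open>real j + z * fit_error f j\<close>, as functions of
  \<open>z\<close>, that touch their lower envelope at \<open>z\<close>.\<close>

definition opt_counts :: "L2 \<Rightarrow> real \<Rightarrow> nat set" where
  "opt_counts f z = {k. \<forall>j. real k + z * fit_error f k \<le> real j + z * fit_error f j}"

lemma best_fits_nonempty: "best_fits f k \<noteq> {}"
proof -
  obtain g where "g \<in> step_functions" "njumps g \<le> k"
    "\<And>h. h \<in> step_functions \<Longrightarrow> njumps h \<le> k \<Longrightarrow> sq_err f g \<le> sq_err f h"
    using ex_best_step_function[of k f] by metis
  then have "g \<in> best_fits f k" unfolding best_fits_def by blast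
  then show ?thesis by blast
qed

lemma best_fits_error: "g \<in> best_fits f k \<Longrightarrow> sq_err f g = fit_error f k"
proof -
  assume g: "g \<in> best_fits f k"
  then have "(SOME g. g \<in> best_fits f k) \<in> best_fits f k" by (rule someI)
  then show ?thesis using g unfolding fit_error_def best_fits_def by (intro antisym) auto
qed

lemma fit_error_le: "h \<in> step_functions \<Longrightarrow> njumps h \<le> k \<Longrightarrow> fit_error f k \<le> sq_err f h"
proof -
  assume h: "h \<in> step_functions" "njumps h \<le> k"
  obtain g where g: "g \<in> best_fits f k" using best_fits_nonempty by blast
  then have "sq_err f g \<le> sq_err f h" using h unfolding best_fits_def by blast
  then show ?thesis by (simp only: best_fits_error[OF g])
qed

lemma fit_error_nonneg: "0 \<le> fit_error f k"
  by (simp add: fit_error_def)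

text \<open>If a best fit for \<open>k\<close> had fewer than \<open>k\<close> jumps, its own count
  would achieve at most the same error at a smaller cost.\<close>

lemma opt_counts_jumps:
  assumes "k \<in> opt_counts f z" "g \<in> best_fits f k" "0 \<le> z"
  shows "njumps g = k"
proof (rule antisym)
  show "njumps g \<le> k" using assms(2) by (simp add: best_fits_def)
  have "fit_error f (njumps g) \<le> fit_error f k"
    using fit_error_le[of g "njumps g" f] best_fits_error[OF assms(2)] assms(2) by (simp add: best_fits_def)
  then have "z * fit_error f (njumps g) \<le> z * fit_error f k" using assms(3) by (rule mult_left_mono)
  moreover have "real k + z * fit_error f k \<le> real (njumps g) + z * fit_error f (njumps g)"
    using assms(1) by (simp add: opt_counts_def)
  ultimately show "k \<le> njumps g" by linarith
qed

text \<open>Minimization in two stages: over the functions with a given bound on the jumps, and over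
  that bound.\<close>

lemma opt_set_iff:
  assumes "0 \<le> z"
  shows "g \<in> opt_set step_functions f z \<longleftrightarrow> njumps g \<in> opt_counts f z \<and> g \<in> best_fits f (njumps g)"
proof
  assume g: "g \<in> opt_set step_functions f z"
  then have b: "g \<in> best_fits f (njumps g)" by (simp add: opt_set_def best_fits_def)
  have "real (njumps g) + z * fit_error f (njumps g) \<le> real j + z * fit_error f j" for j
  proof -
    obtain h where h: "h \<in> best_fits f j" using best_fits_nonempty by blast
    then have "real (njumps g) + z * sq_err f g \<le> real (njumps h) + z * sq_err f h"
      using g by (simp add: opt_set_def best_fits_def)
    moreover have "njumps h \<le> j" using h by (simp add: best_fits_def)
    ultimately show ?thesis using best_fits_error[OF h] best_fits_error[OF b] by simp
  qed
  then show "njumps g \<in> opt_counts f z \<and> g \<in> best_fits f (njumps g)" using b by (simp add: opt_counts_def)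
next
  assume g: "njumps g \<in> opt_counts f z \<and> g \<in> best_fits f (njumps g)"
  have "real (njumps g) + z * sq_err f g \<le> real (njumps h) + z * sq_err f h" if h: "h \<in> step_functions" for h
  proof -
    have "real (njumps g) + z * fit_error f (njumps g) \<le> real (njumps h) + z * fit_error f (njumps h)"
      using g by (simp add: opt_counts_def)
    moreover have "z * fit_error f (njumps h) \<le> z * sq_err f h"
      using fit_error_le[OF h order_refl] assms by (rule mult_left_mono)
    ultimately show ?thesis using best_fits_error[of g f "njumps g"] g by simp
  qed
  then show "g \<in> opt_set step_functions f z" using g by (simp add: opt_set_def best_fits_def)
qed

lemma best_fits_subset_opt_set:
  assumes "k \<in> opt_counts f z" "0 \<le> z"
  shows "best_fits f k \<subseteq> opt_set step_functions f z"
  using opt_counts_jumps[OF assms(1) _ assms(2)] opt_set_iff[OF assms(2)] assms(1) by auto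

lemma opt_counts_bound:
  assumes "k \<in> opt_counts f z" "0 \<le> z"
  shows "real k \<le> z * fit_error f 0"
proof -
  have "real k + z * fit_error f k \<le> real 0 + z * fit_error f 0" using assms(1) unfolding opt_counts_def by blast
  moreover have "0 \<le> z * fit_error f k" using assms(2) fit_error_nonneg by simp
  ultimately show ?thesis by simp
qed

lemma finite_opt_counts: "0 \<le> z \<Longrightarrow> finite (opt_counts f z)"
proof -
  assume z: "0 \<le> z"
  have "k \<le> nat \<lceil>z * fit_error f 0\<rceil>" if "k \<in> opt_counts f z" for k
    using opt_counts_bound[OF that z] by linarith
  then have "opt_counts f z \<subseteq> {..nat \<lceil>z * fit_error f 0\<rceil>}" by auto
  then show ?thesis by (rule finite_subset) simp
qed

lemma opt_counts_nonempty:
  assumes "0 \<le> z"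
  shows "opt_counts f z \<noteq> {}"
proof -
  let ?v = "\<lambda>k. real k + z * fit_error f k"
  define K where "K = nat \<lceil>z * fit_error f 0\<rceil>"
  obtain k where k: "k \<in> {..K}" "\<And>j. j \<in> {..K} \<Longrightarrow> ?v k \<le> ?v j"
    using ex_min_if_finite[of "?v ` {..K}"] by (auto simp: not_less)
  have "?v k \<le> ?v j" for j
  proof (cases "j \<le> K")
    case False
    have "?v k \<le> ?v 0" by (rule k(2)) simp
    also have "\<dots> \<le> real j" using False unfolding K_def by simp linarith
    also have "\<dots> \<le> ?v j" using assms fit_error_nonneg by simp
    finally show ?thesis .
  qed (use k in simp)
  then show ?thesis by (auto simp: opt_counts_def)
qed

lemma opt_counts_0: "opt_counts f 0 = {0}"
  by (auto simp: opt_counts_def)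

text \<open>If \<open>k > k'\<close>, optimality of \<open>k\<close> at \<open>z\<close> says that
  its smaller error pays for the additional jumps. At \<open>z'\<close> the gain is larger still, so
  \<open>k'\<close> would not be optimal there.\<close>

lemma opt_counts_mono:
  assumes "k \<in> opt_counts f z" "k' \<in> opt_counts f z'" "0 \<le> z" "z < z'"
  shows "k \<le> k'"
proof (rule ccontr)
  assume "\<not> k \<le> k'"
  then have kk: "0 < real k - real k'" by simp
  let ?D = "fit_error f k' - fit_error f k"
  have a: "real k + z * fit_error f k \<le> real k' + z * fit_error f k'"
    using assms(1) by (simp add: opt_counts_def)
  have b: "real k' + z' * fit_error f k' \<le> real k + z' * fit_error f k"
    using assms(2) by (simp add: opt_counts_def)
  have "0 < z * ?D" using a kk by (simp add: right_diff_distrib)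
  then have "0 < ?D" using assms(3) by (simp add: zero_less_mult_iff)
  then have "z * ?D < z' * ?D" using assms(4) by (rule mult_strict_right_mono[rotated])
  then show False using a b by (simp add: right_diff_distrib)
qed

text \<open>Only counts up to \<open>K\<close> can be optimal for parameters at most
  \<open>z + 1\<close>. Those not optimal at \<open>z\<close> lose strictly against
  \<open>k\<close>, and by continuity they still do nearby.\<close>

lemma opt_counts_nhds:
  assumes "0 \<le> z"
  obtains d where "0 < d" "\<And>z'. 0 \<le> z' \<Longrightarrow> \<bar>z' - z\<bar> < d \<Longrightarrow> opt_counts f z' \<subseteq> opt_counts f z"
proof -
  obtain k where k: "k \<in> opt_counts f z" using opt_counts_nonempty[OF assms] by blast
  define K where "K = nat \<lceil>(z + 1) * fit_error f 0\<rceil>"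
  let ?J = "{..K} - opt_counts f z"
  have "\<forall>\<^sub>F z' in nhds z. \<forall>j\<in>?J. real k + z' * fit_error f k < real j + z' * fit_error f j"
  proof (intro eventually_ball_finite ballI)
    fix j assume j: "j \<in> ?J"
    have "\<not> real j + z * fit_error f j \<le> real k + z * fit_error f k"
    proof
      assume "real j + z * fit_error f j \<le> real k + z * fit_error f k"
      then have "j \<in> opt_counts f z" using k unfolding opt_counts_def by (blast intro: order_trans)
      then show False using j by blast
    qed
    then have "0 < (real j + z * fit_error f j) - (real k + z * fit_error f k)" by simp
    moreover have "((\<lambda>z'. (real j + z' * fit_error f j) - (real k + z' * fit_error f k)) \<longlongrightarrow>
        (real j + z * fit_error f j) - (real k + z * fit_error f k)) (nhds z)"
      by (intro tendsto_intros filterlim_ident)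
    ultimately have "\<forall>\<^sub>F z' in nhds z. 0 < (real j + z' * fit_error f j) - (real k + z' * fit_error f k)"
      by (rule order_tendstoD(1)[rotated])
    then show "\<forall>\<^sub>F z' in nhds z. real k + z' * fit_error f k < real j + z' * fit_error f j"
      by eventually_elim simp
  qed simp
  then obtain d where d: "0 < d"
    "\<And>z' j. dist z' z < d \<Longrightarrow> j \<in> ?J \<Longrightarrow> real k + z' * fit_error f k < real j + z' * fit_error f j"
    unfolding eventually_nhds_metric by blast
  show thesis
  proof (rule that[of "min d 1"])
    fix z' assume z': "0 \<le> z'" "\<bar>z' - z\<bar> < min d 1"
    show "opt_counts f z' \<subseteq> opt_counts f z"
    proof
      fix j assume j: "j \<in> opt_counts f z'"
      have "real j \<le> z' * fit_error f 0" by (rule opt_counts_bound[OF j z'(1)])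
      also have "\<dots> \<le> (z + 1) * fit_error f 0" using z' fit_error_nonneg by (intro mult_right_mono) auto
      finally have "j \<le> K" unfolding K_def by linarith
      show "j \<in> opt_counts f z"
      proof (rule ccontr)
        assume "j \<notin> opt_counts f z"
        then have "real k + z' * fit_error f k < real j + z' * fit_error f j"
          using d(2)[of z' j] z' \<open>j \<le> K\<close> by (simp add: dist_real_def)
        moreover have "real j + z' * fit_error f j \<le> real k + z' * fit_error f k"
          using j by (simp add: opt_counts_def)
        ultimately show False by simp
      qed
    qed
  qed (use d(1) in simp)
qed

definition lo_count :: "L2 \<Rightarrow> real \<Rightarrow> nat" where "lo_count f z = Min (opt_counts f z)"
definition hi_count :: "L2 \<Rightarrow> real \<Rightarrow> nat" where "hi_count f z = Max (opt_counts f z)"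
definition best_fit :: "L2 \<Rightarrow> nat \<Rightarrow> L2" where "best_fit f k = (THE g. g \<in> best_fits f k)"

lemma lo_count_mem: "0 \<le> z \<Longrightarrow> lo_count f z \<in> opt_counts f z"
  and hi_count_mem: "0 \<le> z \<Longrightarrow> hi_count f z \<in> opt_counts f z"
  by (simp_all add: lo_count_def hi_count_def finite_opt_counts opt_counts_nonempty)

text \<open>Nearby optimal counts are optimal at \<open>z\<close> as well; monotonicity leaves the
  largest of these to the right and the smallest to the left.\<close>

lemma opt_counts_near:
  assumes "0 \<le> z"
  obtains d where "0 < d" "\<And>z'. z < z' \<Longrightarrow> z' < z + d \<Longrightarrow> opt_counts f z' = {hi_count f z}"
    "\<And>z'. 0 \<le> z' \<Longrightarrow> z - d < z' \<Longrightarrow> z' < z \<Longrightarrow> opt_counts f z' = {lo_count f z}"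
proof -
  obtain d where d: "0 < d" "\<And>z'. 0 \<le> z' \<Longrightarrow> \<bar>z' - z\<bar> < d \<Longrightarrow> opt_counts f z' \<subseteq> opt_counts f z"
    using opt_counts_nhds[OF assms] by metis
  show thesis
  proof (rule that[OF d(1)])
    fix z' assume z': "z < z'" "z' < z + d"
    have "k = hi_count f z" if "k \<in> opt_counts f z'" for k
    proof (rule antisym)
      have "k \<in> opt_counts f z" using d(2)[of z'] z' assms that by auto
      then show "k \<le> hi_count f z" by (simp add: hi_count_def finite_opt_counts[OF assms])
      show "hi_count f z \<le> k" by (rule opt_counts_mono[OF hi_count_mem[OF assms] that assms z'(1)])
    qed
    then show "opt_counts f z' = {hi_count f z}" using opt_counts_nonempty[of z' f] z' assms by fastforce
  next
    fix z' assume z': "0 \<le> z'" "z - d < z'" "z' < z"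
    have "k = lo_count f z" if "k \<in> opt_counts f z'" for k
    proof (rule antisym)
      have "k \<in> opt_counts f z" using d(2)[of z'] z' that by auto
      then show "lo_count f z \<le> k" by (simp add: lo_count_def finite_opt_counts[OF assms])
      show "k \<le> lo_count f z" by (rule opt_counts_mono[OF that lo_count_mem[OF assms] z'(1,3)])
    qed
    then show "opt_counts f z' = {lo_count f z}" using opt_counts_nonempty[of z' f] z' by fastforce
  qed
qed

lemma lo_count_0: "lo_count f 0 = 0" and hi_count_0: "hi_count f 0 = 0"
  by (simp_all add: lo_count_def hi_count_def opt_counts_0)

text \<open>The hypotheses on minimizers in the parameter \<open>z = 1 / \<gamma>\<close>.
  Finiteness is stated separately because \<open>card\<close> of an infinite set is 0.\<close>

locale scale_space =
  fixes f :: L2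
  assumes countable_nonunique: "countable {z. 0 < z \<and> card (opt_set step_functions f z) \<noteq> 1}"
    and at_most_two: "\<And>z. 0 < z \<Longrightarrow> finite (opt_set step_functions f z) \<and> card (opt_set step_functions f z) \<le> 2"
begin

text \<open>
  If \<open>k\<close> is the only optimal count at \<open>z\<close>, it remains so slightly above \<open>z\<close>, where the minimizer
  is unique at some point since the exceptional set is countable. If there are two optimal counts at
  \<open>z\<close>, the best fits of both are among the at most two minimizers.
\<close>

lemma best_fits_singleton:
  assumes "0 \<le> z" "k \<in> opt_counts f z"
  shows "best_fits f k = {best_fit f k}"
proof -
  have "card (best_fits f k) = 1"
  proof (cases "opt_counts f z = {k}")
    case True
    obtain d where d: "0 < d" "\<And>z'. z < z' \<Longrightarrow> z' < z + d \<Longrightarrow> opt_counts f z' = {hi_count f z}"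
      using opt_counts_near[OF assms(1), of f] by metis
    have "hi_count f z = k" using True by (simp add: hi_count_def)
    have "\<not> {z<..<z + d} \<subseteq> {z. 0 < z \<and> card (opt_set step_functions f z) \<noteq> 1}"
      using countable_subset[OF _ countable_nonunique, of "{z<..<z + d}"] uncountable_open_interval[of z "z + d"] d(1) by auto
    then obtain z' where z': "z < z'" "z' < z + d" "card (opt_set step_functions f z') = 1"
      using assms(1) by auto
    have z'0: "0 \<le> z'" using z'(1) assms(1) by simp
    have oc: "opt_counts f z' = {k}" using d(2)[OF z'(1,2)] \<open>hi_count f z = k\<close> by simp
    have "opt_set step_functions f z' = best_fits f k"
    proof
      show "best_fits f k \<subseteq> opt_set step_functions f z'" by (rule best_fits_subset_opt_set) (use oc z'0 in auto)
      show "opt_set step_functions f z' \<subseteq> best_fits f k" using opt_set_iff[OF z'0, of _ f] oc by auto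
    qed
    then show ?thesis using z'(3) by simp
  next
    case False
    then obtain k' where k': "k' \<in> opt_counts f z" "k' \<noteq> k" using assms(2) by blast
    have "z \<noteq> 0"
    proof
      assume "z = 0"
      then show False using k' assms(2) by (simp add: opt_counts_0)
    qed
    then have z: "0 < z" using assms(1) by simp
    have sub: "best_fits f k \<union> best_fits f k' \<subseteq> opt_set step_functions f z"
      using best_fits_subset_opt_set[OF assms(2,1)] best_fits_subset_opt_set[OF k'(1) assms(1)] by blast
    have fin: "finite (best_fits f k)" "finite (best_fits f k')"
      using sub at_most_two[OF z] by (auto intro: finite_subset)
    have "best_fits f k \<inter> best_fits f k' = {}"
      using opt_counts_jumps[OF assms(2) _ assms(1)] opt_counts_jumps[OF k'(1) _ assms(1)] k'(2) by blast
    then have "card (best_fits f k) + card (best_fits f k') = card (best_fits f k \<union> best_fits f k')"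
      using fin by (simp add: card_Un_disjoint)
    also have "\<dots> \<le> card (opt_set step_functions f z)" by (rule card_mono) (use sub at_most_two[OF z] in auto)
    also have "\<dots> \<le> 2" using at_most_two[OF z] by simp
    finally have "card (best_fits f k) + card (best_fits f k') \<le> 2" .
    moreover have "1 \<le> card (best_fits f k)" "1 \<le> card (best_fits f k')"
      using fin best_fits_nonempty[of f] by (auto simp: Suc_le_eq card_gt_0_iff)
    ultimately show ?thesis by simp
  qed
  then obtain g where "best_fits f k = {g}" by (auto simp: card_1_singleton_iff)
  then show ?thesis by (simp add: best_fit_def)
qed

text \<open>Best fits for different optimal counts differ in their number of jumps, so a third
  optimal count would produce a third minimizer.\<close>

lemma opt_counts_cases:
  assumes "0 \<le> z" "k \<in> opt_counts f z"
  shows "k = lo_count f z \<or> k = hi_count f z"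
proof (rule ccontr)
  assume "\<not> ?thesis"
  then have ne: "k \<noteq> lo_count f z" "k \<noteq> hi_count f z" by auto
  note lo = lo_count_mem[OF assms(1), of f] and hi = hi_count_mem[OF assms(1), of f]
  have le: "lo_count f z \<le> k" "k \<le> hi_count f z"
    using assms by (simp_all add: lo_count_def hi_count_def finite_opt_counts)
  have "z \<noteq> 0"
  proof
    assume "z = 0"
    then show False using ne(1) assms(2) by (simp add: opt_counts_0 lo_count_0)
  qed
  then have z: "0 < z" using assms(1) by simp
  have mem: "best_fit f j \<in> opt_set step_functions f z" "njumps (best_fit f j) = j" if "j \<in> opt_counts f z" for j
    using best_fits_singleton[OF assms(1) that] best_fits_subset_opt_set[OF that assms(1)]
      opt_counts_jumps[OF that _ assms(1), of "best_fit f j"] by auto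
  have "card (best_fit f ` {lo_count f z, k, hi_count f z}) \<le> card (opt_set step_functions f z)"
    using mem(1) lo hi assms(2) at_most_two[OF z] by (intro card_mono) auto
  moreover have "card (best_fit f ` {lo_count f z, k, hi_count f z}) = card {lo_count f z, k, hi_count f z}"
  proof (rule card_image, rule inj_onI)
    fix i j assume "i \<in> {lo_count f z, k, hi_count f z}" "j \<in> {lo_count f z, k, hi_count f z}" and eq: "best_fit f i = best_fit f j"
    then have "i \<in> opt_counts f z" "j \<in> opt_counts f z" using lo hi assms(2) by blast+
    then have "i = njumps (best_fit f i)" "j = njumps (best_fit f j)" by (simp_all only: mem(2))
    then show "i = j" using eq by (simp only:)
  qed
  moreover have "card {lo_count f z, k, hi_count f z} = 3"
  proof -
    have "lo_count f z < k" "k < hi_count f z" using ne le by simp_all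
    then show ?thesis by simp
  qed
  ultimately show False using at_most_two[OF z] by simp
qed

lemma opt_set_eq_best_fit:
  assumes "0 \<le> z" "g \<in> opt_set step_functions f z"
  shows "g = best_fit f (njumps g)" "njumps g \<in> opt_counts f z"
  using opt_set_iff[OF assms(1), of g f] assms(2) best_fits_singleton[OF assms(1), of "njumps g"] by auto

lemma best_fit_opt_set:
  assumes "0 \<le> z" "k \<in> opt_counts f z"
  shows "best_fit f k \<in> opt_set step_functions f z" "njumps (best_fit f k) = k"
  using best_fits_singleton[OF assms] best_fits_subset_opt_set[OF assms(2,1)]
    opt_counts_jumps[OF assms(2) _ assms(1), of "best_fit f k"] by auto

text \<open>Slightly to the right of \<open>z\<close> the only optimal count is the largest one at
  \<open>z\<close>; choosing it at \<open>z\<close> itself makes the path right continuous.\<close>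

definition limit_path :: "real \<Rightarrow> L2" where
  "limit_path = (\<lambda>z\<in>{0..}. best_fit f (hi_count f z))"

lemma hi_count_near:
  assumes "0 \<le> z"
  obtains d where "0 < d" "\<And>z'. z \<le> z' \<Longrightarrow> z' < z + d \<Longrightarrow> hi_count f z' = hi_count f z"
    "\<And>z'. 0 \<le> z' \<Longrightarrow> z - d < z' \<Longrightarrow> z' < z \<Longrightarrow> hi_count f z' = lo_count f z"
proof -
  obtain d where d: "0 < d" "\<And>z'. z < z' \<Longrightarrow> z' < z + d \<Longrightarrow> opt_counts f z' = {hi_count f z}"
    "\<And>z'. 0 \<le> z' \<Longrightarrow> z - d < z' \<Longrightarrow> z' < z \<Longrightarrow> opt_counts f z' = {lo_count f z}"
    using opt_counts_near[OF assms, of f] by metis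
  show thesis
  proof (rule that[OF d(1)])
    show "hi_count f z' = hi_count f z" if "z \<le> z'" "z' < z + d" for z'
      using d(2)[of z'] that by (cases "z' = z") (simp_all add: hi_count_def[of f z'])
    show "hi_count f z' = lo_count f z" if "0 \<le> z'" "z - d < z'" "z' < z" for z'
      using d(3)[OF that] by (simp add: hi_count_def[of f z'])
  qed
qed

lemma limit_path_opt: "0 \<le> z \<Longrightarrow> limit_path z \<in> opt_set step_functions f z"
  using best_fit_opt_set(1)[OF _ hi_count_mem] by (simp add: limit_path_def)

lemma limit_path_skorokhod: "limit_path \<in> skorokhod_space"
  unfolding skorokhod_space_def
proof (intro CollectI conjI allI impI)
  show "limit_path \<in> extensional {0..}" by (simp add: limit_path_def)
next
  fix t :: real assume t: "0 \<le> t"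
  obtain d where d: "0 < d" "\<And>z'. t \<le> z' \<Longrightarrow> z' < t + d \<Longrightarrow> hi_count f z' = hi_count f t"
    using hi_count_near[OF t] by metis
  have "t < t + d" using d(1) by simp
  then have "\<forall>\<^sub>F u in at_right t. limit_path u = limit_path t"
  proof (rule eventually_at_rightI[rotated])
    fix u assume "u \<in> {t<..<t + d}"
    then show "limit_path u = limit_path t" using d(2)[of u] t by (simp add: limit_path_def)
  qed
  then show "continuous (at_right t) limit_path" unfolding continuous_within by (rule tendsto_eventually)
next
  fix t :: real assume t: "0 < t"
  obtain d where d: "0 < d" "\<And>z'. 0 \<le> z' \<Longrightarrow> t - d < z' \<Longrightarrow> z' < t \<Longrightarrow> hi_count f z' = lo_count f t"
    using hi_count_near[OF less_imp_le[OF t]] by metis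
  have "max 0 (t - d) < t" using d(1) t by simp
  then have "\<forall>\<^sub>F u in at_left t. limit_path u = best_fit f (lo_count f t)"
  proof (rule eventually_at_leftI[rotated])
    fix u assume "u \<in> {max 0 (t - d)<..<t}"
    then show "limit_path u = best_fit f (lo_count f t)" using d(2)[of u] by (simp add: limit_path_def)
  qed
  then show "\<exists>a. (limit_path \<longlongrightarrow> a) (at_left t)" by (blast intro: tendsto_eventually)
qed

text \<open>Immediately to the right of \<open>t\<close> the minimizer is unique and does not
  change, so right continuity dictates the value at \<open>t\<close>.\<close>

lemma limit_path_unique:
  assumes "\<tau> \<in> skorokhod_space" "\<And>z. 0 \<le> z \<Longrightarrow> \<tau> z \<in> opt_set step_functions f z"
  shows "\<tau> = limit_path"
proof (rule extensionalityI)
  show "\<tau> \<in> extensional {0..}" "limit_path \<in> extensional {0..}"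
    using assms(1) limit_path_skorokhod by (auto simp: skorokhod_space_def)
  fix t :: real assume "t \<in> {0..}"
  then have t: "0 \<le> t" by simp
  obtain d where d: "0 < d" "\<And>z'. t < z' \<Longrightarrow> z' < t + d \<Longrightarrow> opt_counts f z' = {hi_count f t}"
    using opt_counts_near[OF t, of f] by metis
  have "t < t + d" using d(1) by simp
  then have "\<forall>\<^sub>F u in at_right t. \<tau> u = limit_path t"
  proof (rule eventually_at_rightI[rotated])
    fix u assume u: "u \<in> {t<..<t + d}"
    then have u0: "0 \<le> u" using t by simp
    have "\<tau> u = best_fit f (hi_count f t)"
      using opt_set_eq_best_fit[OF u0 assms(2)[OF u0]] d(2)[of u] u by simp
    then show "\<tau> u = limit_path t" using t by (simp add: limit_path_def)
  qed
  then have "(\<tau> \<longlongrightarrow> limit_path t) (at_right t)" by (rule tendsto_eventually)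
  moreover have "(\<tau> \<longlongrightarrow> \<tau> t) (at_right t)"
    using assms(1) t by (simp add: skorokhod_space_def continuous_within)
  ultimately show "\<tau> t = limit_path t" by (intro tendsto_unique[of "at_right t"]) auto
qed

end

section \<open>Empirical minimizers\<close>

text \<open>The exchange argument of \<open>opt_counts_mono\<close> for an arbitrary set of
  candidates; for empirical minimizers it makes the count path nondecreasing.\<close>

lemma opt_set_njumps_mono:
  assumes "u \<in> opt_set X \<phi> z" "v \<in> opt_set X \<phi> z'" "0 \<le> z" "z < z'"
  shows "njumps u \<le> njumps v"
proof (rule ccontr)
  assume "\<not> njumps u \<le> njumps v"
  then have kk: "0 < real (njumps u) - real (njumps v)" by simp
  let ?D = "sq_err \<phi> v - sq_err \<phi> u"
  have X: "u \<in> X" "v \<in> X" using assms by (auto simp: opt_set_def)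
  have a: "real (njumps u) + z * sq_err \<phi> u \<le> real (njumps v) + z * sq_err \<phi> v"
    using assms(1) X unfolding opt_set_def by blast
  have b: "real (njumps v) + z' * sq_err \<phi> v \<le> real (njumps u) + z' * sq_err \<phi> u"
    using assms(2) X unfolding opt_set_def by blast
  have "0 < z * ?D" using a kk unfolding right_diff_distrib by linarith
  then have "0 < ?D" using assms(3) by (metis mult_nonneg_nonpos not_less)
  then have "z * ?D < z' * ?D" using assms(4) by (rule mult_strict_right_mono[rotated])
  then show False using a b kk unfolding right_diff_distrib by linarith
qed

lemma jump_set_zero: "jump_set 0 = {}"
proof -
  have "piecewise_const {} (\<lambda>_. 0)" by (simp add: piecewise_const_def)
  from jump_set_subset[OF piecewise_const_cadlag_fun[OF this L2_represents_0]] show ?thesis by simp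
qed

lemma zero_grid_steps: "0 \<in> grid_steps m"
  by (simp add: grid_steps_def jump_set_zero step_functions_def span_zero)

lemma norm_eq_step_proj:
  assumes "partition_pts k t"
  shows "(norm \<phi>)\<^sup>2 = sq_err \<phi> (step_proj k \<phi> t) + (norm (step_proj k \<phi> t))\<^sup>2"
proof -
  have "step_comb k (\<lambda>_. 0) t = 0" by (simp add: step_comb_def)
  then show ?thesis using norm_diff_step_comb[OF assms, of \<phi> "\<lambda>_. 0"] by simp
qed

text \<open>Comparison with the zero function gives \<open>k \<le> z * (norm u)\<^sup>2\<close>. As
  \<open>u\<close> is a projection of \<open>f + e\<close>, its squared norm is at most twice that
  of \<open>f\<close> plus a noise term proportional to \<open>(k + 1) * c\<close>.\<close>

lemma opt_set_njumps_bound: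
  assumes u: "u \<in> opt_set (grid_steps m) (f + e) z" and m: "1 \<le> m" and e: "noise_le m e c"
    and z: "0 \<le> z" "z \<le> Z" and c: "4 * Z * c \<le> 1"
  shows "real (njumps u) \<le> 4 * Z * (norm f)\<^sup>2 + 1"
proof -
  let ?k = "njumps u" and ?t = "pts_of (jump_set u)"
  have ug: "u \<in> grid_steps m" and us: "u \<in> step_functions" using u by (auto simp: opt_set_def grid_steps_def)
  note P = partition_jump_set[OF us]
  have up: "u = step_proj ?k (f + e) ?t" by (rule opt_set_eq_proj[OF u m])
  have "(norm (f + e))\<^sup>2 = sq_err (f + e) u + (norm u)\<^sup>2"
    using norm_eq_step_proj[OF P, of "f + e"] unfolding up[symmetric] .
  moreover have "real (njumps u) + z * sq_err (f + e) u \<le> real (njumps 0) + z * sq_err (f + e) 0"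
    using u zero_grid_steps[of m] unfolding opt_set_def by blast
  ultimately have k: "real ?k \<le> z * (norm u)\<^sup>2" by (simp add: jump_set_zero distrib_left)
  have F: "(norm (step_proj ?k f ?t))\<^sup>2 \<le> (norm f)\<^sup>2" using norm_eq_step_proj[OF P, of f] by simp
  have E: "(norm (step_proj ?k e ?t))\<^sup>2 \<le> real (Suc ?k) * c"
  proof (rule norm_step_proj_le[OF P])
    show "0 \<le> c" using e by (simp add: noise_le_def)
    fix i assume "i \<le> ?k"
    then show "(inner e (L2_indicator (?t i) (?t (Suc i))))\<^sup>2 \<le> c * (?t (Suc i) - ?t i)"
      using e pts_of_jump_set_grid[OF ug m] P by (simp add: noise_le_def partition_pts_def)
  qed
  have "norm u \<le> norm (step_proj ?k f ?t) + norm (step_proj ?k e ?t)"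
    by (subst up, unfold step_proj_add) (rule norm_triangle_ineq)
  then have "(norm u)\<^sup>2 \<le> (norm (step_proj ?k f ?t) + norm (step_proj ?k e ?t))\<^sup>2" by (rule power_mono) simp
  also have "\<dots> \<le> 2 * (norm (step_proj ?k f ?t))\<^sup>2 + 2 * (norm (step_proj ?k e ?t))\<^sup>2"
    using sum_squares_bound[of "norm (step_proj ?k f ?t)" "norm (step_proj ?k e ?t)"] unfolding power2_sum by linarith
  also have "\<dots> \<le> 2 * (norm f)\<^sup>2 + 2 * (real (Suc ?k) * c)" using F E by linarith
  finally have n: "(norm u)\<^sup>2 \<le> 2 * (norm f)\<^sup>2 + 2 * (real (Suc ?k) * c)" .
  have "real ?k \<le> Z * (norm u)\<^sup>2"
    using k mult_right_mono[OF z(2), of "(norm u)\<^sup>2"] by simp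
  also have "\<dots> \<le> Z * (2 * (norm f)\<^sup>2 + 2 * (real (Suc ?k) * c))" using n z by (intro mult_left_mono) auto
  \<comment> \<open>The count comes back on the right with the coefficient \<open>2 * Z * c\<close>;
    the assumption on \<open>c\<close> makes this at most 1/2, so that it can be absorbed.\<close>
  also have "\<dots> = 2 * Z * (norm f)\<^sup>2 + real (Suc ?k) * (4 * Z * c) / 2" by (simp add: algebra_simps)
  also have "\<dots> \<le> 2 * Z * (norm f)\<^sup>2 + real (Suc ?k) * 1 / 2"
    using c by (intro add_left_mono divide_right_mono mult_left_mono) auto
  finally have "real ?k \<le> 2 * Z * (norm f)\<^sup>2 + real (Suc ?k) * 1 / 2" .
  moreover have "4 * Z * (norm f)\<^sup>2 = 2 * (2 * Z * (norm f)\<^sup>2)" by simp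
  moreover have "real (Suc ?k) * 1 / 2 = (real ?k + 1) / 2" by simp
  ultimately show ?thesis by argo
qed

lemma constant_count_subseq:
  fixes h :: "nat \<Rightarrow> nat"
  assumes "\<And>n. h n \<le> K"
  obtains r k where "strict_mono (r :: nat \<Rightarrow> nat)" "\<And>n. h (r n) = k"
proof -
  have "finite (h ` UNIV)" by (rule finite_subset[of _ "{..K}"]) (use assms in auto)
  then have "\<exists>n\<in>UNIV. infinite {n' \<in> UNIV. h n' = h n}" by (intro pigeonhole_infinite) auto
  then obtain n where "infinite {n'. h n' = h n}" by auto
  from infinite_enumerate[OF this] obtain r where "strict_mono (r :: nat \<Rightarrow> nat)" "\<forall>i. r i \<in> {n'. h n' = h n}" by blast
  then show thesis by (intro that[of r "h n"]) auto
qed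

text \<open>The parameters \<open>z j\<close> may vary with \<open>j\<close>, so that arguments by
  contradiction yield statements uniform in the parameter over bounded sets. Subsequences are
  extracted for the parameter, the count and the partition.\<close>

lemma opt_converging_subsequence:
  fixes m :: "nat \<Rightarrow> nat"
  assumes e: "\<forall>\<^sub>F n in sequentially. noise_le n (e n) (c n)" "c \<longlonglongrightarrow> 0" and m: "\<And>j. j \<le> m j"
    and z: "\<And>j. 0 \<le> z j" "\<And>j. z j \<le> Z"
    and u: "\<And>j. u j \<in> opt_set (grid_steps (m j)) (f + e (m j)) (z j)"
  obtains r \<zeta> g where "strict_mono (r :: nat \<Rightarrow> nat)" "(\<lambda>j. z (r j)) \<longlonglongrightarrow> \<zeta>" "0 \<le> \<zeta>" "g \<in> opt_set step_functions f \<zeta>"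
    "\<And>j. njumps (u (r j)) = njumps g" "(\<lambda>j. u (r j)) \<longlonglongrightarrow> g" "(\<lambda>j. cadlag_rep (u (r j))) \<longlonglongrightarrow> cadlag_rep g"
proof -
  have "(\<lambda>n. 4 * Z * c n) \<longlonglongrightarrow> 4 * Z * 0" by (intro tendsto_intros e(2))
  then have "\<forall>\<^sub>F n in sequentially. 4 * Z * c n < 1" by (rule order_tendstoD(2)) simp
  with e(1) have "\<forall>\<^sub>F n in sequentially. noise_le n (e n) (c n) \<and> 4 * Z * c n < 1 \<and> 1 \<le> n"
    using eventually_ge_at_top[of 1] by eventually_elim simp
  then obtain N where N: "\<And>n. N \<le> n \<Longrightarrow> noise_le n (e n) (c n) \<and> 4 * Z * c n < 1 \<and> 1 \<le> n"
    by (auto simp: eventually_sequentially)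
  have mN: "1 \<le> m j" "noise_le (m j) (e (m j)) (c (m j))" "4 * Z * c (m j) \<le> 1" if "N \<le> j" for j
    using N[OF order_trans[OF that m]] by auto
  \<comment> \<open>The shift by \<open>N\<close> discards the indices at which the noise bound does
    not hold yet.\<close>
  have "\<forall>j. z (j + N) \<in> {0..Z}" using z by simp
  then obtain \<zeta> r1 where r1: "strict_mono (r1 :: nat \<Rightarrow> nat)" "((\<lambda>j. z (j + N)) \<circ> r1) \<longlonglongrightarrow> \<zeta>"
    using seq_compactE[OF compact_imp_seq_compact[OF compact_Icc[of 0 Z]]] by metis
  have "njumps (u (r1 j + N)) \<le> nat \<lceil>4 * Z * (norm f)\<^sup>2 + 1\<rceil>" for j
    using opt_set_njumps_bound[OF u mN(1,2) z mN(3), of "r1 j + N"] by linarith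
  then obtain r2 k where r2: "strict_mono (r2 :: nat \<Rightarrow> nat)" "\<And>j. njumps (u (r1 (r2 j) + N)) = k"
    using constant_count_subseq[of "\<lambda>j. njumps (u (r1 j + N))"] by metis
  define s where "s j = r1 (r2 j) + N" for j
  have s: "strict_mono s" using strict_mono_o[OF r1(1) r2(1)] by (simp add: s_def strict_mono_def)
  have sN: "N \<le> s j" for j by (simp add: s_def)
  have ms: "filterlim (\<lambda>j. m (s j)) at_top sequentially"
    by (rule filterlim_at_top_mono[OF filterlim_subseq[OF s]]) (use m in simp)
  have zs: "(\<lambda>j. z (s j)) \<longlonglongrightarrow> \<zeta>" using LIMSEQ_subseq_LIMSEQ[OF r1(2) r2(1)] by (simp add: s_def comp_def)
  have us: "njumps (u (s j)) = k" for j using r2(2) by (simp add: s_def)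
  obtain r g where r: "strict_mono (r :: nat \<Rightarrow> nat)" "g \<in> step_functions" "((\<lambda>j. u (s j)) \<circ> r) \<longlonglongrightarrow> g" "njumps g \<le> k"
    and g1: "\<And>h. h \<in> step_functions \<Longrightarrow> real k + \<zeta> * sq_err f g \<le> real (njumps h) + \<zeta> * sq_err f h"
    and g2: "\<And>h. h \<in> step_functions \<Longrightarrow> njumps h \<le> k \<Longrightarrow> sq_err f g \<le> sq_err f h"
    and g3: "njumps g = k \<Longrightarrow> (\<lambda>j. cadlag_rep (u (s (r j)))) \<longlonglongrightarrow> cadlag_rep g"
    using opt_subsequence[of "\<lambda>j. m (s j)" "\<lambda>j. e (m (s j))" "\<lambda>j. c (m (s j))" "\<lambda>j. u (s j)" f "\<lambda>j. z (s j)" k \<zeta>,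
        OF ms mN(1)[OF sN] mN(2)[OF sN] filterlim_compose[OF e(2) ms] u us zs] by metis
  \<comment> \<open>With \<open>h = g\<close> the errors cancel and \<open>k \<le> njumps g\<close>
    remains: no jump is lost in the limit.\<close>
  have gk: "njumps g = k" using g1[OF r(2)] r(4) by simp
  have "g \<in> opt_set step_functions f \<zeta>" unfolding opt_set_def using r(2) g1 g2 gk by simp
  moreover have "strict_mono (s \<circ> r)" by (rule strict_mono_o[OF s r(1)])
  moreover have "0 \<le> \<zeta>" by (rule LIMSEQ_le_const[OF zs]) (use z(1) in auto)
  moreover have "(\<lambda>j. z ((s \<circ> r) j)) \<longlonglongrightarrow> \<zeta>" using LIMSEQ_subseq_LIMSEQ[OF zs r(1)] by (simp add: comp_def)
  ultimately show thesis using that[of "s \<circ> r" \<zeta> g] us gk r(3) g3 by (simp add: comp_def)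
qed

context scale_space
begin

text \<open>Otherwise there would be empirical minimizers with parameters tending to
  \<open>z\<close> and counts outside \<open>opt_counts f z\<close>. A limit along a subsequence has
  the same count and is optimal at \<open>z\<close>.\<close>

lemma empirical_counts_near:
  assumes e: "\<forall>\<^sub>F n in sequentially. noise_le n (e n) (c n)" "c \<longlonglongrightarrow> 0" and z: "0 \<le> z"
  shows "\<exists>d>0. \<forall>\<^sub>F n in sequentially. \<forall>z'\<ge>0. \<bar>z' - z\<bar> < d \<longrightarrow>
    (\<forall>u\<in>opt_set (grid_steps n) (f + e n) z'. njumps u \<in> opt_counts f z)"
proof (rule ccontr)
  assume no: "\<not> ?thesis"
  have "\<exists>n z' u. j \<le> n \<and> 0 \<le> z' \<and> \<bar>z' - z\<bar> < 1 / real (Suc j) \<and>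
      u \<in> opt_set (grid_steps n) (f + e n) z' \<and> njumps u \<notin> opt_counts f z" for j
  proof -
    have "0 < 1 / real (Suc j)" by simp
    then have "\<not> (\<forall>\<^sub>F n in sequentially. \<forall>z'\<ge>0. \<bar>z' - z\<bar> < 1 / real (Suc j) \<longrightarrow>
        (\<forall>u\<in>opt_set (grid_steps n) (f + e n) z'. njumps u \<in> opt_counts f z))" using no by blast
    then show ?thesis unfolding eventually_sequentially by blast
  qed
  then obtain m z' u where m: "\<And>j. j \<le> m j" and z': "\<And>j. 0 \<le> z' j" "\<And>j. \<bar>z' j - z\<bar> < 1 / real (Suc j)"
    and u: "\<And>j. u j \<in> opt_set (grid_steps (m j)) (f + e (m j)) (z' j)" "\<And>j. njumps (u j) \<notin> opt_counts f z"
    by metis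
  have zZ: "z' j \<le> z + 1" for j
  proof -
    have "1 / real (Suc j) \<le> 1" by simp
    then show ?thesis using z'(2)[of j] by linarith
  qed
  have zlim: "z' \<longlonglongrightarrow> z"
  proof (rule LIM_zero_cancel, rule Lim_null_comparison)
    show "\<forall>\<^sub>F j in sequentially. norm (z' j - z) \<le> 1 / real (Suc j)" using z'(2) by (simp add: less_imp_le)
    show "(\<lambda>j. 1 / real (Suc j)) \<longlonglongrightarrow> 0" by (rule LIMSEQ_Suc[OF lim_1_over_n])
  qed
  obtain r \<zeta> g where r: "strict_mono (r :: nat \<Rightarrow> nat)" "(\<lambda>n. z' (r n)) \<longlonglongrightarrow> \<zeta>" "0 \<le> \<zeta>" "g \<in> opt_set step_functions f \<zeta>"
    "\<And>n. njumps (u (r n)) = njumps g"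
    using opt_converging_subsequence[of e c m z' "z + 1" u f, OF e m z'(1) zZ u(1)] by metis
  have "\<zeta> = z" using LIMSEQ_unique[OF r(2)] LIMSEQ_subseq_LIMSEQ[OF zlim r(1)] by (simp add: comp_def)
  then have "njumps (u (r 0)) \<in> opt_counts f z" using opt_set_eq_best_fit(2)[OF r(3,4)] r(5) by simp
  then show False using u(2) by blast
qed

text \<open>The comparison is with the best fit for the count of \<open>u\<close> itself, whether or
  not the limit path has this count at the same parameter. This separates closeness of the functions
  from the matching of the counts.\<close>

lemma empirical_close:
  assumes e: "\<forall>\<^sub>F n in sequentially. noise_le n (e n) (c n)" "c \<longlonglongrightarrow> 0" and eps: "0 < \<epsilon>"
  shows "\<forall>\<^sub>F n in sequentially. \<forall>z'. 0 \<le> z' \<and> z' \<le> Z \<longrightarrow> (\<forall>u\<in>opt_set (grid_steps n) (f + e n) z'.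
      dist u (best_fit f (njumps u)) < \<epsilon> \<and> dist (cadlag_rep u) (cadlag_rep (best_fit f (njumps u))) < \<epsilon>)"
proof (rule ccontr)
  assume no: "\<not> ?thesis"
  have "\<exists>n z' u. j \<le> n \<and> 0 \<le> z' \<and> z' \<le> Z \<and> u \<in> opt_set (grid_steps n) (f + e n) z' \<and>
      \<not> (dist u (best_fit f (njumps u)) < \<epsilon> \<and> dist (cadlag_rep u) (cadlag_rep (best_fit f (njumps u))) < \<epsilon>)" for j
    using no unfolding eventually_sequentially by blast
  then obtain m z' u where m: "\<And>j. j \<le> m j" and z': "\<And>j. 0 \<le> z' j" "\<And>j. z' j \<le> Z"
    and u: "\<And>j. u j \<in> opt_set (grid_steps (m j)) (f + e (m j)) (z' j)"
    and far: "\<And>j. \<not> (dist (u j) (best_fit f (njumps (u j))) < \<epsilon> \<and>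
      dist (cadlag_rep (u j)) (cadlag_rep (best_fit f (njumps (u j)))) < \<epsilon>)"
    by metis
  obtain r \<zeta> g where r: "strict_mono (r :: nat \<Rightarrow> nat)" "0 \<le> \<zeta>" "g \<in> opt_set step_functions f \<zeta>"
    "\<And>n. njumps (u (r n)) = njumps g" "(\<lambda>n. u (r n)) \<longlonglongrightarrow> g" "(\<lambda>n. cadlag_rep (u (r n))) \<longlonglongrightarrow> cadlag_rep g"
    using opt_converging_subsequence[of e c m z' Z u f, OF e m z' u] by metis
  have g: "best_fit f (njumps g) = g" using opt_set_eq_best_fit(1)[OF r(2,3)] by simp
  have "\<forall>\<^sub>F n in sequentially. dist (u (r n)) g < \<epsilon> \<and> dist (cadlag_rep (u (r n))) (cadlag_rep g) < \<epsilon>"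
    by (intro eventually_conj tendstoD[OF r(5)] tendstoD[OF r(6)] eps)
  then obtain n where "dist (u (r n)) g < \<epsilon> \<and> dist (cadlag_rep (u (r n))) (cadlag_rep g) < \<epsilon>"
    by (auto simp: eventually_sequentially)
  then show False using far[of "r n"] r(4)[of n] g by simp
qed

end

section \<open>Convergence of counting paths in the \<open>J\<^sub>1\<close> topology\<close>

definition counting_path :: "(real \<Rightarrow> nat) \<Rightarrow> bool" where
  "counting_path h \<longleftrightarrow> (\<forall>s t. 0 \<le> s \<longrightarrow> s \<le> t \<longrightarrow> h s \<le> h t) \<and>
     (\<forall>t\<ge>0. \<exists>d>0. \<forall>s. t \<le> s \<longrightarrow> s < t + d \<longrightarrow> h s = h t)"

lemma counting_path_mono: "counting_path h \<Longrightarrow> 0 \<le> s \<Longrightarrow> s \<le> t \<Longrightarrow> h s \<le> h t"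
  by (simp add: counting_path_def)

definition passage :: "(real \<Rightarrow> nat) \<Rightarrow> nat \<Rightarrow> real" where
  "passage h c = Inf {s. 0 \<le> s \<and> c \<le> h s}"

text \<open>Right continuity makes the infimum attained, which turns \<open>passage h\<close> into
  the lower adjoint of \<open>h\<close>.\<close>

lemma passage:
  assumes h: "counting_path h" and ex: "0 \<le> s0" "c \<le> h s0"
  shows "0 \<le> passage h c" "\<And>s. 0 \<le> s \<Longrightarrow> c \<le> h s \<longleftrightarrow> passage h c \<le> s"
proof -
  let ?S = "{s. 0 \<le> s \<and> c \<le> h s}"
  have ne: "?S \<noteq> {}" using ex by blast
  have bdd: "bdd_below ?S" by (rule bdd_belowI[of _ 0]) simp
  show a0: "0 \<le> passage h c" unfolding passage_def by (rule cInf_greatest[OF ne]) simp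
  obtain d where d: "0 < d" "\<And>s. passage h c \<le> s \<Longrightarrow> s < passage h c + d \<Longrightarrow> h s = h (passage h c)"
    using h a0 unfolding counting_path_def by meson
  have "Inf ?S < passage h c + d" using d(1) by (simp add: passage_def)
  then obtain s1 where s1: "s1 \<in> ?S" "s1 < passage h c + d" unfolding cInf_less_iff[OF ne bdd] by blast
  have "passage h c \<le> s1" unfolding passage_def by (rule cInf_lower[OF s1(1) bdd])
  then have ca: "c \<le> h (passage h c)" using d(2)[of s1] s1 by simp
  show "c \<le> h s \<longleftrightarrow> passage h c \<le> s" if s: "0 \<le> s" for s
  proof
    assume "c \<le> h s"
    then show "passage h c \<le> s" unfolding passage_def using s by (intro cInf_lower[OF _ bdd]) simp
  next
    assume "passage h c \<le> s"
    then have "h (passage h c) \<le> h s" by (rule counting_path_mono[OF h a0])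
    then show "c \<le> h s" using ca by simp
  qed
qed

section \<open>Estimates for the integral in the metric\<close>

lemma nn_integral_exp_tail: "(\<integral>\<^sup>+u\<in>{A..}. ennreal (exp (- u)) \<partial>lborel) = ennreal (exp (- A))"
proof -
  have "(\<integral>\<^sup>+u. ennreal (exp (- u)) * indicator {A..} u \<partial>lborel) = ennreal (0 - (- exp (- A)))"
  proof (rule nn_integral_FTC_atLeast)
    show "((\<lambda>u::real. - exp (- u)) \<longlongrightarrow> 0) at_top" by real_asymp
  qed (auto intro!: derivative_eq_intros)
  then show ?thesis by simp
qed

text \<open>The gap never exceeds 1. Levels \<open>u\<close> near some \<open>a i\<close> have total
  length at most \<open>(C + 1) * 2 * r\<close>, and those beyond \<open>A\<close> carry the
  exponential weight \<open>exp (- A)\<close>.\<close>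

lemma J1_int_le:
  fixes a :: "nat \<Rightarrow> real"
  assumes "0 \<le> e" "0 \<le> r"
    and gap: "\<And>u. 0 \<le> u \<Longrightarrow> u \<le> A \<Longrightarrow> (\<And>i. i \<le> C \<Longrightarrow> r < \<bar>u - a i\<bar>) \<Longrightarrow> J1_gap x y l u \<le> ennreal e"
  shows "J1_int x y l \<le> ennreal (e + real (Suc C) * (2 * r) + exp (- A))"
proof -
  let ?B = "\<lambda>u. \<Sum>i\<le>C. indicator {a i - r..a i + r} u :: ennreal"
  have "J1_int x y l \<le> (\<integral>\<^sup>+u. (ennreal e * (ennreal (exp (- u)) * indicator {0..} u) + ?B u +
      ennreal (exp (- u)) * indicator {A..} u) \<partial>lborel)"
    unfolding J1_int_def
  proof (rule nn_integral_mono)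
    fix u :: real
    show "ennreal (exp (- u)) * J1_gap x y l u * indicator {0..} u \<le>
      ennreal e * (ennreal (exp (- u)) * indicator {0..} u) + ?B u + ennreal (exp (- u)) * indicator {A..} u" (is "?l \<le> ?p + ?q + ?r")
    proof (cases "0 \<le> u")
      case u: True
      consider "A \<le> u" | "\<exists>i\<le>C. \<bar>u - a i\<bar> \<le> r" | "u \<le> A" "\<And>i. i \<le> C \<Longrightarrow> r < \<bar>u - a i\<bar>"
        by (meson linear not_less)
      then show ?thesis
      proof cases
        case 1
        have "?l \<le> ennreal (exp (- u)) * 1" using u mult_left_mono[OF J1_gap_le_1] by simp
        also have "\<dots> = ?r" using 1 by simp
        also have "\<dots> \<le> ?p + ?q + ?r" by (rule add_increasing) simp_all
        finally show ?thesis .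
      next
        case 2
        then obtain i where i: "i \<le> C" "\<bar>u - a i\<bar> \<le> r" by blast
        have "?l \<le> ennreal (exp (- u)) * 1" using u mult_left_mono[OF J1_gap_le_1] by simp
        also have "\<dots> \<le> 1" using u by (simp add: ennreal_le_1)
        also have "\<dots> = indicator {a i - r..a i + r} u" using i(2) by (auto simp: indicator_def abs_le_iff)
        also have "\<dots> \<le> ?q" by (rule member_le_sum) (use i(1) in auto)
        also have "\<dots> \<le> ?p + ?q" by (rule add_increasing) simp_all
        also have "\<dots> \<le> ?p + ?q + ?r" by (rule add_increasing2) simp_all
        finally show ?thesis .
      next
        case 3
        have "?l \<le> ?p" using u mult_left_mono[OF gap[OF u 3], of "ennreal (exp (- u))"] by (simp add: mult.commute)
        also have "\<dots> \<le> ?p + ?q" by (rule add_increasing2) simp_all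
        also have "\<dots> \<le> ?p + ?q + ?r" by (rule add_increasing2) simp_all
        finally show ?thesis .
      qed
    qed simp
  qed
  also have "\<dots> = ennreal e * 1 + (\<Sum>i\<le>C. ennreal (2 * r)) + ennreal (exp (- A))"
  proof -
    have 1: "(\<integral>\<^sup>+u. ?B u \<partial>lborel) = (\<Sum>i\<le>C. ennreal (2 * r))"
      using assms(2) by (subst nn_integral_sum) (auto intro!: sum.cong)
    have 2: "(\<integral>\<^sup>+u. ennreal e * (ennreal (exp (- u)) * indicator {0..} u) \<partial>lborel) = ennreal e * 1"
      by (subst nn_integral_cmult) (simp_all add: nn_integral_exp_minus)
    show ?thesis
      by (subst nn_integral_add, simp, simp, subst nn_integral_add, simp, simp)
         (simp only: 1 2 nn_integral_exp_tail)
  qed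
  also have "\<dots> = ennreal (e + real (Suc C) * (2 * r) + exp (- A))"
    using assms by (simp add: ennreal_plus[symmetric] ennreal_of_nat_eq_real_of_nat ennreal_mult[symmetric] del: ennreal_plus)
  finally show ?thesis .
qed

text \<open>Stopping at \<open>u\<close> comes after the time change, so \<open>t\<close> and
  \<open>l t\<close> may fall on different sides of \<open>u\<close>. Both are then close to
  \<open>u\<close>, where \<open>k\<close> is constant.\<close>

lemma counts_min_eq:
  fixes k kn :: "real \<Rightarrow> nat"
  assumes l: "l \<in> time_changes {0..}" "\<And>t. \<bar>l t - t\<bar> \<le> r"
    and eq: "\<And>t. 0 \<le> t \<Longrightarrow> t \<le> T \<Longrightarrow> kn (l t) = k t"
    and u: "0 \<le> u" "u + r \<le> T" and const: "\<And>s. 0 \<le> s \<Longrightarrow> \<bar>s - u\<bar> \<le> r \<Longrightarrow> k s = k u"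
    and t: "0 \<le> t"
  shows "kn (min (l t) u) = k (min t u)"
proof -
  have r: "0 \<le> r" using l(2)[of 0] by linarith
  have "u \<in> l ` {0..}" using l(1) u(1) by (simp add: time_changes_def)
  then obtain s where s: "0 \<le> s" "l s = u" by auto
  have su: "\<bar>s - u\<bar> \<le> r" using l(2)[of s] s(2) by linarith
  have knu: "kn u = k u" using eq[of s] s su u(2) const[OF s(1) su] by simp
  consider "l t \<le> u" "t \<le> u" | "l t \<le> u" "u < t" | "u < l t" "t \<le> u" | "u < l t" "u < t" by linarith
  then show ?thesis
  proof cases
    case 1
    then show ?thesis using eq[of t] t u r by simp
  next
    case 2
    then have "\<bar>t - u\<bar> \<le> r" "t \<le> T" using l(2)[of t] u(2) by linarith+
    then show ?thesis using 2 eq[of t] const[of t] t by simp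
  next
    case 3
    then have "\<bar>t - u\<bar> \<le> r" using l(2)[of t] by linarith
    then show ?thesis using 3 const[of t] t knu by simp
  next
    case 4
    then show ?thesis using knu by simp
  qed
qed

text \<open>\<open>lo\<close> gives the left limits of the limit path \<open>k\<close>, and
  \<open>P t\<close> holds the counts admissible at \<open>t\<close>; it will be
  \<open>opt_counts f t\<close>. Assumption \<open>kn_near\<close> together with
  \<open>P_cases\<close> says that near \<open>t\<close> the paths \<open>kn n\<close> eventually
  take no values other than \<open>lo t\<close> and \<open>k t\<close>.\<close>

locale count_convergence =
  fixes kn :: "nat \<Rightarrow> real \<Rightarrow> nat" and k lo :: "real \<Rightarrow> nat" and P :: "real \<Rightarrow> nat set"
  assumes k: "counting_path k"
    and kn: "\<forall>\<^sub>F n in sequentially. counting_path (kn n)"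
    and lo: "\<And>t. 0 \<le> t \<Longrightarrow> lo t \<in> P t" "lo 0 = k 0"
    and P_cases: "\<And>t j. 0 \<le> t \<Longrightarrow> j \<in> P t \<Longrightarrow> j = lo t \<or> j = k t"
    and P_near: "\<And>t. 0 \<le> t \<Longrightarrow> \<exists>d>0. (\<forall>s. t < s \<longrightarrow> s < t + d \<longrightarrow> P s = {k t}) \<and>
        (\<forall>s. 0 \<le> s \<longrightarrow> t - d < s \<longrightarrow> s < t \<longrightarrow> P s = {lo t} \<and> k s = lo t)"
    and kn_near: "\<And>t. 0 \<le> t \<Longrightarrow> \<exists>d>0. \<forall>\<^sub>F n in sequentially. \<forall>s\<ge>0. \<bar>s - t\<bar> < d \<longrightarrow> kn n s \<in> P t"
begin

lemma kn_at: "0 \<le> t \<Longrightarrow> P t = {j} \<Longrightarrow> \<forall>\<^sub>F n in sequentially. kn n t = j"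
proof -
  assume t: "0 \<le> t" "P t = {j}"
  obtain d where d: "0 < d" "\<forall>\<^sub>F n in sequentially. \<forall>s\<ge>0. \<bar>s - t\<bar> < d \<longrightarrow> kn n s \<in> P t"
    using kn_near[OF t(1)] by blast
  from d(2) show ?thesis
  proof eventually_elim
    case (elim n)
    then have "kn n t \<in> P t" using d(1) t(1) by simp
    then show ?case using t(2) by simp
  qed
qed

lemma kn_0: "\<forall>\<^sub>F n in sequentially. kn n 0 = k 0"
proof -
  have "j = k 0" if "j \<in> P 0" for j using P_cases[OF order_refl that] lo(2) by simp
  moreover have "k 0 \<in> P 0" using lo(1)[OF order_refl] lo(2) by simp
  ultimately have "P 0 = {k 0}" by blast
  then show ?thesis by (intro kn_at) auto
qed

lemma lo_less_passage:
  assumes c: "0 \<le> t1" "c \<le> k t1" and pos: "0 < passage k c"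
  shows "lo (passage k c) < c"
proof -
  note p = passage[OF k c]
  obtain d where d: "0 < d" "\<And>s. 0 \<le> s \<Longrightarrow> passage k c - d < s \<Longrightarrow> s < passage k c \<Longrightarrow> k s = lo (passage k c)"
    using P_near[OF p(1)] by blast
  define s where "s = max (passage k c / 2) (passage k c - d / 2)"
  have s: "0 \<le> s" "passage k c - d < s" "s < passage k c" using d(1) pos by (auto simp: s_def)
  then have "\<not> c \<le> k s" using p(2) by simp
  then show ?thesis using d(2)[OF s] by simp
qed

text \<open>On either side of the passage time there are points with a single admissible count,
  below \<open>c\<close> on the left and at least \<open>c\<close> on the right. Eventually
  \<open>kn n\<close> has these counts too and passes \<open>c\<close> in between. At time 0
  equality is required, because time changes fix 0.\<close>

lemma passage_tendsto:
  assumes c: "0 \<le> t1" "c \<le> k t1" and w: "0 < w"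
  shows "\<forall>\<^sub>F n in sequentially. \<bar>passage (kn n) c - passage k c\<bar> < w \<and>
    (\<exists>s0\<ge>0. c \<le> kn n s0) \<and> (passage k c = 0 \<longrightarrow> passage (kn n) c = 0)"
proof -
  let ?a = "passage k c"
  note p = passage[OF k c]
  obtain d where d: "0 < d" "\<And>s. ?a < s \<Longrightarrow> s < ?a + d \<Longrightarrow> P s = {k ?a}"
    "\<And>s. 0 \<le> s \<Longrightarrow> ?a - d < s \<Longrightarrow> s < ?a \<Longrightarrow> P s = {lo ?a}"
    using P_near[OF p(1)] by blast
  define q where "q = ?a + min d w / 2"
  have q: "?a < q" "q < ?a + d" "q < ?a + w" "0 \<le> q" using d(1) w p(1) by (auto simp: q_def)
  have "P q = {k ?a}" by (rule d(2)[OF q(1,2)])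
  then have evq: "\<forall>\<^sub>F n in sequentially. kn n q = k ?a" by (rule kn_at[OF q(4)])
  have ka: "c \<le> k ?a" using p(2)[OF p(1)] by simp
  show ?thesis
  proof (cases "?a = 0")
    case True
    then have c0: "c \<le> k 0" using ka by simp
    from kn kn_0 show ?thesis
    proof eventually_elim
      case (elim n)
      have "c \<le> kn n 0" using c0 elim(2) by simp
      note pn = passage[OF elim(1) order_refl this]
      have "passage (kn n) c = 0" using pn(1) pn(2)[of 0] \<open>c \<le> kn n 0\<close> by simp
      then show ?case using True w \<open>c \<le> kn n 0\<close> by auto
    qed
  next
    case False
    then have pos: "0 < ?a" using p(1) by simp
    define s where "s = max (?a / 2) (?a - min d w / 2)"
    have s: "0 \<le> s" "?a - d < s" "s < ?a" "?a - w < s" using d(1) w pos by (auto simp: s_def)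
    have "P s = {lo ?a}" by (rule d(3)[OF s(1-3)])
    then have "\<forall>\<^sub>F n in sequentially. kn n s = lo ?a" by (rule kn_at[OF s(1)])
    with kn evq show ?thesis
    proof eventually_elim
      case (elim n)
      have cq: "c \<le> kn n q" using elim(2) ka by simp
      note pn = passage[OF elim(1) q(4) cq]
      have "passage (kn n) c \<le> q" using pn(2)[OF q(4)] cq by simp
      moreover have "\<not> c \<le> kn n s" using lo_less_passage[OF c pos] elim(3) by simp
      then have "s < passage (kn n) c" using pn(2)[OF s(1)] by simp
      ultimately show ?case using s(4) q(3) cq q(4) False by auto
    qed
  qed
qed

text \<open>For two levels that \<open>k\<close> reaches in the same jump: \<open>kn n\<close> has
  only the values before and after the jump nearby, so on reaching \<open>c'\<close> it has the full
  value and thereby also \<open>c\<close>. Exchanging the levels gives equality.\<close>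

lemma passage_coincide:
  assumes c: "0 \<le> t1" "c \<le> k t1" "c' \<le> k t1" and eq: "passage k c = passage k c'"
  shows "\<forall>\<^sub>F n in sequentially. passage (kn n) c \<le> passage (kn n) c'"
proof -
  let ?a = "passage k c"
  note p = passage[OF k c(1,2)] and p' = passage[OF k c(1,3)]
  obtain d where d: "0 < d" "\<forall>\<^sub>F n in sequentially. \<forall>s\<ge>0. \<bar>s - ?a\<bar> < d \<longrightarrow> kn n s \<in> P ?a"
    using kn_near[OF p(1)] by blast
  from kn d(2) passage_tendsto[OF c(1,2) d(1)] passage_tendsto[OF c(1,3) d(1)]
  show ?thesis
  proof eventually_elim
    case (elim n)
    obtain s0 where s0: "0 \<le> s0" "c \<le> kn n s0" using elim(3) by blast
    obtain s0' where s0': "0 \<le> s0'" "c' \<le> kn n s0'" using elim(4) by blast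
    note pn = passage[OF elim(1) s0] and pn' = passage[OF elim(1) s0']
    let ?s = "passage (kn n) c'"
    show ?case
    proof (cases "?a = 0")
      case True
      then show ?thesis using elim(3,4) eq by simp
    next
      case False
      then have pos: "0 < ?a" "0 < passage k c'" using p(1) eq by auto
      have "\<bar>?s - ?a\<bar> < d" using elim(4) eq by simp
      then have "kn n ?s \<in> P ?a" using elim(2) pn'(1) by blast
      then have "kn n ?s = lo ?a \<or> kn n ?s = k ?a" by (rule P_cases[OF p(1)])
      moreover have "c' \<le> kn n ?s" using pn'(2)[OF pn'(1)] by simp
      moreover have "lo ?a < c'" using lo_less_passage[OF c(1,3) pos(2)] eq by simp
      ultimately have "kn n ?s = k ?a" by auto
      then have "c \<le> kn n ?s" using p(2)[OF p(1)] by simp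
      then show ?thesis using pn(2)[OF pn'(1)] by simp
    qed
  qed
qed

text \<open>If \<open>l\<close> carries the passage times of \<open>k\<close> to those of
  \<open>kn n\<close>, adjointness turns the order preservation of \<open>l\<close> into equality of
  the counts.\<close>

lemma ex_count_time_change:
  assumes T: "0 \<le> T" and r: "0 < r"
  shows "\<forall>\<^sub>F n in sequentially. \<exists>l. l \<in> time_changes {0..} \<and> log_distortion {0..} l \<le> ennreal r \<and>
    (\<forall>t. \<bar>l t - t\<bar> \<le> r) \<and> (\<forall>t. 0 \<le> t \<and> t \<le> T \<longrightarrow> kn n (l t) = k t)"
proof -
  \<comment> \<open>Just beyond \<open>T + r\<close> only the count \<open>k (T + r)\<close> is
    admissible. Eventually \<open>kn n\<close> stays at most there up to \<open>t1\<close>, so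
    finitely many levels suffice.\<close>
  obtain d where d: "0 < d" "\<And>s. T + r < s \<Longrightarrow> s < T + r + d \<Longrightarrow> P s = {k (T + r)}"
    using P_near[of "T + r"] T r by auto
  define t1 where "t1 = T + r + d / 2"
  have t1: "0 \<le> t1" "T + r < t1" using d(1) T r by (auto simp: t1_def)
  have Pt1: "P t1 = {k (T + r)}" by (rule d(2)) (use d(1) in \<open>auto simp: t1_def\<close>)
  define C where "C = k (T + r)"
  have Ck: "C \<le> k t1" unfolding C_def using T r t1 by (intro counting_path_mono[OF k]) auto
  define A where "A = passage k ` {..C}"
  have "finite A" by (simp add: A_def)
  then obtain w where w: "0 < w" "\<forall>q. (\<forall>p\<in>A. \<bar>q p - p\<bar> < w) \<longrightarrow> (\<exists>l. small_time_change r A q l)"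
    using ex_small_time_change r by blast
  have "\<forall>\<^sub>F n in sequentially. kn n t1 = C" unfolding C_def by (rule kn_at[OF t1(1) Pt1])
  moreover have "\<forall>\<^sub>F n in sequentially. \<forall>c\<in>{..C}. \<bar>passage (kn n) c - passage k c\<bar> < w \<and>
      (\<exists>s0\<ge>0. c \<le> kn n s0) \<and> (passage k c = 0 \<longrightarrow> passage (kn n) c = 0)"
    using Ck by (intro eventually_ball_finite ballI passage_tendsto[OF t1(1) _ w(1)]) auto
  moreover have "\<forall>\<^sub>F n in sequentially. \<forall>c\<in>{..C}. \<forall>c'\<in>{..C}. passage k c = passage k c' \<longrightarrow>
      passage (kn n) c \<le> passage (kn n) c'"
  proof (intro eventually_ball_finite ballI)
    fix c c' assume c: "c \<in> {..C}" "c' \<in> {..C}"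
    show "\<forall>\<^sub>F n in sequentially. passage k c = passage k c' \<longrightarrow> passage (kn n) c \<le> passage (kn n) c'"
    proof (cases "passage k c = passage k c'")
      case True
      have "c \<le> k t1" "c' \<le> k t1" using c Ck by auto
      from passage_coincide[OF t1(1) this True] show ?thesis by eventually_elim simp
    qed simp
  qed simp_all
  ultimately show ?thesis using kn
  proof eventually_elim
    case (elim n)
    have coin: "passage (kn n) c = passage (kn n) c'" if "c \<le> C" "c' \<le> C" "passage k c = passage k c'" for c c'
      using elim(3) that by (intro antisym) auto
    have pn: "\<And>s. 0 \<le> s \<Longrightarrow> c \<le> kn n s \<longleftrightarrow> passage (kn n) c \<le> s" if "c \<le> C" for c
      using elim(2) that passage(2)[OF elim(4)] by (metis atMost_iff)
    have pk: "\<And>s. 0 \<le> s \<Longrightarrow> c \<le> k s \<longleftrightarrow> passage k c \<le> s" if "c \<le> C" for c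
      using passage(2)[OF k t1(1)] order_trans[OF that Ck] by blast
    \<comment> \<open>Several levels may share one passage time of \<open>k\<close>; by
      \<open>coin\<close> the chosen one does not matter.\<close>
    define q where "q p = passage (kn n) (SOME c. c \<le> C \<and> passage k c = p)" for p
    have q: "q (passage k c) = passage (kn n) c" if "c \<le> C" for c
    proof -
      have "(SOME c'. c' \<le> C \<and> passage k c' = passage k c) \<le> C \<and>
          passage k (SOME c'. c' \<le> C \<and> passage k c' = passage k c) = passage k c"
        by (rule someI[of "\<lambda>c'. c' \<le> C \<and> passage k c' = passage k c" c]) (use that in simp)
      then show ?thesis unfolding q_def using that by (intro coin) auto
    qed
    have "\<forall>p\<in>A. \<bar>q p - p\<bar> < w" using elim(2) q by (auto simp: A_def)
    then have "\<exists>l. small_time_change r A q l" using w(2) by blast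
    then obtain l where "small_time_change r A q l" ..
    then have l: "strict_mono l" "continuous_on UNIV l" "\<And>p. p \<in> A \<Longrightarrow> l p = q p"
      "\<And>t. \<bar>l t - t\<bar> \<le> r" "\<And>s t. s \<noteq> t \<Longrightarrow> \<bar>ln ((l t - l s) / (t - s))\<bar> \<le> r"
      unfolding small_time_change_def by blast+
    have lp: "l (passage k c) = passage (kn n) c" if "c \<le> C" for c
      using l(3)[of "passage k c"] q[OF that] that by (simp add: A_def)
    \<comment> \<open>Both paths pass level 0 at time 0, so \<open>l\<close> fixes 0.\<close>
    have p0: "passage k 0 = 0"
      using passage[OF k order_refl, of 0] by (metis le0 antisym order_refl)
    have l0: "l 0 = 0" using lp[of 0] p0 elim(2) by auto
    have tc: "l \<in> time_changes {0..}"
    proof (rule time_changesI[OF l(1,2)])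
      show "l ` {0..} \<subseteq> {0..}" using strict_mono_less_eq[OF l(1), of 0] l0 by (simp add: image_subset_iff)
      show "\<exists>a\<in>{0..}. \<exists>b\<in>{0..}. l a \<le> y \<and> y \<le> l b" if "y \<in> {0..}" for y
        by (rule bexI[of _ 0], rule bexI[of _ "y + r"]) (use that l0 l(4)[of "y + r"] r in auto)
    qed (simp add: is_interval_ci)
    have ld: "log_distortion {0..} l \<le> ennreal r"
      by (rule log_distortion_least) (intro ennreal_leI l(5))
    have "kn n (l t) = k t" if t: "0 \<le> t" "t \<le> T" for t
    proof -
      have lt: "0 \<le> l t" using time_changes_mem[OF tc, of t] t by simp
      have iff: "c \<le> kn n (l t) \<longleftrightarrow> c \<le> k t" if c: "c \<le> C" for c
        using pn[OF c lt] pk[OF c t(1)] lp[OF c] strict_mono_less_eq[OF l(1), of "passage k c" t] by simp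
      have "k t \<le> C" unfolding C_def using t r by (intro counting_path_mono[OF k]) auto
      moreover have "kn n (l t) \<le> C"
      proof -
        have "l t \<le> t1" using l(4)[of t] t t1 by linarith
        then have "kn n (l t) \<le> kn n t1" by (rule counting_path_mono[OF elim(4) lt])
        then show ?thesis using elim(1) by simp
      qed
      ultimately show ?thesis using iff[of "k t"] iff[of "kn n (l t)"] by simp
    qed
    then show ?case using tc ld l(4) by blast
  qed
qed

text \<open>The limit is exactly \<open>G\<close> of its count and \<open>x n\<close> is nearly
  \<open>G\<close> of its own count, so a time change that matches counts makes the paths close. The
  target space enters only through \<open>G\<close>.\<close>

lemma J1_dist_tendsto:
  fixes x :: "nat \<Rightarrow> real \<Rightarrow> 'a::metric_space"
  assumes close: "\<And>T e. 0 < e \<Longrightarrow> \<forall>\<^sub>F n in sequentially. \<forall>t. 0 \<le> t \<and> t \<le> T \<longrightarrow> dist (x n t) (G (kn n t)) < e"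
    and y: "\<And>t. 0 \<le> t \<Longrightarrow> y t = G (k t)"
  shows "(\<lambda>n. J1_dist (x n) y) \<longlonglongrightarrow> 0"
proof (rule tendstoI)
  fix e :: real assume e: "0 < e"
  \<comment> \<open>Beyond \<open>A\<close> the exponential weight leaves at most
    \<open>e / 4\<close>.\<close>
  define A where "A = max 0 (- ln (e / 4))"
  have A: "0 \<le> A" "exp (- A) \<le> e / 4"
  proof -
    have "exp (- A) \<le> exp (ln (e / 4))" by (subst exp_le_cancel_iff) (auto simp: A_def)
    then show "exp (- A) \<le> e / 4" using e by simp
  qed (simp add: A_def)
  define C where "C = k (A + 1)"
  \<comment> \<open>The levels within \<open>r\<close> of the \<open>C + 1\<close> passage times
    have total length at most \<open>e / 4\<close>; \<open>r \<le> 1\<close> keeps every point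
    within \<open>r\<close> of a level \<open>u \<le> A\<close> below \<open>A + 1\<close>.\<close>
  define r where "r = min 1 (e / (8 * real (Suc C)))"
  have r: "0 < r" "r \<le> 1" "real (Suc C) * (2 * r) \<le> e / 4" "r \<le> e / 2"
  proof -
    show "0 < r" "r \<le> 1" using e by (auto simp: r_def)
    have "r \<le> e / (8 * real (Suc C))" by (simp add: r_def)
    then have le: "r * (8 * real (Suc C)) \<le> e" by (subst (asm) pos_le_divide_eq) auto
    then show "real (Suc C) * (2 * r) \<le> e / 4" by (simp add: algebra_simps)
    have "r * 8 \<le> r * (8 * real (Suc C))" using \<open>0 < r\<close> by simp
    then show "r \<le> e / 2" using le \<open>0 < r\<close> by linarith
  qed
  have e4: "0 < e / 4" using e by simp
  have A1: "0 \<le> A + 1" using A(1) by simp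
  from ex_count_time_change[OF A1 r(1)] close[OF e4, of "A"]
  show "\<forall>\<^sub>F n in sequentially. dist (J1_dist (x n) y) 0 < e"
  proof eventually_elim
    case (elim n)
    then obtain l where l: "l \<in> time_changes {0..}" "log_distortion {0..} l \<le> ennreal r"
      "\<And>t. \<bar>l t - t\<bar> \<le> r" "\<And>t. 0 \<le> t \<Longrightarrow> t \<le> A + 1 \<Longrightarrow> kn n (l t) = k t" by blast
    have "J1_int (x n) y l \<le> ennreal (e / 4 + real (Suc C) * (2 * r) + exp (- A))"
    proof (rule J1_int_le[where a = "passage k"])
      fix u assume u: "0 \<le> u" "u \<le> A" and far: "\<And>i. i \<le> C \<Longrightarrow> r < \<bar>u - passage k i\<bar>"
      have const: "k s = k u" if s: "0 \<le> s" "\<bar>s - u\<bar> \<le> r" for s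
      proof -
        have iff: "i \<le> k s \<longleftrightarrow> i \<le> k u" if i: "i \<le> C" for i
        proof -
          have "i \<le> k (A + 1)" using i by (simp add: C_def)
          note p = passage(2)[OF k A1 this]
          show ?thesis using p[OF s(1)] p[OF u(1)] far[OF i] s(2) by linarith
        qed
        have "k s \<le> C" "k u \<le> C" unfolding C_def
          using s u r(2) by (auto intro!: counting_path_mono[OF k])
        then show ?thesis using iff[of "k s"] iff[of "k u"] by simp
      qed
      show "J1_gap (x n) y l u \<le> ennreal (e / 4)"
        unfolding J1_gap_def
      proof (rule SUP_least)
        fix t :: real assume "t \<in> {0..}"
        then have t: "0 \<le> t" by simp
        have lt: "0 \<le> l t" using time_changes_mem[OF l(1), of t] t by simp
        have "kn n (min (l t) u) = k (min t u)"
          by (rule counts_min_eq[of l r "A + 1" "kn n" k u t, OF l(1,3,4) u(1) _ const t]) (use u r in auto)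
        moreover have "dist (x n (min (l t) u)) (G (kn n (min (l t) u))) < e / 4"
          using elim(2) u lt by simp
        ultimately have "dist (x n (min (l t) u)) (y (min t u)) < e / 4" using y[of "min t u"] t u by simp
        then show "ennreal (min 1 (dist (x n (min (l t) u)) (y (min t u)))) \<le> ennreal (e / 4)"
          by (intro ennreal_leI) simp
      qed
    qed (use e4 r in auto)
    also have "\<dots> \<le> ennreal (3 * e / 4)" using A(2) r(3) by (intro ennreal_leI) simp
    finally have "J1_int (x n) y l \<le> ennreal (3 * e / 4)" .
    moreover have "log_distortion {0..} l \<le> ennreal (3 * e / 4)"
      using l(2) by (rule order_trans) (use r(4) e in \<open>intro ennreal_leI, simp\<close>)
    ultimately have "(INF l\<in>time_changes {0..}. max (log_distortion {0..} l) (J1_int (x n) y l)) \<le> ennreal (3 * e / 4)"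
      by (intro INF_lower2[OF l(1)]) simp
    then have "J1_dist (x n) y \<le> 3 * e / 4" unfolding J1_dist_alt using e by (intro enn2real_leI) auto
    moreover have "0 \<le> J1_dist (x n) y" by (simp add: J1_dist_def)
    ultimately show ?case using e by simp
  qed
qed

end

section \<open>Grid functions and the regression model\<close>

text \<open>For \<open>z > 0\<close> the functional is multiplied by \<open>z\<close>. For
  \<open>z = 0\<close> the penalty is infinite and \<open>g0\<close> has finite value, so minimizers
  have \<open>N g = 0\<close> and the second clause compares their \<open>S\<close>.\<close>

lemma argmin_penalty:
  fixes N :: "'a \<Rightarrow> nat" and S :: "'a \<Rightarrow> real"
  assumes z: "0 \<le> z" and S: "\<And>g. g \<in> X \<Longrightarrow> 0 \<le> S g" and g0: "g0 \<in> X" "N g0 = 0"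
    and F: "\<And>g. g \<in> X \<Longrightarrow> F g = 1 / ennreal z * of_nat (N g) + ennreal (S g)"
  shows "argmin F X = {g \<in> X. \<forall>h\<in>X. real (N g) + z * S g \<le> real (N h) + z * S h \<and> (N h \<le> N g \<longrightarrow> S g \<le> S h)}"
proof -
  have "argmin F X = {g \<in> X. \<forall>h\<in>X. F g \<le> F h}"
    by (auto simp: argmin_def is_arg_min_def not_less)
  also have "\<dots> = {g \<in> X. \<forall>h\<in>X. real (N g) + z * S g \<le> real (N h) + z * S h \<and> (N h \<le> N g \<longrightarrow> S g \<le> S h)}"
  proof (cases "z = 0")
    case True
    have top: "1 / ennreal z = \<top>" using True by (simp add: divide_ennreal_def)
    have F0: "F g = (if N g = 0 then ennreal (S g) else \<top>)" if "g \<in> X" for g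
      using F[OF that] top by (simp add: ennreal_top_mult)
    have "(\<forall>h\<in>X. F g \<le> F h) \<longleftrightarrow> (\<forall>h\<in>X. real (N g) + z * S g \<le> real (N h) + z * S h \<and> (N h \<le> N g \<longrightarrow> S g \<le> S h))"
      if g: "g \<in> X" for g
    proof
      assume *: "\<forall>h\<in>X. F g \<le> F h"
      have "F g \<le> ennreal (S g0)" using bspec[OF * g0(1)] F0[OF g0(1)] g0(2) by simp
      then have "N g = 0" using F0[OF g] by (auto split: if_splits simp: top_unique)
      moreover have "S g \<le> S h" if h: "h \<in> X" "N h = 0" for h
        using bspec[OF * h(1)] F0[OF g] F0[OF h(1)] h(2) \<open>N g = 0\<close> S[OF h(1)] by simp
      ultimately show "\<forall>h\<in>X. real (N g) + z * S g \<le> real (N h) + z * S h \<and> (N h \<le> N g \<longrightarrow> S g \<le> S h)"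
        using True by simp
    next
      assume *: "\<forall>h\<in>X. real (N g) + z * S g \<le> real (N h) + z * S h \<and> (N h \<le> N g \<longrightarrow> S g \<le> S h)"
      have "N g = 0" using bspec[OF * g0(1)] g0(2) True by simp
      then show "\<forall>h\<in>X. F g \<le> F h"
        using * F0 g by (auto simp: ennreal_leI)
    qed
    then show ?thesis by blast
  next
    case False
    then have z0: "0 < z" using z by simp
    have F1: "F g = ennreal ((real (N g) + z * S g) / z)" if "g \<in> X" for g
    proof -
      have "1 / ennreal z = ennreal (1 / z)" using divide_ennreal[of 1 z] z0 by simp
      then have "F g = ennreal (1 / z) * ennreal (real (N g)) + ennreal (S g)"
        using F[OF that] by (simp add: ennreal_of_nat_eq_real_of_nat)
      also have "\<dots> = ennreal (1 / z * real (N g) + S g)"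
        using z0 S[OF that] by (simp add: ennreal_mult[symmetric] ennreal_plus[symmetric] del: ennreal_plus)
      also have "1 / z * real (N g) + S g = (real (N g) + z * S g) / z" using z0 by (simp add: add_divide_distrib)
      finally show ?thesis .
    qed
    have iff: "F g \<le> F h \<longleftrightarrow> real (N g) + z * S g \<le> real (N h) + z * S h" if "g \<in> X" "h \<in> X" for g h
    proof -
      have "0 \<le> (real (N h) + z * S h) / z" using S[OF that(2)] z0 by simp
      then have "F g \<le> F h \<longleftrightarrow> (real (N g) + z * S g) / z \<le> (real (N h) + z * S h) / z"
        using F1[OF that(1)] F1[OF that(2)] by (simp only: ennreal_le_iff)
      also have "\<dots> \<longleftrightarrow> real (N g) + z * S g \<le> real (N h) + z * S h"
        by (subst divide_le_cancel) (use z0 in auto)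
      finally show ?thesis .
    qed
    have imp: "S g \<le> S h" if "real (N g) + z * S g \<le> real (N h) + z * S h" "N h \<le> N g" for g h
    proof -
      have "z * S g \<le> z * S h" using that by simp
      then show ?thesis using z0 by simp
    qed
    show ?thesis using iff imp by blast
  qed
  finally show ?thesis .
qed

text \<open>As \<open>z\<close> is finite, the penalty \<open>1 / z\<close> is never 0; functions
  outside \<open>step_functions\<close> thus have infinite value and cannot minimize.\<close>

lemma argmin_H_limit:
  assumes z: "0 \<le> z"
  shows "argmin (\<lambda>g. H_limit (1 / ennreal z) g f) UNIV = opt_set step_functions f z"
proof -
  let ?F = "\<lambda>g. H_limit (1 / ennreal z) g f"
  have g0: "0 \<in> step_functions" "njumps 0 = 0" by (simp_all add: step_functions_def span_zero jump_set_zero)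
  have nz: "1 / ennreal z \<noteq> 0"
  proof (cases "z = 0")
    case True
    then show ?thesis by (simp add: divide_ennreal_def)
  next
    case False
    then show ?thesis using divide_ennreal[of 1 z] z by simp
  qed
  have F: "?F g = 1 / ennreal z * of_nat (njumps g) + ennreal (sq_err f g)" if "g \<in> step_functions" for g
    using that nz by (simp add: H_limit_def)
  have inf: "?F g = \<infinity>" if "g \<notin> step_functions" for g using that nz by (simp add: H_limit_def)
  have F0: "?F 0 < \<infinity>" using F[OF g0(1)] g0(2) by simp
  have "argmin ?F UNIV = argmin ?F step_functions"
  proof (rule set_eqI)
    fix g
    show "g \<in> argmin ?F UNIV \<longleftrightarrow> g \<in> argmin ?F step_functions"
    proof
      assume g: "g \<in> argmin ?F UNIV"
      then have "\<not> ?F 0 < ?F g" by (simp add: argmin_def is_arg_min_def)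
      then have "g \<in> step_functions" using inf[of g] F0 by (cases "g \<in> step_functions") simp_all
      then show "g \<in> argmin ?F step_functions" using g by (auto simp: argmin_def is_arg_min_def)
    next
      assume g: "g \<in> argmin ?F step_functions"
      have "\<not> ?F h < ?F g" for h
        using g inf[of h] by (cases "h \<in> step_functions") (auto simp: argmin_def is_arg_min_def)
      then show "g \<in> argmin ?F UNIV" by (simp add: argmin_def is_arg_min_def)
    qed
  qed
  also have "\<dots> = opt_set step_functions f z"
    unfolding opt_set_def by (rule argmin_penalty[where N = njumps and S = "\<lambda>g. sq_err f g", OF z _ g0 F]) simp_all
  finally show ?thesis .
qed

abbreviation grid_pt :: "nat \<Rightarrow> nat \<Rightarrow> real" where
  "grid_pt n i \<equiv> real i / real n"

lemma partition_grid: "1 \<le> n \<Longrightarrow> partition_pts (n - 1) (grid_pt n)"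
  by (auto simp: partition_pts_def divide_right_mono)

section \<open>Vectors as step functions on the grid\<close>

lemma step_embed_eq_comb:
  assumes "1 \<le> n"
  shows "step_embed n u = step_comb (n - 1) (\<lambda>i. u (Suc i)) (grid_pt n)"
proof -
  have "step_embed n u = (\<Sum>i\<in>{Suc 0..Suc (n - 1)}. u i *\<^sub>R L2_indicator ((real i - 1) / real n) (real i / real n))"
    using assms by (simp add: step_embed_def)
  also have "\<dots> = (\<Sum>i\<in>{0..n - 1}. u (Suc i) *\<^sub>R L2_indicator ((real (Suc i) - 1) / real n) (real (Suc i) / real n))"
    by (rule sum.shift_bounds_cl_Suc_ivl)
  also have "\<dots> = step_comb (n - 1) (\<lambda>i. u (Suc i)) (grid_pt n)"
    unfolding step_comb_def atLeast0AtMost by (intro sum.cong) simp_all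
  finally show ?thesis .
qed

lemma cadlag_fun_step_embed:
  assumes "1 \<le> n" "i < n" "grid_pt n i \<le> x" "x < grid_pt n (Suc i)"
  shows "cadlag_fun (step_embed n u) x = u (Suc i)"
proof -
  note P = partition_grid[OF assms(1)]
  have i: "i \<le> n - 1" using assms(2) by simp
  have "0 \<le> grid_pt n i" by simp
  moreover have "grid_pt n (Suc i) \<le> 1" using assms(2) by simp
  ultimately have x: "x \<in> {0..1}" using assms(3,4) by (metis atLeastAtMost_iff less_imp_le order_trans)
  show ?thesis
    using cadlag_fun_step_comb[OF P x, of "\<lambda>i. u (Suc i)"] piece_eqI[OF P i assms(3,4)]
    by (simp add: step_embed_eq_comb[OF assms(1)])
qed

lemma jump_set_step_embed:
  assumes n: "1 \<le> n"
  shows "jump_set (step_embed n u) = grid_pt n ` jumps n u"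
proof -
  note P = partition_grid[OF n]
  have n0: "0 < real n" using n by simp
  have pc: "piecewise_const (grid_pt n ` {1..n - 1} \<inter> {0<..<1}) (cadlag_fun (step_embed n u))"
    unfolding step_embed_eq_comb[OF n]
    by (rule piecewise_const_cadlag_fun[OF piecewise_const_piece L2_represents_step_comb[OF P]])
  have iff: "grid_pt n i \<in> jump_set (step_embed n u) \<longleftrightarrow> u i \<noteq> u (Suc i)" if i: "1 \<le> i" "i < n" for i
  proof -
    obtain j where j: "i = Suc j" using i(1) by (cases i) auto
    have t: "grid_pt n i \<in> {0<..<1}" using i n0 by simp
    have "\<forall>\<^sub>F x in at_left (grid_pt n i). cadlag_fun (step_embed n u) x = u i"
    proof (rule eventually_at_leftI[of "grid_pt n j"])
      show "grid_pt n j < grid_pt n i" using n0 by (simp add: j divide_strict_right_mono)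
      fix x assume x: "x \<in> {grid_pt n j<..<grid_pt n i}"
      then show "cadlag_fun (step_embed n u) x = u i"
        using cadlag_fun_step_embed[OF n, of j x u] i j by simp
    qed
    moreover have "cadlag_fun (step_embed n u) (grid_pt n i) = u (Suc i)"
      using n0 by (intro cadlag_fun_step_embed[OF n i(2)]) (auto simp: divide_strict_right_mono)
    ultimately show ?thesis using jump_set_iff[OF pc t] by simp
  qed
  show ?thesis
  proof
    show "jump_set (step_embed n u) \<subseteq> grid_pt n ` jumps n u"
    proof
      fix t assume t: "t \<in> jump_set (step_embed n u)"
      then obtain i where i: "i \<in> {1..n - 1}" "t = grid_pt n i" using jump_set_subset[OF pc] by auto
      then have "1 \<le> i" "i < n" using n by auto
      then have "i \<in> jumps n u" using iff[of i] t i(2) by (simp add: jumps_def)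
      then show "t \<in> grid_pt n ` jumps n u" using i(2) by blast
    qed
    show "grid_pt n ` jumps n u \<subseteq> jump_set (step_embed n u)"
      using iff by (auto simp: jumps_def)
  qed
qed

lemma njumps_step_embed: "1 \<le> n \<Longrightarrow> njumps (step_embed n u) = card (jumps n u)"
  unfolding jump_set_step_embed by (intro card_image inj_onI) auto

lemma step_embed_grid_steps:
  assumes "1 \<le> n"
  shows "step_embed n u \<in> grid_steps n"
proof -
  have "step_embed n u \<in> step_functions"
    unfolding step_embed_eq_comb[OF assms] by (rule step_comb_step[OF partition_grid[OF assms]])
  moreover have "jump_set (step_embed n u) \<subseteq> grid n"
    unfolding jump_set_step_embed[OF assms] grid_def by (auto simp: jumps_def)
  ultimately show ?thesis by (simp add: grid_steps_def)
qed

text \<open>A function that jumps only at grid points is constant on each grid cell; its values at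
  the left ends form the vector.\<close>

lemma ex_step_embed:
  assumes n: "1 \<le> n" and h: "h \<in> grid_steps n"
  shows "\<exists>v\<in>{1..n} \<rightarrow>\<^sub>E UNIV. h = step_embed n v"
proof -
  define v where "v = (\<lambda>i\<in>{1..n}. cadlag_fun h (grid_pt n (i - 1)))"
  have hs: "h \<in> step_functions" and hj: "jump_set h \<subseteq> grid n" using h by (auto simp: grid_steps_def)
  note pc = piecewise_const_jump_set[OF hs] and P = partition_grid[OF n]
  have n0: "0 < real n" using n by simp
  have eq: "cadlag_fun h x = v (Suc (piece (n - 1) (grid_pt n) x))" if "x \<in> {0..<1}" for x
  proof -
    have x: "0 \<le> x" "x < 1" using that by auto
    define i where "i = piece (n - 1) (grid_pt n) x"
    have i: "i \<le> n - 1" "grid_pt n i \<le> x" "x < grid_pt n (Suc i)"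
      using piece_mem[OF P x] by (simp_all add: i_def)
    have "cadlag_fun h (grid_pt n i) = cadlag_fun h x"
    proof (rule piecewise_constD[OF pc])
      show "jump_set h \<inter> {grid_pt n i<..x} = {}"
      proof (rule ccontr)
        assume "jump_set h \<inter> {grid_pt n i<..x} \<noteq> {}"
        then obtain b where b: "b \<in> jump_set h" "grid_pt n i < b" "b \<le> x" by auto
        then have "b \<in> grid n" using hj by blast
        then obtain j where "b = grid_pt n j" unfolding grid_def by blast
        with b have j: "grid_pt n i < grid_pt n j" "grid_pt n j \<le> x" by simp_all
        have "grid_pt n j < grid_pt n (Suc i)" using j(2) i(3) by (rule le_less_trans)
        then have "j < Suc i" "i < j" using j(1) n0 by (simp_all only: divide_less_cancel of_nat_less_iff)
        then show False by simp
      qed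
    qed (use x i in auto)
    moreover have "Suc i \<in> {1..n}" using i(1) n by auto
    then have "v (Suc i) = cadlag_fun h (grid_pt n i)" by (simp add: v_def)
    ultimately show ?thesis unfolding i_def[symmetric] by simp
  qed
  have "L2_represents (\<lambda>x. v (Suc (piece (n - 1) (grid_pt n) x))) h"
    using cadlag_rep_represents[OF hs] by (subst (asm) L2_represents_cong[OF eq])
  then have "h = step_comb (n - 1) (\<lambda>i. v (Suc i)) (grid_pt n)"
    using L2_represents_step_comb[OF P, of "\<lambda>i. v (Suc i)"] by (rule L2_represents_unique)
  then have "h = step_embed n v" by (simp only: step_embed_eq_comb[OF n])
  moreover have "v \<in> {1..n} \<rightarrow>\<^sub>E UNIV" by (simp add: v_def)
  ultimately show ?thesis by blast
qed

lemma step_embed_diff: "step_embed n u - step_embed n v = step_embed n (\<lambda>i. u i - v i)"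
  by (simp add: step_embed_def sum_subtractf[symmetric] scaleR_diff_left)

lemma step_embed_add: "step_embed n (\<lambda>i. u i + v i) = step_embed n u + step_embed n v"
  by (simp add: step_embed_def sum.distrib[symmetric] scaleR_add_left)

lemma inner_step_embed_indicator:
  assumes n: "1 \<le> n" and ij: "i \<le> j" "j \<le> n"
  shows "inner (step_embed n u) (L2_indicator (grid_pt n i) (grid_pt n j)) = (\<Sum>k=Suc i..j. u k) / real n"
proof -
  have n0: "0 < real n" using n by simp
  have c: "inner (L2_indicator ((real k - 1) / real n) (grid_pt n k)) (L2_indicator (grid_pt n i) (grid_pt n j)) =
      (if k \<in> {Suc i..j} then 1 / real n else 0)" if k: "k \<in> {1..n}" for k
  proof -
    have e: "inner (L2_indicator ((real k - 1) / real n) (grid_pt n k)) (L2_indicator (grid_pt n i) (grid_pt n j)) =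
        max 0 (min (grid_pt n k) (grid_pt n j) - max ((real k - 1) / real n) (grid_pt n i))"
      using k ij n0 by (intro L2_inner_indicator) auto
    consider "k \<le> i" | "i < k" "k \<le> j" | "j < k" by linarith
    then show ?thesis
    proof cases
      case 1
      then have "grid_pt n k \<le> grid_pt n i" using n0 by (simp add: divide_right_mono)
      then show ?thesis using e 1 by simp
    next
      case 2
      then have "grid_pt n k \<le> grid_pt n j" using n0 by (simp add: divide_right_mono)
      moreover have "grid_pt n i \<le> (real k - 1) / real n" using n0 2 by (intro divide_right_mono) auto
      ultimately show ?thesis using e 2 n0 by (simp add: diff_divide_distrib)
    next
      case 3
      then have "grid_pt n j \<le> (real k - 1) / real n" using n0 by (intro divide_right_mono) auto
      then show ?thesis using e 3 by simp
    qed
  qed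
  have "inner (step_embed n u) (L2_indicator (grid_pt n i) (grid_pt n j)) =
      (\<Sum>k\<in>{1..n}. if k \<in> {Suc i..j} then u k * (1 / real n) else 0)"
    unfolding step_embed_def inner_sum_left using c by (intro sum.cong) auto
  also have "\<dots> = (\<Sum>k\<in>{1..n} \<inter> {Suc i..j}. u k * (1 / real n))" by (rule sum.inter_restrict[symmetric]) simp
  also have "{1..n} \<inter> {Suc i..j} = {Suc i..j}" using ij by auto
  finally show ?thesis by (simp add: sum_divide_distrib)
qed

lemma norm_step_embed:
  assumes "1 \<le> n"
  shows "(norm (step_embed n u))\<^sup>2 = 1 / real n * (\<Sum>i=1..n. (u i)\<^sup>2)"
proof -
  have "(norm (step_embed n u))\<^sup>2 = (\<Sum>i=1..n. u i * inner (step_embed n u) (L2_indicator (grid_pt n (i - 1)) (grid_pt n i)))"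
    unfolding power2_norm_eq_inner
    by (subst (2) step_embed_def) (auto simp: inner_sum_right of_nat_diff intro!: sum.cong)
  also have "\<dots> = (\<Sum>i=1..n. u i * (u i / real n))"
  proof (intro sum.cong refl)
    fix i assume i: "i \<in> {1..n}"
    then have "{Suc (i - 1)..i} = {i}" by auto
    then show "u i * inner (step_embed n u) (L2_indicator (grid_pt n (i - 1)) (grid_pt n i)) = u i * (u i / real n)"
      using inner_step_embed_indicator[OF assms, of "i - 1" i u] i by simp
  qed
  also have "\<dots> = 1 / real n * (\<Sum>i=1..n. (u i)\<^sup>2)"
    by (simp add: sum_distrib_left power2_eq_square)
  finally show ?thesis .
qed

text \<open>\<open>norm_step_embed\<close> turns the data term into a squared distance in
  \<open>L2\<close>, and by \<open>ex_step_embed\<close> every grid step function is the image of a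
  competing vector.\<close>

lemma argmin_H_emp:
  assumes n: "1 \<le> n" and z: "0 \<le> z"
  shows "step_embed n ` argmin (\<lambda>u. H_emp (1 / ennreal z) n u y) ({1..n} \<rightarrow>\<^sub>E UNIV)
    \<subseteq> opt_set (grid_steps n) (step_embed n y) z"
proof -
  let ?X = "{1..n} \<rightarrow>\<^sub>E (UNIV :: real set)"
  let ?u0 = "\<lambda>i\<in>{1..n}. 0 :: real"
  have S: "1 / real n * (\<Sum>i=1..n. (u i - y i)\<^sup>2) = sq_err (step_embed n y) (step_embed n u)" for u
    using norm_step_embed[OF n, of "\<lambda>i. y i - u i"] by (simp add: step_embed_diff power2_commute)
  let ?P = "\<lambda>g h. real (njumps g) + z * sq_err (step_embed n y) g
        \<le> real (njumps h) + z * sq_err (step_embed n y) h \<and>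
      (njumps h \<le> njumps g \<longrightarrow> sq_err (step_embed n y) g \<le> sq_err (step_embed n y) h)"
  have eq: "argmin (\<lambda>u. H_emp (1 / ennreal z) n u y) ?X =
      {g \<in> ?X. \<forall>h\<in>?X. ?P (step_embed n g) (step_embed n h)}"
  proof (rule argmin_penalty[where N = "\<lambda>u. njumps (step_embed n u)" and
        S = "\<lambda>u. sq_err (step_embed n y) (step_embed n u)" and ?g0.0 = ?u0, OF z])
    show "?u0 \<in> ?X" by simp
    show "njumps (step_embed n ?u0) = 0" unfolding njumps_step_embed[OF n] by (auto simp: jumps_def)
    show "H_emp (1 / ennreal z) n g y = 1 / ennreal z * of_nat (njumps (step_embed n g)) +
        ennreal (sq_err (step_embed n y) (step_embed n g))" for g
      unfolding H_emp_def S njumps_step_embed[OF n] ..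
  qed simp
  show ?thesis
  proof (rule image_subsetI)
    fix u assume "u \<in> argmin (\<lambda>u. H_emp (1 / ennreal z) n u y) ?X"
    then have u: "\<forall>h\<in>?X. ?P (step_embed n u) (step_embed n h)" unfolding eq by blast
    have "?P (step_embed n u) h" if h: "h \<in> grid_steps n" for h
    proof -
      obtain v where "v \<in> ?X" "h = step_embed n v" using ex_step_embed[OF n h] by blast
      then show ?thesis using u by blast
    qed
    then show "step_embed n u \<in> opt_set (grid_steps n) (step_embed n y) z"
      unfolding opt_set_def using step_embed_grid_steps[OF n] by blast
  qed
qed

section \<open>The regression data as \<open>f\<close> plus noise\<close>

lemma L2_integral_eq_inner: "L2_integral f a b = inner f (L2_indicator a b)"
  by transfer (simp add: set_lebesgue_integral_def mult.commute)

lemma opt_set_cong: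
  assumes "\<And>g. g \<in> X \<Longrightarrow> sq_err \<phi> g = sq_err \<psi> g + K"
  shows "opt_set X \<phi> z = opt_set X \<psi> z"
proof -
  have "real (njumps g) + z * sq_err \<phi> g \<le> real (njumps h) + z * sq_err \<phi> h \<longleftrightarrow>
      real (njumps g) + z * sq_err \<psi> g \<le> real (njumps h) + z * sq_err \<psi> h"
    "sq_err \<phi> g \<le> sq_err \<phi> h \<longleftrightarrow> sq_err \<psi> g \<le> sq_err \<psi> h"
    if "g \<in> X" "h \<in> X" for g h
    unfolding assms[OF that(1)] assms[OF that(2)] distrib_left[of z] by linarith+
  then show ?thesis unfolding opt_set_def by blast
qed

text \<open>
  Local averages of \<open>f\<close> and \<open>f\<close> itself have the same inner products with grid functions, so that
  the discretization of \<open>f\<close> does not affect the minimizers.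
\<close>

lemma opt_set_regression_data:
  assumes n: "1 \<le> n"
  shows "opt_set (grid_steps n) (step_embed n (regression_data f \<xi> n \<omega>)) z =
    opt_set (grid_steps n) (f + step_embed n (\<lambda>i. \<xi> n i \<omega>)) z"
proof -
  let ?e = "step_embed n (\<lambda>i. \<xi> n i \<omega>)" and ?p = "step_proj (n - 1) f (grid_pt n)"
  note P = partition_grid[OF n]
  have n0: "real n \<noteq> 0" using n by simp
  have "step_embed n (\<lambda>i. real n * L2_integral f ((real i - 1) / real n) (real i / real n)) = ?p"
    unfolding step_embed_eq_comb[OF n] step_proj_def step_comb_def L2_integral_eq_inner L2_mean_def
    using n0 by (intro sum.cong) (simp_all add: diff_divide_distrib[symmetric])
  then have d: "step_embed n (regression_data f \<xi> n \<omega>) = ?p + ?e"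
    using step_embed_add[of n "\<lambda>i. real n * L2_integral f ((real i - 1) / real n) (real i / real n)" "\<lambda>i. \<xi> n i \<omega>"]
    unfolding regression_data_def[abs_def] by simp
  show ?thesis
    unfolding d
  proof (rule opt_set_cong)
    fix g assume "g \<in> grid_steps n"
    then obtain v where "g = step_embed n v" using ex_step_embed[OF n] by blast
    then have g: "g = step_comb (n - 1) (\<lambda>i. v (Suc i)) (grid_pt n)" by (simp only: step_embed_eq_comb[OF n])
    have i: "inner ?p g = inner f g" unfolding g by (rule inner_step_proj[OF P])
    have exp: "sq_err \<phi> g = (norm \<phi>)\<^sup>2 - 2 * inner \<phi> g + (norm g)\<^sup>2" for \<phi> :: L2
      unfolding power2_norm_eq_inner by (simp add: inner_diff_left inner_diff_right inner_commute[of g \<phi>])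
    show "sq_err (?p + ?e) g = sq_err (f + ?e) g + ((norm (?p + ?e))\<^sup>2 - (norm (f + ?e))\<^sup>2)"
      unfolding exp inner_add_left i by simp
  qed
qed

lemma noise_le_step_embed:
  assumes n: "1 \<le> n"
    and b: "\<And>i j. 1 \<le> i \<Longrightarrow> i \<le> j \<Longrightarrow> j \<le> n \<Longrightarrow> (\<Sum>k=i..j. x k)\<^sup>2 / real (j - i + 1) \<le> \<beta>"
  shows "noise_le n (step_embed n x) (\<beta> / real n)"
  unfolding noise_le_def
proof (intro conjI ballI impI)
  have n0: "0 < real n" using n by simp
  \<comment> \<open>A block of a single term gives a square, which forces
    \<open>\<beta> \<ge> 0\<close>.\<close>
  have "0 \<le> (\<Sum>k=1..1. x k)\<^sup>2 / real (1 - 1 + 1)" by simp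
  also have "\<dots> \<le> \<beta>" by (rule b) (use n in auto)
  finally show "0 \<le> \<beta> / real n" by simp
  fix a c assume "a \<in> grid n" "c \<in> grid n" and ac: "a \<le> c"
  then obtain i j where ij: "a = grid_pt n i" "c = grid_pt n j" "i \<le> n" "j \<le> n" by (auto simp: grid_def)
  have le: "i \<le> j" using ac n0 unfolding ij by (auto simp: divide_le_cancel)
  \<comment> \<open>The interval from \<open>i / n\<close> to \<open>j / n\<close> carries the
    observations \<open>i + 1\<close> to \<open>j\<close>, that is \<open>j - i\<close>
    terms.\<close>
  have "(\<Sum>k=Suc i..j. x k)\<^sup>2 \<le> \<beta> * real (j - i)"
  proof (cases "i = j")
    case False
    then have s: "Suc i \<le> j" "j - Suc i + 1 = j - i" using le by auto
    have "(\<Sum>k=Suc i..j. x k)\<^sup>2 / real (j - i) \<le> \<beta>" using b[OF _ s(1) ij(4)] unfolding s(2) by simp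
    then show ?thesis using s(1) by (subst (asm) pos_divide_le_eq) auto
  qed simp
  then have "(\<Sum>k=Suc i..j. x k)\<^sup>2 / (real n)\<^sup>2 \<le> \<beta> * real (j - i) / (real n)\<^sup>2" by (rule divide_right_mono) simp
  also have "\<dots> = \<beta> / real n * (grid_pt n j - grid_pt n i)"
    using le by (simp add: of_nat_diff power2_eq_square diff_divide_distrib[symmetric])
  finally show "(inner (step_embed n x) (L2_indicator a c))\<^sup>2 \<le> \<beta> / real n * (c - a)"
    unfolding ij inner_step_embed_indicator[OF n le ij(4)] power_divide .
qed

section \<open>Convergence of the scale spaces\<close>

text \<open>A finite set of values is discrete, so a path that converges from one side is eventually
  constant there.\<close>

lemma
  fixes x :: "real \<Rightarrow> 'a::metric_space"
  assumes x: "x \<in> skorokhod_space" and fin: "\<And>T. finite (x ` {0..T})"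
  shows skorokhod_finite_range_right: "0 \<le> t \<Longrightarrow> \<forall>\<^sub>F s in at_right t. x s = x t"
    and skorokhod_finite_range_left: "0 < t \<Longrightarrow> \<exists>a. \<forall>\<^sub>F s in at_left t. x s = a"
proof -
  have const: "\<forall>\<^sub>F s in F. x s = a" if "(x \<longlongrightarrow> a) F" "\<forall>\<^sub>F s in F. s \<in> {0..T}" for a T and F :: "real filter"
  proof -
    have "finite (x ` {0..T} - {a})" using fin by blast
    then have "open (- (x ` {0..T} - {a}))" by (intro open_Compl finite_imp_closed)
    then have "\<forall>\<^sub>F s in F. x s \<in> - (x ` {0..T} - {a})" by (rule topological_tendstoD[OF that(1)]) simp
    with that(2) show ?thesis by eventually_elim blast
  qed
  show "\<forall>\<^sub>F s in at_right t. x s = x t" if t: "0 \<le> t"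
  proof (rule const)
    show "(x \<longlongrightarrow> x t) (at_right t)" using x t by (simp add: skorokhod_space_def continuous_within)
    show "\<forall>\<^sub>F s in at_right t. s \<in> {0..t + 1}"
      by (rule eventually_at_rightI[of t "t + 1"]) (use t in auto)
  qed
  show "\<exists>a. \<forall>\<^sub>F s in at_left t. x s = a" if t: "0 < t"
  proof -
    obtain a where a: "(x \<longlongrightarrow> a) (at_left t)" using x t by (auto simp: skorokhod_space_def)
    have "\<forall>\<^sub>F s in at_left t. s \<in> {0..t}" by (rule eventually_at_leftI[OF _ t]) auto
    from const[OF a this] show ?thesis by blast
  qed
qed

text \<open>Meant for \<open>F = cadlag_rep\<close>, which is not continuous from \<open>L2\<close>
  to \<open>D01\<close>. A path with finitely many values on bounded intervals is locally constant
  on each side of every time, and any map preserves this.\<close>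

lemma skorokhod_map:
  fixes x :: "real \<Rightarrow> 'a::metric_space" and F :: "'a \<Rightarrow> 'b::metric_space"
  assumes x: "x \<in> skorokhod_space" and fin: "\<And>T. finite (x ` {0..T})"
  shows "(\<lambda>z\<in>{0..}. F (x z)) \<in> skorokhod_space"
  unfolding skorokhod_space_def
proof (intro CollectI conjI allI impI)
  let ?y = "\<lambda>z\<in>{0..}. F (x z)"
  show "?y \<in> extensional {0..}" by simp
  show "continuous (at_right t) ?y" if t: "0 \<le> t" for t
    unfolding continuous_within
  proof (rule tendsto_eventually)
    have "\<forall>\<^sub>F s in at_right t. t < s" by (simp add: eventually_at_filter)
    with skorokhod_finite_range_right[OF x fin t] show "\<forall>\<^sub>F s in at_right t. ?y s = ?y t"
      by eventually_elim (use t in simp)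
  qed
  show "\<exists>a. (?y \<longlongrightarrow> a) (at_left t)" if t: "0 < t" for t
  proof -
    obtain a where "\<forall>\<^sub>F s in at_left t. x s = a" using skorokhod_finite_range_left[OF x fin t] by blast
    moreover have "\<forall>\<^sub>F s in at_left t. 0 < s" by (rule eventually_at_leftI[OF _ t]) simp
    ultimately have "\<forall>\<^sub>F s in at_left t. ?y s = F a" by eventually_elim simp
    then show ?thesis by (blast intro: tendsto_eventually)
  qed
qed

lemma limitin_J1_topology:
  fixes y :: "real \<Rightarrow> 'a::metric_space"
  assumes "y \<in> skorokhod_space" "\<forall>\<^sub>F n in sequentially. x n \<in> skorokhod_space"
    "(\<lambda>n. J1_dist (x n) y) \<longlonglongrightarrow> 0"
  shows "limitin J1_topology x y sequentially"
proof -
  interpret Metric_space "skorokhod_space :: (real \<Rightarrow> 'a) set" J1_dist by (rule Metric_space_J1)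
  show ?thesis
    unfolding J1_topology_def limitin_metric
  proof (intro conjI allI impI assms(1))
    fix e :: real assume "0 < e"
    with assms(3) have "\<forall>\<^sub>F n in sequentially. J1_dist (x n) y < e" by (rule order_tendstoD(2))
    with assms(2) show "\<forall>\<^sub>F n in sequentially. x n \<in> skorokhod_space \<and> J1_dist (x n) y < e"
      by eventually_elim simp
  qed
qed

text \<open>A minimizer is the projection onto its own jump set, and the grid has only finitely many
  subsets.\<close>

lemma finite_opt_sets:
  assumes "1 \<le> m"
  shows "finite (\<Union>z. opt_set (grid_steps m) \<phi> z)"
proof (rule finite_subset)
  have "grid m = (\<lambda>i. real i / real m) ` {..m}" by (auto simp: grid_def)
  then have "finite (grid m)" by simp
  then show "finite ((\<lambda>J. step_proj (card J) \<phi> (pts_of J)) ` Pow (grid m))" by simp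
  show "(\<Union>z. opt_set (grid_steps m) \<phi> z) \<subseteq> (\<lambda>J. step_proj (card J) \<phi> (pts_of J)) ` Pow (grid m)"
  proof
    fix u assume "u \<in> (\<Union>z. opt_set (grid_steps m) \<phi> z)"
    then obtain z where u: "u \<in> opt_set (grid_steps m) \<phi> z" by blast
    then have "jump_set u \<in> Pow (grid m)" by (simp add: opt_set_def grid_steps_def)
    with opt_set_eq_proj[OF u assms] show "u \<in> (\<lambda>J. step_proj (card J) \<phi> (pts_of J)) ` Pow (grid m)" by blast
  qed
qed

lemma counting_path_njumps:
  assumes x: "x \<in> skorokhod_space" and opt: "\<And>z. 0 \<le> z \<Longrightarrow> x z \<in> opt_set X \<phi> z" and fin: "\<And>T. finite (x ` {0..T})"
  shows "counting_path (\<lambda>z. njumps (x z))"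
  unfolding counting_path_def
proof (intro conjI allI impI)
  fix s t :: real assume "0 \<le> s" "s \<le> t"
  then show "njumps (x s) \<le> njumps (x t)"
    using opt_set_njumps_mono[OF opt opt, of s t] by (cases "s = t") auto
next
  fix t :: real assume t: "0 \<le> t"
  obtain b where b: "t < b" "\<And>s. t < s \<Longrightarrow> s < b \<Longrightarrow> x s = x t"
    using skorokhod_finite_range_right[OF x fin t] unfolding eventually_at_right_field by auto
  show "\<exists>d>0. \<forall>s. t \<le> s \<longrightarrow> s < t + d \<longrightarrow> njumps (x s) = njumps (x t)"
  proof (intro exI[of _ "b - t"] conjI allI impI)
    fix s assume "t \<le> s" "s < t + (b - t)"
    then show "njumps (x s) = njumps (x t)" using b(2)[of s] by (cases "s = t") auto
  qed (use b in simp)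
qed

context scale_space
begin

lemma counting_path_hi_count: "counting_path (hi_count f)"
  unfolding counting_path_def
proof (intro conjI allI impI)
  fix s t :: real assume "0 \<le> s" "s \<le> t"
  then show "hi_count f s \<le> hi_count f t"
    using opt_counts_mono[OF hi_count_mem[of s f] hi_count_mem[of t f]] by (cases "s = t") auto
next
  fix t :: real assume t: "0 \<le> t"
  show "\<exists>d>0. \<forall>s. t \<le> s \<longrightarrow> s < t + d \<longrightarrow> hi_count f s = hi_count f t"
    using hi_count_near[OF t] by metis
qed

lemma finite_limit_path: "finite (limit_path ` {0..T})"
proof (rule finite_subset)
  show "limit_path ` {0..T} \<subseteq> best_fit f ` {..hi_count f T}"
    using counting_path_mono[OF counting_path_hi_count] by (auto simp: limit_path_def)
qed simp

text \<open>One instance of \<open>count_convergence\<close> serves both target spaces; only the map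
  from counts to functions changes.\<close>

lemma paths_converge:
  assumes e: "\<forall>\<^sub>F n in sequentially. noise_le n (e n) (c n)" "c \<longlonglongrightarrow> 0"
    and x: "\<And>n. 1 \<le> n \<Longrightarrow> x n \<in> skorokhod_space"
    and opt: "\<And>n z. 1 \<le> n \<Longrightarrow> 0 \<le> z \<Longrightarrow> x n z \<in> opt_set (grid_steps n) (f + e n) z"
  shows "limitin J1_topology (\<lambda>n. \<lambda>\<zeta>\<in>{0..}. cadlag_rep (x n \<zeta>)) (\<lambda>\<zeta>\<in>{0..}. cadlag_rep (limit_path \<zeta>)) sequentially"
    and "limitin J1_topology x limit_path sequentially"
proof -
  have ge1: "\<forall>\<^sub>F n in sequentially. 1 \<le> (n::nat)" by (rule eventually_ge_at_top)
  have fin: "finite (x n ` {0..T})" if n: "1 \<le> n" for n T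
  proof (rule finite_subset[OF _ finite_opt_sets[OF n, of "f + e n"]])
    have "x n z \<in> (\<Union>z. opt_set (grid_steps n) (f + e n) z)" if "0 \<le> z" for z using opt[OF n that] by blast
    then show "x n ` {0..T} \<subseteq> (\<Union>z. opt_set (grid_steps n) (f + e n) z)" by (simp add: image_subset_iff)
  qed
  interpret count_convergence "\<lambda>n z. njumps (x n z)" "hi_count f" "lo_count f" "opt_counts f"
  proof
    show "counting_path (hi_count f)" by (rule counting_path_hi_count)
    show "\<forall>\<^sub>F n in sequentially. counting_path (\<lambda>z. njumps (x n z))"
      using ge1 by eventually_elim (rule counting_path_njumps[OF x opt fin])
    show "lo_count f t \<in> opt_counts f t" if "0 \<le> t" for t by (rule lo_count_mem[OF that])
    show "lo_count f 0 = hi_count f 0" by (simp add: lo_count_0 hi_count_0)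
    show "j = lo_count f t \<or> j = hi_count f t" if "0 \<le> t" "j \<in> opt_counts f t" for t j
      by (rule opt_counts_cases[OF that])
    show "\<exists>d>0. (\<forall>s. t < s \<longrightarrow> s < t + d \<longrightarrow> opt_counts f s = {hi_count f t}) \<and>
        (\<forall>s. 0 \<le> s \<longrightarrow> t - d < s \<longrightarrow> s < t \<longrightarrow> opt_counts f s = {lo_count f t} \<and> hi_count f s = lo_count f t)"
      if t: "0 \<le> t" for t
    proof -
      obtain d where d: "0 < d" "\<And>s. t < s \<Longrightarrow> s < t + d \<Longrightarrow> opt_counts f s = {hi_count f t}"
        "\<And>s. 0 \<le> s \<Longrightarrow> t - d < s \<Longrightarrow> s < t \<Longrightarrow> opt_counts f s = {lo_count f t}"
        using opt_counts_near[OF t, of f] by metis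
      have "hi_count f s = lo_count f t" if "0 \<le> s" "t - d < s" "s < t" for s
        using d(3)[OF that] by (simp add: hi_count_def)
      then show ?thesis using d by blast
    qed
    show "\<exists>d>0. \<forall>\<^sub>F n in sequentially. \<forall>s\<ge>0. \<bar>s - t\<bar> < d \<longrightarrow> njumps (x n s) \<in> opt_counts f t"
      if t: "0 \<le> t" for t
    proof -
      obtain d where d: "0 < d" "\<forall>\<^sub>F n in sequentially. \<forall>z'\<ge>0. \<bar>z' - t\<bar> < d \<longrightarrow>
          (\<forall>u\<in>opt_set (grid_steps n) (f + e n) z'. njumps u \<in> opt_counts f t)"
        using empirical_counts_near[OF e t] by blast
      from d(2) ge1 have "\<forall>\<^sub>F n in sequentially. \<forall>s\<ge>0. \<bar>s - t\<bar> < d \<longrightarrow> njumps (x n s) \<in> opt_counts f t"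
        by eventually_elim (use opt in blast)
      then show ?thesis using d(1) by blast
    qed
  qed
  have close: "\<forall>\<^sub>F n in sequentially. \<forall>t. 0 \<le> t \<and> t \<le> T \<longrightarrow> dist (x n t) (best_fit f (njumps (x n t))) < \<epsilon> \<and>
      dist (cadlag_rep (x n t)) (cadlag_rep (best_fit f (njumps (x n t)))) < \<epsilon>" if "0 < \<epsilon>" for T \<epsilon>
    using empirical_close[OF e that, of T] ge1 by eventually_elim (use opt in blast)
  show "limitin J1_topology (\<lambda>n. \<lambda>\<zeta>\<in>{0..}. cadlag_rep (x n \<zeta>)) (\<lambda>\<zeta>\<in>{0..}. cadlag_rep (limit_path \<zeta>)) sequentially"
  proof (rule limitin_J1_topology)
    show "(\<lambda>\<zeta>\<in>{0..}. cadlag_rep (limit_path \<zeta>)) \<in> skorokhod_space"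
      by (rule skorokhod_map[OF limit_path_skorokhod finite_limit_path])
    show "\<forall>\<^sub>F n in sequentially. (\<lambda>\<zeta>\<in>{0..}. cadlag_rep (x n \<zeta>)) \<in> skorokhod_space"
      using ge1 by eventually_elim (rule skorokhod_map[OF x fin])
    show "(\<lambda>n. J1_dist (\<lambda>\<zeta>\<in>{0..}. cadlag_rep (x n \<zeta>)) (\<lambda>\<zeta>\<in>{0..}. cadlag_rep (limit_path \<zeta>))) \<longlonglongrightarrow> 0"
    proof (rule J1_dist_tendsto[where G = "\<lambda>k. cadlag_rep (best_fit f k)"])
      fix T \<epsilon> :: real assume "0 < \<epsilon>"
      from close[OF this, of T] show "\<forall>\<^sub>F n in sequentially. \<forall>t. 0 \<le> t \<and> t \<le> T \<longrightarrow>
          dist ((\<lambda>\<zeta>\<in>{0..}. cadlag_rep (x n \<zeta>)) t) (cadlag_rep (best_fit f (njumps (x n t)))) < \<epsilon>"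
        by eventually_elim simp
    qed (simp add: limit_path_def)
  qed
  show "limitin J1_topology x limit_path sequentially"
  proof (rule limitin_J1_topology[OF limit_path_skorokhod])
    show "\<forall>\<^sub>F n in sequentially. x n \<in> skorokhod_space" using ge1 by eventually_elim (rule x)
    show "(\<lambda>n. J1_dist (x n) limit_path) \<longlonglongrightarrow> 0"
    proof (rule J1_dist_tendsto[where G = "best_fit f"])
      fix T \<epsilon> :: real assume "0 < \<epsilon>"
      from close[OF this, of T] show "\<forall>\<^sub>F n in sequentially. \<forall>t. 0 \<le> t \<and> t \<le> T \<longrightarrow>
          dist (x n t) (best_fit f (njumps (x n t))) < \<epsilon>"
        by eventually_elim blast
    qed (simp add: limit_path_def)
  qed
qed

end

lemma scale_space_H_limit:
  assumes "countable {\<gamma>::real. 0 < \<gamma> \<and> card (argmin (\<lambda>g. H_limit (ennreal \<gamma>) g f) UNIV) \<noteq> 1}"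
    and "\<And>\<gamma>::real. 0 \<le> \<gamma> \<Longrightarrow> finite (argmin (\<lambda>g. H_limit (ennreal \<gamma>) g f) UNIV)
           \<and> card (argmin (\<lambda>g. H_limit (ennreal \<gamma>) g f) UNIV) \<le> 2"
  shows "scale_space f"
proof -
  have eq: "opt_set step_functions f z = argmin (\<lambda>g. H_limit (ennreal (1 / z)) g f) UNIV" if "0 < z" for z
    using argmin_H_limit[of z f] divide_ennreal[of 1 z] that by simp
  show ?thesis
  proof
    show "countable {z. 0 < z \<and> card (opt_set step_functions f z) \<noteq> 1}"
    proof (rule countable_subset)
      show "{z. 0 < z \<and> card (opt_set step_functions f z) \<noteq> 1} \<subseteq>
        (\<lambda>\<gamma>. 1 / \<gamma>) ` {\<gamma>. 0 < \<gamma> \<and> card (argmin (\<lambda>g. H_limit (ennreal \<gamma>) g f) UNIV) \<noteq> 1}"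
      proof
        fix z assume "z \<in> {z. 0 < z \<and> card (opt_set step_functions f z) \<noteq> 1}"
        then have z: "0 < z" "card (opt_set step_functions f z) \<noteq> 1" by auto
        show "z \<in> (\<lambda>\<gamma>. 1 / \<gamma>) ` {\<gamma>. 0 < \<gamma> \<and> card (argmin (\<lambda>g. H_limit (ennreal \<gamma>) g f) UNIV) \<noteq> 1}"
          by (rule image_eqI[of _ _ "1 / z"]) (use z eq[OF z(1)] in simp_all)
      qed
      show "countable ((\<lambda>\<gamma>. 1 / \<gamma>) ` {\<gamma>. 0 < \<gamma> \<and> card (argmin (\<lambda>g. H_limit (ennreal \<gamma>) g f) UNIV) \<noteq> 1})"
        using assms(1) by (rule countable_image)
    qed
    show "finite (opt_set step_functions f z) \<and> card (opt_set step_functions f z) \<le> 2" if "0 < z" for z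
      unfolding eq[OF that] using that by (intro assms(2)) simp
  qed
qed

theorem theorem4:
  fixes M :: "'w measure" and \<xi> :: "nat \<Rightarrow> nat \<Rightarrow> 'w \<Rightarrow> real" and f :: L2
  assumes "prob_space M"
    and "centered_array M \<xi>"
    and "condition_A M \<xi>"
    and "countable {\<gamma>::real. 0 < \<gamma> \<and> card (argmin (\<lambda>g. H_limit (ennreal \<gamma>) g f) UNIV) \<noteq> 1}"
    and "\<And>\<gamma>::real. 0 \<le> \<gamma> \<Longrightarrow> finite (argmin (\<lambda>g. H_limit (ennreal \<gamma>) g f) UNIV)
           \<and> card (argmin (\<lambda>g. H_limit (ennreal \<gamma>) g f) UNIV) \<le> 2"
  shows "(\<exists>!\<tau>. \<tau> \<in> skorokhod_space \<and>
            (\<forall>\<zeta>\<ge>0. \<tau> \<zeta> \<in> argmin (\<lambda>g. H_limit (1 / ennreal \<zeta>) g f) UNIV)) \<and>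
         (\<forall>\<tau> \<tau>hat.
            \<tau> \<in> skorokhod_space \<and>
            (\<forall>\<zeta>\<ge>0. \<tau> \<zeta> \<in> argmin (\<lambda>g. H_limit (1 / ennreal \<zeta>) g f) UNIV) \<and>
            (\<forall>n\<ge>1. \<forall>\<omega>\<in>space M.
               \<tau>hat n \<omega> \<in> skorokhod_space \<and>
               (\<forall>\<zeta>\<ge>0. \<tau>hat n \<omega> \<zeta> \<in> step_embed n `
                  argmin (\<lambda>u. H_emp (1 / ennreal \<zeta>) n u (regression_data f \<xi> n \<omega>))
                    ({1..n} \<rightarrow>\<^sub>E UNIV))) \<longrightarrow>
            (AE \<omega> in M.
               limitin J1_topology (\<lambda>n. \<lambda>\<zeta>\<in>{0..}. cadlag_rep (\<tau>hat n \<omega> \<zeta>))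
                 (\<lambda>\<zeta>\<in>{0..}. cadlag_rep (\<tau> \<zeta>)) sequentially \<and>
               limitin J1_topology (\<lambda>n. \<tau>hat n \<omega>) \<tau> sequentially))"
proof -
  interpret scale_space f by (rule scale_space_H_limit[OF assms(4,5)])
  let ?path = "\<lambda>\<tau>. \<tau> \<in> skorokhod_space \<and> (\<forall>\<zeta>\<ge>0. \<tau> \<zeta> \<in> argmin (\<lambda>g. H_limit (1 / ennreal \<zeta>) g f) UNIV)"
  let ?emp = "\<lambda>\<tau>hat. \<forall>n\<ge>1. \<forall>\<omega>\<in>space M. \<tau>hat n \<omega> \<in> skorokhod_space \<and>
               (\<forall>\<zeta>\<ge>0. \<tau>hat n \<omega> \<zeta> \<in> step_embed n `
                  argmin (\<lambda>u. H_emp (1 / ennreal \<zeta>) n u (regression_data f \<xi> n \<omega>))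
                    ({1..n} \<rightarrow>\<^sub>E UNIV))"
  let ?lim = "\<lambda>\<tau>hat \<tau>. AE \<omega> in M.
      limitin J1_topology (\<lambda>n. \<lambda>\<zeta>\<in>{0..}. cadlag_rep (\<tau>hat n \<omega> \<zeta>)) (\<lambda>\<zeta>\<in>{0..}. cadlag_rep (\<tau> \<zeta>)) sequentially \<and>
      limitin J1_topology (\<lambda>n. \<tau>hat n \<omega>) \<tau> sequentially"
  have path: "?path limit_path" using limit_path_skorokhod limit_path_opt argmin_H_limit by simp
  have unique: "\<tau> = limit_path" if "?path \<tau>" for \<tau>
    by (rule limit_path_unique) (use that argmin_H_limit in auto)
  obtain \<beta> :: "nat \<Rightarrow> real" where \<beta>: "(\<lambda>n. \<beta> n / real n) \<longlonglongrightarrow> 0"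
    and noise: "AE \<omega> in M. \<forall>\<^sub>F n in sequentially.
           (MAX (i, j)\<in>{(i, j). 1 \<le> i \<and> i \<le> j \<and> j \<le> n}.
              (\<Sum>k = i..j. \<xi> n k \<omega>)\<^sup>2 / real (j - i + 1)) \<le> \<beta> n"
    using assms(3) unfolding condition_A_def by blast
  have conv: "?lim \<tau>hat limit_path"
    if emp: "?emp \<tau>hat" for \<tau>hat
    using noise AE_space
  proof eventually_elim
    case (elim \<omega>)
    let ?e = "\<lambda>n. step_embed n (\<lambda>i. \<xi> n i \<omega>)"
    have e: "\<forall>\<^sub>F n in sequentially. noise_le n (?e n) (\<beta> n / real n)"
      using elim(1) eventually_ge_at_top[of "1::nat"]
    proof eventually_elim
      case (elim n)
      show ?case
      proof (rule noise_le_step_embed[OF elim(2)])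
        fix i j assume ij: "1 \<le> i" "i \<le> j" "j \<le> n"
        let ?V = "(\<lambda>(i, j). (\<Sum>k = i..j. \<xi> n k \<omega>)\<^sup>2 / real (j - i + 1)) ` {(i, j). 1 \<le> i \<and> i \<le> j \<and> j \<le> n}"
        have "{(i, j). 1 \<le> i \<and> i \<le> j \<and> j \<le> n} \<subseteq> {..n} \<times> {..n}" by auto
        then have "finite {(i, j). 1 \<le> i \<and> i \<le> j \<and> j \<le> n}"
          by (rule finite_subset) (intro finite_cartesian_product finite_atMost)
        then have "finite ?V" by (rule finite_imageI)
        then have "(\<Sum>k = i..j. \<xi> n k \<omega>)\<^sup>2 / real (j - i + 1) \<le> Max ?V"
          by (rule Max_ge) (use ij in force)
        also have "\<dots> \<le> \<beta> n" by (rule elim(1))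
        finally show "(\<Sum>k = i..j. \<xi> n k \<omega>)\<^sup>2 / real (j - i + 1) \<le> \<beta> n" .
      qed
    qed
    have opt: "\<tau>hat n \<omega> z \<in> opt_set (grid_steps n) (f + ?e n) z" if "1 \<le> n" "0 \<le> z" for n z
      using emp elim(2) that argmin_H_emp[OF that, of "regression_data f \<xi> n \<omega>"]
      unfolding opt_set_regression_data[OF that(1), of f \<xi> \<omega> z] by blast
    have sk: "\<tau>hat n \<omega> \<in> skorokhod_space" if "1 \<le> n" for n using emp elim(2) that by blast
    show ?case using paths_converge[OF e \<beta> sk opt] by blast
  qed
  show ?thesis
  proof (intro conjI allI impI)
    show "\<exists>!\<tau>. ?path \<tau>"
    proof (rule ex1I)
      show "?path limit_path" by (rule path)
      show "\<tau> = limit_path" if "?path \<tau>" for \<tau> by (rule unique[OF that])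
    qed
  next
    fix \<tau> \<tau>hat
    assume a: "\<tau> \<in> skorokhod_space \<and>
      (\<forall>\<zeta>\<ge>0. \<tau> \<zeta> \<in> argmin (\<lambda>g. H_limit (1 / ennreal \<zeta>) g f) UNIV) \<and> ?emp \<tau>hat"
    have "\<tau> = limit_path" by (rule unique[OF conjI[OF a[THEN conjunct1] a[THEN conjunct2, THEN conjunct1]]])
    then show "?lim \<tau>hat \<tau>"
      using conv[OF a[THEN conjunct2, THEN conjunct2]] by (simp only:)
  qed
qed

end
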